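(* Let $(\Omega,\mathcal G,\mu,\{\tau_x\}_{x\in\mathbb R^d})$ be a stationary and ergodic random environment and $a:\Omega\to\mathbb R^{d\times d}$ a $\mathcal G$-measurable symmetric matrix. Assume that there are $\mathcal G$-measurable, positive and finite $\lambda,\Lambda$ such that: $\lambda(\omega)|\xi|^2\le\langle a(\omega)\xi,\xi\rangle\le\Lambda(\omega)|\xi|^2$ for $\mu$-a.a. $\omega$ and all $\xi\in\mathbb R^d$; $\mathbb E_\mu[\lambda^{-q}]<\infty$ and $\mathbb E_\mu[\Lambda^p]<\infty$ for some $p,q\in[1,\infty]$ with $1/p+1/q<2/d$; and $x\mapsto\lambda^{-1}(\tau_x\omega)$, $x\mapsto\Lambda(\tau_x\omega)$ are in $L^\infty_{loc}(\mathbb R^d)$ for $\mu$-a.a. $\omega$. For $\mu$-almost all $\omega$ let $\mathbf M^\omega=(X^\omega_t,\mathbb P^\omega_x,\zeta^\omega)$, $x\in\mathbb R^d$, be the minimal diffusion associated to $(\mathcal E^\omega,\mathcal F^\omega)$ on $L^2(\mathbb R^d,dx)$. Then, for $\mu$-almost all $\omega$, this diffusion is conservative: $\mathbb P^\omega_x(\zeta^\omega=\infty)=1$ for all $x\in\mathbb R^d$.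
   Context: A stationary and ergodic random environment is a probability space $(\Omega,\mathcal G,\mu)$ with a group of transformations $\{\tau_x\}_{x\in\mathbb R^d}$ of $\Omega$ ($\tau_{x+y}=\tau_x\tau_y$, $\tau_0=\mathrm{id}$) such that: $\mu(\tau_xA)=\mu(A)$ for all $A\in\mathcal G$, $x\in\mathbb R^d$; if $\tau_xA=A$ for all $x$ then $\mu(A)\in\{0,1\}$; and $(x,\omega)\mapsto\tau_x\omega$ is $\mathcal B(\mathbb R^d)\otimes\mathcal G$-measurable. For infinite exponents the moment conditions mean essential boundedness. Write $a^\omega(x)=a(\tau_x\omega)$ and $\mathcal E^\omega(u,v)=\sum_{i,j}\int_{\mathbb R^d}a^\omega_{ij}\partial_iu\,\partial_jv\,dx$. $\mathcal F^\omega$ is the closure of $C_0^\infty(\mathbb R^d)$ in $L^2(\mathbb R^d,dx)$ with respect to $\mathcal E^\omega+(\cdot,\cdot)_{L^2(dx)}$; for an open ball $B$, $\mathcal F^\omega_B$ is the analogous closure of $C_0^\infty(B)$ in $L^2(B,dx)$. Minimal diffusion: the (unique in law) standard diffusion process $(X^\omega_t,\mathbb P^\omega_x,\zeta^\omega)$ with lifetime $\zeta^\omega$, associated to $(\mathcal E^\omega,\mathcal F^\omega)$, defined for every starting point $x\in\mathbb R^d$, and such that for every open ball $B$, $\alpha>0$, the killed resolvent $G^B_\alpha f(x)=\mathbb E^\omega_x[\int_0^{\tau_B}e^{-\alpha t}f(X^\omega_t)\,dt]$, $\tau_B=\inf\{t>0:X^\omega_t\in B^c\}$, maps $L^r(B,dx)$,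 $r>d$, into $C_\infty(B)$ (continuous functions on $B$ vanishing at the boundary), and $G^B_\alpha C_\infty(B)$ is dense in $C_\infty(B)$. Here $G^B_\alpha f$ is the continuous version of the unique element of $\mathcal F^\omega_B$ with $\mathcal E^\omega(G^B_\alpha f,v)+\alpha\int_BG^B_\alpha f\,v\,dx=\int_Bfv\,dx$ for all $v\in\mathcal F^\omega_B$. It exists for $\mu$-a.a. $\omega$ under the stated assumptions. *)

theory Defs
  imports "HOL-Probability.Probability" "HOL-Probability.Essential_Supremum"
begin

section \<open>Random environments\<close>

locale stationary_ergodic_environment = prob_space M
  for M :: "'w measure" and \<tau> :: "real ^ 'n \<Rightarrow> 'w \<Rightarrow> 'w" +
  assumes shift_space: "\<omega> \<in> space M \<Longrightarrow> \<tau> x \<omega> \<in> space M"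
    and shift_add: "\<omega> \<in> space M \<Longrightarrow> \<tau> (x + y) \<omega> = \<tau> x (\<tau> y \<omega>)"
    and shift_zero: "\<omega> \<in> space M \<Longrightarrow> \<tau> 0 \<omega> = \<omega>"
    and stationary: "A \<in> sets M \<Longrightarrow> emeasure M (\<tau> x ` A) = emeasure M A"
    and ergodic: "A \<in> sets M \<Longrightarrow> (\<And>x. \<tau> x ` A = A) \<Longrightarrow> emeasure M A \<in> {0, 1}"
    and shift_measurable: "(\<lambda>(x, \<omega>). \<tau> x \<omega>) \<in> borel \<Otimes>\<^sub>M M \<rightarrow>\<^sub>M M"

definition finite_moment :: "'w measure \<Rightarrow> ('w \<Rightarrow> real) \<Rightarrow> ennreal \<Rightarrow> bool" where
  "finite_moment M f p \<longleftrightarrow>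
     (if p = \<infinity> then esssup M (\<lambda>\<omega>. ereal \<bar>f \<omega>\<bar>) < \<infinity>
      else (\<integral>\<^sup>+\<omega>. ennreal (\<bar>f \<omega>\<bar> powr enn2real p) \<partial>M) < \<infinity>)"

definition Linfty_loc :: "(real ^ 'n \<Rightarrow> real) \<Rightarrow> bool" where
  "Linfty_loc f \<longleftrightarrow> f \<in> borel_measurable borel \<and>
     (\<forall>K. compact K \<longrightarrow> esssup (restrict_space lborel K) (\<lambda>x. ereal \<bar>f x\<bar>) < \<infinity>)"

section \<open>The Dirichlet form\<close>

text \<open>Elements of Lebesgue spaces over \<open>U\<close> are represented by functions on the whole space of which
  only the restriction to \<open>U\<close>, up to null sets, matters.\<close>

definition partial_deriv :: "'n::finite \<Rightarrow> (real ^ 'n \<Rightarrow> real) \<Rightarrow> real ^ 'n \<Rightarrow> real" where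
  "partial_deriv i f x = frechet_derivative f (at x) (axis i 1)"

primrec Ck :: "nat \<Rightarrow> (real ^ 'n::finite \<Rightarrow> real) \<Rightarrow> bool" where
  "Ck 0 f \<longleftrightarrow> continuous_on UNIV f"
| "Ck (Suc k) f \<longleftrightarrow> (\<forall>x. f differentiable (at x)) \<and> (\<forall>i. Ck k (partial_deriv i f))"

definition test_functions :: "(real ^ 'n::finite) set \<Rightarrow> (real ^ 'n \<Rightarrow> real) set" where
  "test_functions U =
     {\<phi>. (\<forall>k. Ck k \<phi>) \<and> compact (closure {x. \<phi> x \<noteq> 0}) \<and> closure {x. \<phi> x \<noteq> 0} \<subseteq> U}"

definition Lp_on :: "real \<Rightarrow> (real ^ 'n::finite) set \<Rightarrow> (real ^ 'n \<Rightarrow> real) set" where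
  "Lp_on r U = {u. set_borel_measurable lborel U u \<and> set_integrable lborel U (\<lambda>x. \<bar>u x\<bar> powr r)}"

definition locally_integrable :: "(real ^ 'n::finite) set \<Rightarrow> (real ^ 'n \<Rightarrow> real) \<Rightarrow> bool" where
  "locally_integrable U u \<longleftrightarrow> (\<forall>K. compact K \<and> K \<subseteq> U \<longrightarrow> set_integrable lborel K u)"

definition has_weak_deriv ::
  "(real ^ 'n::finite) set \<Rightarrow> 'n \<Rightarrow> (real ^ 'n \<Rightarrow> real) \<Rightarrow> (real ^ 'n \<Rightarrow> real) \<Rightarrow> bool" where
  "has_weak_deriv U i u g \<longleftrightarrow> locally_integrable U u \<and> locally_integrable U g \<and>
     (\<forall>\<phi>\<in>test_functions U.
        (LINT x:U|lborel. u x * partial_deriv i \<phi> x) = - (LINT x:U|lborel. g x * \<phi> x))"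

text \<open>Weak derivatives are unique up to null sets, so the choice is irrelevant under the integral in
  \<open>dform\<close>.\<close>

definition weak_deriv ::
  "(real ^ 'n::finite) set \<Rightarrow> 'n \<Rightarrow> (real ^ 'n \<Rightarrow> real) \<Rightarrow> real ^ 'n \<Rightarrow> real" where
  "weak_deriv U i u = (SOME g. has_weak_deriv U i u g)"

text \<open>The sum is inside the integral: for elements of the form domain without compact support the
  sum is integrable, whereas its individual terms need not be.\<close>

definition dform ::
  "(real ^ 'n::finite \<Rightarrow> real ^ 'n ^ 'n) \<Rightarrow> (real ^ 'n) set \<Rightarrow> (real ^ 'n \<Rightarrow> real) \<Rightarrow> (real ^ 'n \<Rightarrow> real) \<Rightarrow> real"
  where
  "dform a U u v =
     (LINT x:U|lborel. \<Sum>i\<in>UNIV. \<Sum>j\<in>UNIV. a x $ i $ j * weak_deriv U i u x * weak_deriv U j v x)"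

text \<open>The closure of the test functions: \<open>L\<^sup>2\<close>-limits of sequences of test functions that are
  Cauchy for the form (convergence in \<open>L\<^sup>2\<close> makes them Cauchy for the form plus the inner product).\<close>

definition form_domain ::
  "(real ^ 'n::finite \<Rightarrow> real ^ 'n ^ 'n) \<Rightarrow> (real ^ 'n) set \<Rightarrow> (real ^ 'n \<Rightarrow> real) set" where
  "form_domain a U = {u \<in> Lp_on 2 U. \<exists>\<phi> :: nat \<Rightarrow> real ^ 'n \<Rightarrow> real.
     (\<forall>n. \<phi> n \<in> test_functions U) \<and>
     (\<lambda>n. LINT x:U|lborel. (\<phi> n x - u x)\<^sup>2) \<longlonglongrightarrow> 0 \<and>
     (\<forall>e>0. \<exists>k. \<forall>m\<ge>k. \<forall>n\<ge>k.
        dform a U (\<lambda>x. \<phi> m x - \<phi> n x) (\<lambda>x. \<phi> m x - \<phi> n x) < e)}"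

definition form_resolvent ::
  "(real ^ 'n::finite \<Rightarrow> real ^ 'n ^ 'n) \<Rightarrow> (real ^ 'n) set \<Rightarrow> real \<Rightarrow> (real ^ 'n \<Rightarrow> real) \<Rightarrow> (real ^ 'n \<Rightarrow> real) \<Rightarrow> bool"
  where
  "form_resolvent a U \<alpha> f u \<longleftrightarrow> u \<in> form_domain a U \<and>
     (\<forall>v\<in>form_domain a U.
        dform a U u v + \<alpha> * (LINT x:U|lborel. u x * v x) = (LINT x:U|lborel. f x * v x))"

section \<open>Diffusion processes with lifetime\<close>

text \<open>The cemetery is \<open>None\<close>. Time ranges over \<open>[0, \<infinity>]\<close> with the convention that the process is at the
  cemetery at time \<open>\<infinity>\<close>; hence the infima below are over nonempty sets.\<close>

definition cemetery_borel :: "(real ^ 'n) option measure" where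
  "cemetery_borel = sigma UNIV (insert {None} ((`) Some ` sets borel))"

definition lifetime :: "(ennreal \<Rightarrow> 'p \<Rightarrow> 's option) \<Rightarrow> 'p \<Rightarrow> ennreal" where
  "lifetime X w = Inf {t. X t w = None}"

definition exit_time :: "(ennreal \<Rightarrow> 'p \<Rightarrow> 's option) \<Rightarrow> 's set \<Rightarrow> 'p \<Rightarrow> ennreal" where
  "exit_time X U w = Inf {t. 0 < t \<and> X t w \<notin> Some ` U}"

definition natural_filtration ::
  "'p measure \<Rightarrow> (ennreal \<Rightarrow> 'p \<Rightarrow> (real ^ 'n) option) \<Rightarrow> ennreal \<Rightarrow> 'p measure" where
  "natural_filtration S X t =
     sigma (space S) {X s -` A \<inter> space S | s A. s \<le> t \<and> A \<in> sets cemetery_borel}"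

text \<open>Inserting \<open>\<infinity>\<close> has an effect only for \<open>t = \<infinity>\<close>, where the intersection would be over the empty
  set.\<close>

definition right_filtration ::
  "'p measure \<Rightarrow> (ennreal \<Rightarrow> 'p \<Rightarrow> (real ^ 'n) option) \<Rightarrow> ennreal \<Rightarrow> 'p measure" where
  "right_filtration S X t =
     sigma (space S) (\<Inter>s\<in>insert \<infinity> {t<..}. sets (natural_filtration S X s))"

text \<open>The law of the process started at the cemetery is not part of the data: it stays there.\<close>

definition trans_prob ::
  "(real ^ 'n \<Rightarrow> 'p measure) \<Rightarrow> (ennreal \<Rightarrow> 'p \<Rightarrow> (real ^ 'n) option) \<Rightarrow>
   ennreal \<Rightarrow> (real ^ 'n) option \<Rightarrow> (real ^ 'n) option set \<Rightarrow> real" where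
  "trans_prob P X t y A =
     (case y of None \<Rightarrow> indicator A None | Some x \<Rightarrow> measure (P x) {w \<in> space (P x). X t w \<in> A})"

text \<open>\<open>S\<close> only provides the sample space and its sigma-algebra. Right continuity at and after the
  lifetime follows from \<open>absorbed\<close>; the left limits and the quasi-left-continuity before the lifetime
  required of a standard process follow from \<open>continuous_paths\<close>. The strong Markov property is
  required for the smallest right-continuous filtration, hence follows from the one for any larger
  admissible filtration.\<close>

locale standard_diffusion =
  fixes S :: "'p measure" and P :: "real ^ 'n \<Rightarrow> 'p measure"
    and X :: "ennreal \<Rightarrow> 'p \<Rightarrow> (real ^ 'n) option"
  assumes prob_P: "prob_space (P x)"
    and sets_P: "sets (P x) = sets S"
    and measurable_X: "X t \<in> S \<rightarrow>\<^sub>M cemetery_borel"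
    and measurable_P: "A \<in> sets cemetery_borel \<Longrightarrow>
          (\<lambda>x. measure (P x) {w \<in> space S. X t w \<in> A}) \<in> borel_measurable borel"
    and normal: "measure (P x) {w \<in> space S. X 0 w = Some x} = 1"
    and at_infinity: "w \<in> space S \<Longrightarrow> X \<infinity> w = None"
    and absorbed: "w \<in> space S \<Longrightarrow> lifetime X w \<le> t \<Longrightarrow> X t w = None"
    and right_continuous: "w \<in> space S \<Longrightarrow> t < lifetime X w \<Longrightarrow>
          ((\<lambda>s. the (X s w)) \<longlongrightarrow> the (X t w)) (at_right t)"
    and continuous_paths: "AE w in P x. continuous_on {0..<lifetime X w} (\<lambda>t. the (X t w))"
    and strong_Markov:
      "stopping_time (right_filtration S X) T \<Longrightarrow>
       \<Gamma> \<in> sets (filtration.pre_sigma (space S) (right_filtration S X) T) \<Longrightarrow>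
       A \<in> sets cemetery_borel \<Longrightarrow>
       measure (P x) {w \<in> \<Gamma>. X (T w + s) w \<in> A} = (LINT w:\<Gamma>|P x. trans_prob P X s (X (T w) w) A)"

text \<open>The resolvent of the process killed on leaving \<open>U\<close>; functions vanish at the cemetery. For
  \<open>U = UNIV\<close> it is the resolvent of the process itself. The completion is needed because paths are
  continuous only almost surely, so the exit time is measurable only up to null sets.\<close>

definition killed_resolvent ::
  "(real ^ 'n \<Rightarrow> 'p measure) \<Rightarrow> (ennreal \<Rightarrow> 'p \<Rightarrow> (real ^ 'n) option) \<Rightarrow> (real ^ 'n) set \<Rightarrow> real \<Rightarrow>
   (real ^ 'n \<Rightarrow> real) \<Rightarrow> real ^ 'n \<Rightarrow> real" where
  "killed_resolvent P X U \<alpha> f x =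
     (LINT w|completion (P x). (LINT t:{t. 0 < t \<and> ennreal t < exit_time X U w}|lborel.
        exp (- \<alpha> * t) * f (the (X (ennreal t) w))))"

definition killed_resolvent_converges ::
  "(real ^ 'n \<Rightarrow> 'p measure) \<Rightarrow> (ennreal \<Rightarrow> 'p \<Rightarrow> (real ^ 'n) option) \<Rightarrow> (real ^ 'n) set \<Rightarrow> real \<Rightarrow>
   (real ^ 'n \<Rightarrow> real) \<Rightarrow> real ^ 'n \<Rightarrow> bool" where
  "killed_resolvent_converges P X U \<alpha> f x \<longleftrightarrow>
     (\<integral>\<^sup>+w. (\<integral>\<^sup>+t\<in>{t. 0 < t \<and> ennreal t < exit_time X U w}.
        ennreal (exp (- \<alpha> * t) * \<bar>f (the (X (ennreal t) w))\<bar>) \<partial>lborel) \<partial>completion (P x)) < \<infinity>"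

text \<open>Association is expressed on the level of resolvents, which determine the semigroups.\<close>

definition associated ::
  "(real ^ 'n::finite \<Rightarrow> real ^ 'n ^ 'n) \<Rightarrow> (real ^ 'n \<Rightarrow> 'p measure) \<Rightarrow>
   (ennreal \<Rightarrow> 'p \<Rightarrow> (real ^ 'n) option) \<Rightarrow> bool" where
  "associated a P X \<longleftrightarrow> (\<forall>\<alpha>>0. \<forall>f \<in> Lp_on 2 UNIV.
     form_resolvent a UNIV \<alpha> f (killed_resolvent P X UNIV \<alpha> f))"

definition C_infty :: "(real ^ 'n) set \<Rightarrow> (real ^ 'n \<Rightarrow> real) set" where
  "C_infty B = {f. continuous_on B f \<and> (\<forall>z\<in>frontier B. (f \<longlongrightarrow> 0) (at z within B))}"

locale minimal_diffusion = standard_diffusion S P X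
  for a :: "real ^ 'n::finite \<Rightarrow> real ^ 'n ^ 'n" and S :: "'p measure"
    and P :: "real ^ 'n \<Rightarrow> 'p measure" and X :: "ennreal \<Rightarrow> 'p \<Rightarrow> (real ^ 'n) option" +
  assumes associated: "associated a P X"
    and killed_converges: "0 < \<rho> \<Longrightarrow> 0 < \<alpha> \<Longrightarrow> real CARD('n) < r \<Longrightarrow> f \<in> Lp_on r (ball c \<rho>) \<Longrightarrow>
          x \<in> ball c \<rho> \<Longrightarrow> killed_resolvent_converges P X (ball c \<rho>) \<alpha> f x"
    and killed_C_infty: "0 < \<rho> \<Longrightarrow> 0 < \<alpha> \<Longrightarrow> real CARD('n) < r \<Longrightarrow> f \<in> Lp_on r (ball c \<rho>) \<Longrightarrow>
          killed_resolvent P X (ball c \<rho>) \<alpha> f \<in> C_infty (ball c \<rho>)"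
    and killed_form: "0 < \<rho> \<Longrightarrow> 0 < \<alpha> \<Longrightarrow> real CARD('n) < r \<Longrightarrow> f \<in> Lp_on r (ball c \<rho>) \<Longrightarrow>
          form_resolvent a (ball c \<rho>) \<alpha> f (killed_resolvent P X (ball c \<rho>) \<alpha> f)"
    and killed_dense: "0 < \<rho> \<Longrightarrow> 0 < \<alpha> \<Longrightarrow> g \<in> C_infty (ball c \<rho>) \<Longrightarrow> 0 < e \<Longrightarrow>
          \<exists>f \<in> C_infty (ball c \<rho>). \<forall>x \<in> ball c \<rho>.
            \<bar>killed_resolvent P X (ball c \<rho>) \<alpha> f x - g x\<bar> < e"

end

theory Submission
  imports Defs
begin

text \<open>Let \<open>G\<close> be the resolvent of the process at level \<open>1\<close> and \<open>w x = (G 1) x = 1 - E\<^sub>x exp (- \<zeta>)\<close>.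
  Conservativeness means \<open>w = 1\<close>.  For square integrable \<open>f\<close> the number \<open>\<integral> f G f\<close> is the supremum of
  \<open>2 \<integral> f v - \<E>(v, v) - \<integral> v\<^sup>2\<close> over test functions \<open>v\<close>.  Taking for \<open>f\<close> the indicator of the box
  \<open>K\<^sub>N = (-N, N)\<^sup>d\<close> and for \<open>v\<close> a bump \<open>\<phi>\<close> on \<open>K\<^sub>1\<close> rescaled to \<open>K\<^sub>N\<close> bounds the integral of \<open>1 - w\<close>
  over \<open>K\<^sub>N\<close> by \<open>N\<^sup>d \<integral> (1 - \<phi>)\<^sup>2\<close>, taken over \<open>K\<^sub>1\<close>, plus \<open>C\<^sub>\<phi> N\<^sup>-\<^sup>2\<close> times the integral of
  \<open>\<Lambda>(\<tau>\<^sub>x \<omega>)\<close> over a ball of radius of order \<open>N\<close>.  By the same variational formula and polarisation, the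
  integral of \<open>1 - w\<close> over a unit lattice cube is a measurable stationary function of \<open>\<omega>\<close>; as there are
  \<open>N\<^sup>d\<close> such cubes in \<open>K\<^sub>N\<close>, its expectation is at most \<open>\<integral> (1 - \<phi>)\<^sup>2 + C'\<^sub>\<phi> E[\<Lambda>] / N\<^sup>2\<close>.  Letting \<open>N\<close>
  tend to infinity and then \<open>\<phi>\<close> to \<open>1\<close> gives \<open>w = 1\<close> almost everywhere.  The exceptional null set
  is not charged at almost every time before the exit from a ball, because the killed resolvent of its
  indicator is continuous and vanishes almost everywhere; with the Markov property at arbitrarily small
  times this gives conservativeness from every starting point.\<close>

text \<open>The processes of different environments are unrelated data, so a quantity defined
  through them cannot be averaged over \<omega> directly. The variational formula removes this
  obstacle: a supremum of explicit functionals of the coefficients over a countable family of test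
  functions is measurable, and it moves with the coefficients under shifts. It yields only the
  quadratic quantities \<integral> f G f, whence the polarisation; and the constant 1 is not square
  integrable, whence an exhaustion by balls. The estimate itself is a completed square: for f the
  indicator of K and v supported in K the functional equals |K| - \<integral> (1 - v)^2 - \<E>(v,
  v), with the integral over K. Stretching a cut-off by N divides its squared gradient by N^2, while
  the volume of the ball and the number of cubes both grow like N^d; hence a finite mean of
  \<Lambda> makes the energy term vanish. N has to go to infinity before \<phi> varies, since the
  constant depends on \<phi>. The form is written with weak derivatives while its domain is a
  closure. Local bounds on 1/\<lambda> reconcile the two: they turn convergence in energy into local
  L2 convergence of gradients.\<close>

section \<open>Calculus of \<open>Ck\<close> functions\<close>

lemma partial_deriv_eqI: "(f has_derivative f') (at x) \<Longrightarrow> partial_deriv i f x = f' (axis i 1)"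
  unfolding partial_deriv_def by (metis frechet_derivative_at)

lemma partial_deriv_const [simp]: "partial_deriv i (\<lambda>x. c) = (\<lambda>x. 0)"
  by (rule ext, rule partial_deriv_eqI[THEN trans]) (auto intro!: derivative_eq_intros)

lemma Ck_Suc_imp: "Ck (Suc k) f \<Longrightarrow> Ck k f"
proof (induction k arbitrary: f)
  case 0
  then show ?case
    by (auto intro!: continuous_at_imp_continuous_on differentiable_imp_continuous_within)
qed auto

lemma Ck_const: "Ck k (\<lambda>x. c)"
  by (induction k arbitrary: c) (auto intro: derivative_intros)

lemma Ck_add: "Ck k f \<Longrightarrow> Ck k g \<Longrightarrow> Ck k (\<lambda>x. f x + g x)"
proof (induction k arbitrary: f g)
  case 0
  then show ?case by (auto intro: continuous_intros)
next
  case (Suc k)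
  have "partial_deriv i (\<lambda>x. f x + g x) = (\<lambda>x. partial_deriv i f x + partial_deriv i g x)" for i
    using Suc.prems
    by (intro ext) (auto simp: partial_deriv_def frechet_derivative_works
        intro!: partial_deriv_eqI[unfolded partial_deriv_def, THEN trans] derivative_eq_intros)
  with Suc show ?case by (auto intro: derivative_intros)
qed

lemma partial_deriv_mult:
  assumes "f differentiable (at x)" "g differentiable (at x)"
  shows "partial_deriv i (\<lambda>x. f x * g x) x = partial_deriv i f x * g x + f x * partial_deriv i g x"
  using assms
  by (auto simp: partial_deriv_def frechet_derivative_works
      intro!: partial_deriv_eqI[unfolded partial_deriv_def, THEN trans] derivative_eq_intros)

lemma Ck_mult: "Ck k f \<Longrightarrow> Ck k g \<Longrightarrow> Ck k (\<lambda>x. f x * g x)"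
proof (induction k arbitrary: f g)
  case 0
  then show ?case by (auto intro: continuous_intros)
next
  case (Suc k)
  have "partial_deriv i (\<lambda>x. f x * g x) = (\<lambda>x. partial_deriv i f x * g x + f x * partial_deriv i g x)" for i
    using Suc.prems by (auto simp: partial_deriv_mult)
  moreover have "Ck k f" "Ck k g"
    using Suc.prems by (blast intro: Ck_Suc_imp)+
  ultimately show ?case
    using Suc by (auto intro!: derivative_intros Ck_add)
qed

lemma Ck_prod: "finite I \<Longrightarrow> (\<And>i. i \<in> I \<Longrightarrow> Ck k (f i)) \<Longrightarrow> Ck k (\<lambda>x. \<Prod>i\<in>I. f i x)"
  by (induction I rule: finite_induct) (auto intro: Ck_const Ck_mult)

lemma affine_has_derivative:
  fixes f :: "real ^ 'n::finite \<Rightarrow> real"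
  assumes "f differentiable (at (c *\<^sub>R x + b))"
  shows "((\<lambda>x. f (c *\<^sub>R x + b)) has_derivative
      (\<lambda>h. frechet_derivative f (at (c *\<^sub>R x + b)) (c *\<^sub>R h))) (at x)"
proof (rule has_derivative_compose[where g=f and f="\<lambda>x. c *\<^sub>R x + b"])
  show "((\<lambda>x. c *\<^sub>R x + b) has_derivative (*\<^sub>R) c) (at x)"
    by (auto intro!: derivative_eq_intros)
qed (use assms in \<open>simp add: frechet_derivative_works\<close>)

lemma partial_deriv_affine:
  fixes f :: "real ^ 'n::finite \<Rightarrow> real"
  assumes "f differentiable (at (c *\<^sub>R x + b))"
  shows "partial_deriv i (\<lambda>x. f (c *\<^sub>R x + b)) x = c * partial_deriv i f (c *\<^sub>R x + b)"
  using partial_deriv_eqI[OF affine_has_derivative[OF assms], of i] assms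
  by (simp add: partial_deriv_def linear_frechet_derivative linear_scale)

lemma differentiable_affine:
  fixes f :: "real ^ 'n::finite \<Rightarrow> real"
  assumes "f differentiable (at (c *\<^sub>R x + b))"
  shows "(\<lambda>x. f (c *\<^sub>R x + b)) differentiable (at x)"
  using affine_has_derivative[OF assms] by (rule differentiableI)

lemma Ck_affine:
  fixes f :: "real ^ 'n::finite \<Rightarrow> real"
  shows "Ck k f \<Longrightarrow> Ck k (\<lambda>x. f (c *\<^sub>R x + b))"
proof (induction k arbitrary: f)
  case 0
  then show ?case
    by (auto intro!: continuous_intros continuous_on_compose2[of UNIV f])
next
  case (Suc k)
  have "partial_deriv i (\<lambda>x. f (c *\<^sub>R x + b)) = (\<lambda>x. c * partial_deriv i f (c *\<^sub>R x + b))" for i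
    using Suc.prems by (auto simp: partial_deriv_affine)
  moreover have "Ck k (\<lambda>x. c * partial_deriv i f (c *\<^sub>R x + b))" for i
    using Suc by (intro Ck_mult Ck_const) auto
  moreover have "(\<lambda>x. f (c *\<^sub>R x + b)) differentiable (at x)" for x
    using Suc.prems by (intro differentiable_affine) auto
  ultimately show ?case by simp
qed

subsection \<open>Smooth bump functions\<close>

text \<open>The classical flat function exp(-1/t) is \<open>flat 0\<close>. The powers of
  \<open>inverse t\<close> are carried along because the derivative of a member is a combination of
  the next two, so smoothness becomes an induction over all k at once.\<close>

definition flat :: "nat \<Rightarrow> real \<Rightarrow> real" where
  "flat k t = (if t \<le> 0 then 0 else inverse t ^ k * exp (- inverse t))"

lemma flat_tendsto_0: "(flat k \<longlongrightarrow> 0) (at 0)"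
proof -
  have "((\<lambda>s::real. s ^ k / exp s) \<longlongrightarrow> 0) at_top" for k
    by (rule tendsto_power_div_exp_0)
  then have "((\<lambda>t. inverse t ^ k / exp (inverse t)) \<longlongrightarrow> (0::real)) (at_right 0)"
    by (rule filterlim_compose) (rule filterlim_inverse_at_top_right)
  then have "(flat k \<longlongrightarrow> 0) (at_right 0)"
    by (rule Lim_transform_eventually)
      (auto simp: flat_def eventually_at_filter exp_minus divide_inverse)
  moreover have "(flat k \<longlongrightarrow> 0) (at_left 0)"
    by (rule tendsto_eventually) (auto simp: flat_def eventually_at_filter)
  ultimately show ?thesis
    by (simp add: filterlim_split_at)
qed

lemma flat_deriv: "(flat k has_real_derivative flat (k + 2) t - real k * flat (k + 1) t) (at t)"
proof -
  consider "t < 0" | "t = 0" | "t > 0" by linarith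
  then show ?thesis
  proof cases
    case 1
    have "((\<lambda>t. 0::real) has_real_derivative flat (k + 2) t - real k * flat (k + 1) t) (at t)"
      using 1 by (simp add: flat_def)
    then show ?thesis
      by (rule has_field_derivative_transform_within_open[where S="{..<0}"]) (use 1 in \<open>auto simp: flat_def\<close>)
  next
    case 2
    \<comment> \<open>At 0 the difference quotient of \<open>flat k\<close> is
      \<open>flat (k + 1)\<close> itself, so differentiability there is a limit already
      known.\<close>
    have "((\<lambda>h. flat (k + 1) h) \<longlongrightarrow> 0) (at 0)"
      by (rule flat_tendsto_0)
    then have "((\<lambda>h. (flat k (0 + h) - flat k 0) / h) \<longlongrightarrow> 0) (at 0)"
      by (rule Lim_transform_eventually)
        (auto simp: flat_def eventually_at_filter divide_inverse)
    with 2 show ?thesis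
      by (simp add: DERIV_def flat_def)
  next
    case 3
    have "((\<lambda>t. inverse t ^ k) has_real_derivative - (real k * inverse t ^ (k + 1))) (at t)"
      using 3 by (intro DERIV_cong[OF DERIV_power[OF DERIV_inverse]]) (cases k; simp add: algebra_simps)+
    moreover have "((\<lambda>t. exp (- inverse t)) has_real_derivative exp (- inverse t) * inverse t ^ 2) (at t)"
      using 3 by (auto intro!: derivative_eq_intros simp: power2_eq_square)
    ultimately have "((\<lambda>t. inverse t ^ k * exp (- inverse t)) has_real_derivative
        flat (k + 2) t - real k * flat (k + 1) t) (at t)"
      by (rule DERIV_cong[OF DERIV_mult]) (use 3 in \<open>simp add: flat_def algebra_simps power_add power2_eq_square\<close>)
    then show ?thesis
      by (rule has_field_derivative_transform_within_open[where S="{0<..}"]) (use 3 in \<open>auto simp: flat_def\<close>)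
  qed
qed

lemma flat_nonneg: "0 \<le> flat k t"
  by (auto simp: flat_def)

lemma flat_le_1: "flat 0 t \<le> 1"
  by (auto simp: flat_def)

lemma flat_coordinate_deriv:
  "((\<lambda>x::real^'n::finite. flat k (c * x $ j + b)) has_derivative
    (\<lambda>h. (flat (k + 2) (c * x $ j + b) - real k * flat (k + 1) (c * x $ j + b)) * (c * h $ j))) (at x)"
  by (rule has_derivative_compose[OF _ flat_deriv[unfolded has_field_derivative_def]])
     (auto intro!: derivative_eq_intros bounded_linear.has_derivative[OF bounded_linear_vec_nth])

lemma Ck_flat_coordinate: "Ck m (\<lambda>x::real^'n::finite. flat k (c * x $ j + b))"
proof (induction m arbitrary: k)
  case 0
  show ?case
    using flat_coordinate_deriv[THEN has_derivative_continuous]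
    by (auto intro!: continuous_at_imp_continuous_on)
next
  case (Suc m)
  have "partial_deriv i (\<lambda>x. flat k (c * x $ j + b)) =
    (\<lambda>x. flat (k + 2) (c * x $ j + b) * (c * (axis i 1 :: real^'n) $ j) +
         - real k * (c * (axis i 1 :: real^'n) $ j) * flat (k + 1) (c * x $ j + b))" for i
    by (rule ext, rule partial_deriv_eqI[OF flat_coordinate_deriv, THEN trans]) (simp add: algebra_simps)
  moreover have "(\<lambda>x. flat k (c * x $ j + b)) differentiable (at x)" for x
    using flat_coordinate_deriv by (rule differentiableI)
  moreover have "Ck m (\<lambda>x. flat (k + 2) (c * x $ j + b) * (c * (axis i 1 :: real^'n) $ j) +
         - real k * (c * (axis i 1 :: real^'n) $ j) * flat (k + 1) (c * x $ j + b))" for i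
    by (intro Ck_add Ck_mult Ck_const Suc)
  ultimately show ?case by simp
qed

text \<open>Since exp(-1/(n t)) tends to 1 for t > 0, a growing n steepens the profile and these
  test functions tend to the indicator of the open box from below. This takes the place of
  mollification.\<close>

definition box_bump :: "real \<Rightarrow> real ^ 'n::finite \<Rightarrow> real ^ 'n \<Rightarrow> real ^ 'n \<Rightarrow> real" where
  "box_bump n a b x = (\<Prod>i\<in>UNIV. flat 0 (n * (x $ i - a $ i)) * flat 0 (n * (b $ i - x $ i)))"

lemma Ck_box_bump: "Ck k (box_bump n a b)"
proof -
  have "Ck k (\<lambda>x. flat 0 (n * x $ i + (- n * a $ i)) * flat 0 ((- n) * x $ i + n * b $ i))" for i
    by (intro Ck_mult Ck_flat_coordinate)
  then have "Ck k (\<lambda>x. \<Prod>i\<in>UNIV. flat 0 (n * x $ i + (- n * a $ i)) * flat 0 ((- n) * x $ i + n * b $ i))"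
    by (intro Ck_prod) auto
  then show ?thesis
    by (simp add: box_bump_def[abs_def] algebra_simps)
qed

lemma box_bump_nonneg: "0 \<le> box_bump n a b x"
  unfolding box_bump_def by (intro prod_nonneg ballI mult_nonneg_nonneg flat_nonneg)

lemma box_bump_le_1: "box_bump n a b x \<le> 1"
  unfolding box_bump_def
  by (intro prod_le_1 conjI mult_nonneg_nonneg flat_nonneg mult_le_one flat_le_1)

lemma box_bump_eq_0:
  assumes "x \<notin> box a b" "n \<ge> 0" shows "box_bump n a b x = 0"
proof -
  from assms obtain i where "\<not> (a $ i < x $ i \<and> x $ i < b $ i)"
    by (auto simp: mem_box_cart)
  then have "flat 0 (n * (x $ i - a $ i)) * flat 0 (n * (b $ i - x $ i)) = 0"
    using assms(2) by (auto simp: flat_def not_less mult_nonneg_nonpos)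
  then show ?thesis
    unfolding box_bump_def by (intro prod_zero) auto
qed

lemma box_bump_tendsto: "(\<lambda>n. box_bump (real n) a b x) \<longlonglongrightarrow> indicator (box a b) x"
proof (cases "x \<in> box a b")
  case False
  then show ?thesis by (simp add: box_bump_eq_0)
next
  case True
  have *: "(\<lambda>n. flat 0 (real n * t)) \<longlonglongrightarrow> 1" if "t > 0" for t
  proof -
    have "(\<lambda>n. exp (- (inverse (real n) * inverse t))) \<longlonglongrightarrow> exp (- (0 * inverse t))"
      by (intro tendsto_intros lim_inverse_n)
    then have "(\<lambda>n. exp (- (inverse (real n) * inverse t))) \<longlonglongrightarrow> 1"
      by simp
    then show ?thesis
      by (rule Lim_transform_eventually)
        (use that in \<open>auto simp: flat_def eventually_sequentially mult_le_0_iff intro!: exI[of _ 1]\<close>)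
  qed
  have "(\<lambda>n. box_bump (real n) a b x) \<longlonglongrightarrow> (\<Prod>i\<in>(UNIV::'a set). 1 * 1)"
    unfolding box_bump_def by (intro tendsto_prod tendsto_mult *) (use True in \<open>auto simp: mem_box_cart\<close>)
  with True show ?thesis by simp
qed

subsection \<open>Test functions on the whole space\<close>

lemma test_functions_UNIV_iff:
  "\<phi> \<in> test_functions UNIV \<longleftrightarrow> (\<forall>k. Ck k \<phi>) \<and> (\<exists>R. \<forall>x. R < norm x \<longrightarrow> \<phi> x = 0)"
proof -
  have "compact (closure {x. \<phi> x \<noteq> 0}) \<longleftrightarrow> (\<exists>R. \<forall>x\<in>{x. \<phi> x \<noteq> 0}. norm x \<le> R)"
    by (simp add: bounded_iff)
  also have "\<dots> \<longleftrightarrow> (\<exists>R. \<forall>x. R < norm x \<longrightarrow> \<phi> x = 0)"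
    by (intro arg_cong[where f=Ex] ext) (simp only: not_less[symmetric] mem_Collect_eq Ball_def; meson)
  finally show ?thesis by (simp add: test_functions_def)
qed

lemma box_bump_test: "n \<ge> 0 \<Longrightarrow> box_bump n a b \<in> test_functions UNIV"
proof -
  assume n: "n \<ge> 0"
  obtain R where "\<forall>x\<in>box a b. norm x \<le> R"
    using bounded_box bounded_iff by blast
  then have "\<forall>x. R < norm x \<longrightarrow> box_bump n a b x = 0"
    using box_bump_eq_0[OF _ n] by (meson linorder_not_le)
  then show ?thesis
    unfolding test_functions_UNIV_iff by (intro conjI allI Ck_box_bump exI[of _ R]) auto
qed

lemma
  assumes "\<phi> \<in> test_functions UNIV"
  shows test_Ck: "Ck k \<phi>" and test_differentiable: "\<phi> differentiable (at x)"
    and test_continuous: "continuous_on UNIV \<phi>"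
    and test_measurable: "\<phi> \<in> borel_measurable borel"
proof -
  show "Ck k \<phi>" for k using assms by (auto simp: test_functions_UNIV_iff)
  from this[of 1] show "\<phi> differentiable (at x)" by simp
  from \<open>Ck 0 \<phi>\<close> show c: "continuous_on UNIV \<phi>" by simp
  then show "\<phi> \<in> borel_measurable borel" by (rule borel_measurable_continuous_onI)
qed

lemma test_supportE:
  assumes "\<phi> \<in> test_functions UNIV"
  obtains R where "0 < R" "\<And>x. R < norm x \<Longrightarrow> \<phi> x = 0"
proof -
  from assms obtain R where R: "\<And>x. R < norm x \<Longrightarrow> \<phi> x = 0"
    by (auto simp: test_functions_UNIV_iff)
  show ?thesis
    by (rule that[of "max R 1"]) (auto intro: R)
qed

lemma test_intro: "(\<And>k. Ck k \<phi>) \<Longrightarrow> (\<And>x. R < norm x \<Longrightarrow> \<phi> x = 0) \<Longrightarrow> \<phi> \<in> test_functions UNIV"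
  by (auto simp: test_functions_UNIV_iff)

lemma test_add:
  assumes "\<phi> \<in> test_functions UNIV" "\<psi> \<in> test_functions UNIV"
  shows "(\<lambda>x. \<phi> x + \<psi> x) \<in> test_functions UNIV"
proof -
  obtain R where R: "0 < R" "\<And>x. R < norm x \<Longrightarrow> \<phi> x = 0" using test_supportE[OF assms(1)] by blast
  obtain R' where R': "0 < R'" "\<And>x. R' < norm x \<Longrightarrow> \<psi> x = 0" using test_supportE[OF assms(2)] by blast
  show ?thesis
    by (rule test_intro[where R="max R R'"]) (simp_all add: R R' Ck_add test_Ck assms)
qed

lemma test_cmult:
  assumes "\<phi> \<in> test_functions UNIV" shows "(\<lambda>x. c * \<phi> x) \<in> test_functions UNIV"
proof -
  obtain R where R: "0 < R" "\<And>x. R < norm x \<Longrightarrow> \<phi> x = 0" using test_supportE[OF assms(1)] by blast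
  show ?thesis
    by (rule test_intro[where R=R]) (simp_all add: R Ck_mult Ck_const test_Ck assms)
qed

lemma test_diff:
  assumes "\<phi> \<in> test_functions UNIV" "\<psi> \<in> test_functions UNIV"
  shows "(\<lambda>x. \<phi> x - \<psi> x) \<in> test_functions UNIV"
  using test_add[OF assms(1) test_cmult[OF assms(2), of "-1"]] by simp

lemma test_mult:
  assumes "\<phi> \<in> test_functions UNIV" "\<psi> \<in> test_functions UNIV"
  shows "(\<lambda>x. \<phi> x * \<psi> x) \<in> test_functions UNIV"
proof -
  obtain R where R: "0 < R" "\<And>x. R < norm x \<Longrightarrow> \<phi> x = 0" using test_supportE[OF assms(1)] by blast
  show ?thesis
    by (rule test_intro[where R=R]) (simp_all add: R Ck_mult test_Ck assms)
qed

lemma partial_deriv_outside_support: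
  assumes "\<And>x. R < norm x \<Longrightarrow> \<phi> x = 0" "R < norm x"
  shows "partial_deriv i \<phi> x = 0"
proof -
  have "((\<lambda>x. 0) has_derivative (\<lambda>h. 0)) (at x)" by simp
  then have "(\<phi> has_derivative (\<lambda>h. 0)) (at x)"
    by (rule has_derivative_transform_within_open[where s="{x. R < norm x}"])
       (use assms in \<open>auto intro: open_Collect_less continuous_intros\<close>)
  then show ?thesis by (rule partial_deriv_eqI[THEN trans]) simp
qed

lemma test_partial:
  assumes "\<phi> \<in> test_functions UNIV" shows "partial_deriv i \<phi> \<in> test_functions UNIV"
proof -
  obtain R where R: "0 < R" "\<And>x. R < norm x \<Longrightarrow> \<phi> x = 0" using test_supportE[OF assms(1)] by blast
  show ?thesis
  proof (rule test_intro[where R=R])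
    show "Ck k (partial_deriv i \<phi>)" for k using test_Ck[OF assms, of "Suc k"] by simp
  qed (rule partial_deriv_outside_support[OF R(2)])
qed

lemma test_affine:
  fixes b :: "real ^ 'n::finite"
  assumes "\<phi> \<in> test_functions UNIV" "c \<noteq> 0"
  shows "(\<lambda>x. \<phi> (c *\<^sub>R x + b)) \<in> test_functions UNIV"
proof -
  obtain R where R: "0 < R" "\<And>x. R < norm x \<Longrightarrow> \<phi> x = 0" using test_supportE[OF assms(1)] by blast
  show ?thesis
  proof (rule test_intro[where R="(R + norm b) / \<bar>c\<bar>"])
    fix x :: "real ^ 'n" assume "(R + norm b) / \<bar>c\<bar> < norm x"
    then have "R + norm b < norm (c *\<^sub>R x)"
      using \<open>c \<noteq> 0\<close> by (simp add: field_simps)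
    also have "\<dots> \<le> norm (c *\<^sub>R x + b) + norm b"
      using norm_triangle_ineq4[of "c *\<^sub>R x + b" b] by simp
    finally show "\<phi> (c *\<^sub>R x + b) = 0" by (intro R) simp
  qed (intro Ck_affine test_Ck assms)
qed

lemma test_bound:
  assumes "\<phi> \<in> test_functions UNIV"
  obtains C R where "0 < C" "0 < R" "\<And>x. \<bar>\<phi> x\<bar> \<le> C * indicator (cball 0 R) x"
proof -
  obtain R where R: "0 < R" "\<And>x. R < norm x \<Longrightarrow> \<phi> x = 0" using test_supportE[OF assms(1)] by blast
  have "compact (\<phi> ` cball 0 R)"
    by (intro compact_continuous_image continuous_on_subset[OF test_continuous[OF assms]]) auto
  then have "bounded (\<phi> ` cball 0 R)" by (rule compact_imp_bounded)
  then obtain C where C: "C > 0" "\<And>x. x \<in> cball 0 R \<Longrightarrow> \<bar>\<phi> x\<bar> \<le> C"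
    by (auto simp: bounded_pos)
  show ?thesis
    by (rule that[OF C(1) R(1)]) (use C R in \<open>auto split: split_indicator simp: not_le\<close>)
qed

lemma indicator_ball_integrable: "integrable lborel (\<lambda>x::real^'n::finite. C * indicator (cball 0 R) x :: real)"
  by (intro integrable_mult_right integrable_real_indicator) (simp_all add: emeasure_lborel_cball_finite[unfolded infinity_ennreal_def])

lemma test_integrable:
  assumes "\<phi> \<in> test_functions UNIV" shows "integrable lborel \<phi>"
proof -
  obtain C R where *: "\<And>x. \<bar>\<phi> x\<bar> \<le> C * indicator (cball 0 R) x" using test_bound[OF assms] by metis
  show ?thesis
    by (rule Bochner_Integration.integrable_bound[OF indicator_ball_integrable[of C R]])
       (use * test_measurable[OF assms] in \<open>auto intro!: AE_I2 intro: order_trans[OF _ abs_ge_self]\<close>)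
qed

lemma locally_integrable_mult_test:
  assumes u: "locally_integrable UNIV u" and phi: "\<phi> \<in> test_functions UNIV"
  shows "integrable lborel (\<lambda>x. u x * \<phi> x)"
proof -
  obtain C R where *: "\<And>x. \<bar>\<phi> x\<bar> \<le> C * indicator (cball 0 R) x" and "0 < C" using test_bound[OF phi] by metis
  have i: "integrable lborel (\<lambda>x. indicator (cball 0 R) x * u x)"
    using u unfolding locally_integrable_def set_integrable_def real_scaleR_def by auto
  have eq: "u x * \<phi> x = (indicator (cball 0 R) x * u x) * \<phi> x" for x
    using *[of x] by (auto split: split_indicator)
  show ?thesis unfolding eq
  proof (rule Bochner_Integration.integrable_bound[where f="\<lambda>x. C * (indicator (cball 0 R) x * u x)"])
    show "integrable lborel (\<lambda>x. C * (indicator (cball 0 R) x * u x))" using i by (rule integrable_mult_right)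
    show "(\<lambda>x. (indicator (cball 0 R) x * u x) * \<phi> x) \<in> borel_measurable lborel"
      using borel_measurable_times[OF borel_measurable_integrable[OF i], of \<phi>] test_measurable[OF phi] by simp
    show "AE x in lborel. norm (indicator (cball 0 R) x * u x * \<phi> x) \<le> norm (C * (indicator (cball 0 R) x * u x))"
    proof (rule AE_I2)
      fix x
      show "norm (indicator (cball 0 R) x * u x * \<phi> x) \<le> norm (C * (indicator (cball 0 R) x * u x))"
        using *[of x] \<open>0 < C\<close> by (auto simp: abs_mult mult.commute[of C] split: split_indicator intro!: mult_left_mono)
    qed
  qed
qed

lemma continuous_locally_integrable:
  fixes u :: "real^'n::finite \<Rightarrow> real"
  shows "continuous_on UNIV u \<Longrightarrow> locally_integrable UNIV u"
  unfolding locally_integrable_def set_integrable_def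
  by (blast intro: borel_integrable_compact continuous_on_subset)

section \<open>Integration by parts and uniqueness of weak derivatives\<close>

lemma lborel_integral_shift:
  fixes f :: "'a::euclidean_space \<Rightarrow> real"
  assumes [measurable]: "f \<in> borel_measurable borel"
  shows "(LINT x|lborel. f (x + c)) = (LINT x|lborel. f x)"
    and "integrable lborel f \<Longrightarrow> integrable lborel (\<lambda>x. f (x + c))"
proof -
  have "(LINT x|lborel. f x) = (LINT x|distr lborel borel ((+) c). f x)"
    by (simp add: lborel_distr_plus)
  also have "\<dots> = (LINT x|lborel. f (x + c))"
    by (subst integral_distr) (auto simp: add.commute)
  finally show "(LINT x|lborel. f (x + c)) = (LINT x|lborel. f x)" ..
  assume "integrable lborel f"
  then have "integrable (distr lborel borel ((+) c)) f" by (simp add: lborel_distr_plus)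
  then show "integrable lborel (\<lambda>x. f (x + c))"
    by (subst (asm) integrable_distr_eq) (auto simp: add.commute)
qed

text \<open>Integration by parts without Fubini: the translates of \<open>\<phi>\<close> all have the same integral, so the
  difference quotients have integral zero.\<close>

lemma integral_partial_deriv_test:
  assumes phi: "\<phi> \<in> test_functions UNIV"
  shows "(LINT x|lborel. partial_deriv i \<phi> x) = 0"
proof -
  note [measurable] = test_measurable[OF phi] test_measurable[OF test_partial[OF phi]]
  obtain C where C: "0 < C" "\<And>x. \<bar>partial_deriv i \<phi> x\<bar> \<le> C"
    using test_bound[OF test_partial[OF phi]] 
    by (metis (no_types, opaque_lifting) indicator_le_1 mult_left_le order.trans order_less_imp_le)
  obtain R where R: "0 < R" "\<And>x. R < norm x \<Longrightarrow> \<phi> x = 0" using test_supportE[OF phi] by blast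
  define e :: "real^'a" where "e = axis i 1"
  have ne: "norm e = 1" by (simp add: e_def)
  have der: "((\<lambda>t. \<phi> (x + t *\<^sub>R e)) has_real_derivative partial_deriv i \<phi> (x + t *\<^sub>R e)) (at t)" for x t
  proof -
    have "(\<phi> has_derivative frechet_derivative \<phi> (at (x + t *\<^sub>R e))) (at (x + t *\<^sub>R e))"
      using test_differentiable[OF phi] by (simp add: frechet_derivative_works)
    then have "((\<lambda>t. \<phi> (x + t *\<^sub>R e)) has_derivative (\<lambda>h. frechet_derivative \<phi> (at (x + t *\<^sub>R e)) (h *\<^sub>R e))) (at t)"
      by (rule has_derivative_compose[rotated]) (auto intro!: derivative_eq_intros)
    then show ?thesis
      using test_differentiable[OF phi]
      by (simp add: has_field_derivative_def linear_frechet_derivative linear_scale partial_deriv_def e_def mult_commute_abs)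
  qed
  define t where "t n = 1 / real (Suc n)" for n
  have t: "0 < t n" "t n \<le> 1" for n by (auto simp: t_def)
  have t0: "t \<longlonglongrightarrow> 0" unfolding t_def by (rule LIMSEQ_Suc[OF lim_1_over_n])
  define d where "d n x = (\<phi> (x + t n *\<^sub>R e) - \<phi> x) / t n" for n x
  have [measurable]: "d n \<in> borel_measurable borel" for n unfolding d_def by measurable
  have "(\<lambda>n. LINT x|lborel. d n x) \<longlonglongrightarrow> (LINT x|lborel. partial_deriv i \<phi> x)"
  proof (rule integral_dominated_convergence[where w="\<lambda>x. C * indicator (cball 0 (R + 1)) x"])
    show "AE x in lborel. (\<lambda>n. d n x) \<longlonglongrightarrow> partial_deriv i \<phi> x"
    proof (rule AE_I2)
      fix x
      have "((\<lambda>h. (\<phi> (x + h *\<^sub>R e) - \<phi> x) / h) \<longlongrightarrow> partial_deriv i \<phi> x) (at 0)"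
        using der[of x 0] by (simp add: DERIV_def)
      moreover have "filterlim t (at 0) sequentially"
        using t0 t(1) by (auto simp: filterlim_at less_imp_neq[THEN not_sym] intro!: always_eventually)
      ultimately show "(\<lambda>n. d n x) \<longlonglongrightarrow> partial_deriv i \<phi> x"
        unfolding d_def by (rule filterlim_compose)
    qed
    \<comment> \<open>Inside the ball of radius R + 1 the mean value theorem bounds the quotient by
      C. Outside it both values vanish, because the step is at most 1.\<close>
    show "AE x in lborel. norm (d n x) \<le> C * indicator (cball 0 (R + 1)) x" for n
    proof (rule AE_I2)
      fix x
      show "norm (d n x) \<le> C * indicator (cball 0 (R + 1)) x"
      proof (cases "norm x \<le> R + 1")
        case True
        obtain s where "\<phi> (x + t n *\<^sub>R e) - \<phi> (x + 0 *\<^sub>R e) = (t n - 0) * partial_deriv i \<phi> (x + s *\<^sub>R e)"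
          using MVT2[OF t(1), where f="\<lambda>t. \<phi> (x + t *\<^sub>R e)" and f'="\<lambda>t. partial_deriv i \<phi> (x + t *\<^sub>R e)"] der by blast
        then have "d n x = partial_deriv i \<phi> (x + s *\<^sub>R e)"
          using t(1)[of n] by (simp add: d_def)
        with C True show ?thesis by simp
      next
        case False
        have "norm x \<le> norm (x + t n *\<^sub>R e) + norm (t n *\<^sub>R e)"
          using norm_triangle_ineq4[of "x + t n *\<^sub>R e" "t n *\<^sub>R e"] by simp
        also have "norm (t n *\<^sub>R e) \<le> 1" using t[of n] by (simp add: ne)
        finally have "\<phi> (x + t n *\<^sub>R e) = 0" "\<phi> x = 0" using False by (auto intro!: R)
        then show ?thesis using C by (simp add: d_def)
      qed
    qed
  qed (measurable, rule indicator_ball_integrable)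
  moreover have "(LINT x|lborel. d n x) = 0" for n
    using lborel_integral_shift[of \<phi> "t n *\<^sub>R e"] test_integrable[OF phi]
    by (simp add: d_def)
  ultimately show ?thesis by (simp add: LIMSEQ_const_iff)
qed

lemma test_has_weak_deriv:
  assumes phi: "\<phi> \<in> test_functions UNIV"
  shows "has_weak_deriv UNIV i \<phi> (partial_deriv i \<phi>)"
  unfolding has_weak_deriv_def
proof (intro conjI ballI)
  show "locally_integrable UNIV \<phi>" "locally_integrable UNIV (partial_deriv i \<phi>)"
    by (intro continuous_locally_integrable test_continuous test_partial phi)+
  fix \<psi> :: "real^'a \<Rightarrow> real" assume psi: "\<psi> \<in> test_functions UNIV"
  have "0 = (LINT x|lborel. partial_deriv i (\<lambda>x. \<phi> x * \<psi> x) x)"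
    by (subst integral_partial_deriv_test[OF test_mult[OF phi psi]]) simp
  also have "\<dots> = (LINT x|lborel. partial_deriv i \<phi> x * \<psi> x + \<phi> x * partial_deriv i \<psi> x)"
    by (intro Bochner_Integration.integral_cong refl partial_deriv_mult test_differentiable phi psi)
  also have "\<dots> = (LINT x|lborel. partial_deriv i \<phi> x * \<psi> x) + (LINT x|lborel. \<phi> x * partial_deriv i \<psi> x)"
    by (intro Bochner_Integration.integral_add test_integrable test_mult test_partial phi psi)
  finally show "(LINT x:UNIV|lborel. \<phi> x * partial_deriv i \<psi> x) = - (LINT x:UNIV|lborel. partial_deriv i \<phi> x * \<psi> x)"
    by (simp add: set_lebesgue_integral_def)
qed

text \<open>The positive and the negative part of h, taken as densities, give measures that are
  finite and equal on open boxes, an intersection-stable generator. Hence the densities agree almost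
  everywhere, and a number with equal positive and negative parts is 0.\<close>

lemma AE_zero_if_box_integrals_zero:
  fixes h :: "'a::euclidean_space \<Rightarrow> real"
  assumes [measurable]: "h \<in> borel_measurable borel"
    and int: "\<And>a b. integrable lborel (\<lambda>x. indicator (box a b) x * h x)"
    and zero: "\<And>a b. (LINT x|lborel. indicator (box a b) x * h x) = 0"
  shows "AE x in lborel. h x = 0"
proof -
  have box_eq: "(\<integral>\<^sup>+x. ennreal (h x) * indicator (box a b) x \<partial>lborel) = (\<integral>\<^sup>+x. ennreal (- h x) * indicator (box a b) x \<partial>lborel)"
    and box_fin: "(\<integral>\<^sup>+x. ennreal (h x) * indicator (box a b) x \<partial>lborel) \<noteq> \<infinity>" for a b
  proof -
    have *: "(\<integral>\<^sup>+x. ennreal (indicator (box a b) x * f x) \<partial>lborel) = (\<integral>\<^sup>+x. ennreal (f x) * indicator (box a b) x \<partial>lborel)" for f :: "'a \<Rightarrow> real"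
      by (intro nn_integral_cong) (simp split: split_indicator)
    note i = int[of a b]
    have fin: "(\<integral>\<^sup>+x. ennreal (indicator (box a b) x * h x) \<partial>lborel) < \<infinity>"
      "(\<integral>\<^sup>+x. ennreal (- (indicator (box a b) x * h x)) \<partial>lborel) < \<infinity>"
      using i by (auto simp: real_integrable_def less_top)
    have "0 = enn2real (\<integral>\<^sup>+x. ennreal (indicator (box a b) x * h x) \<partial>lborel) -
          enn2real (\<integral>\<^sup>+x. ennreal (- (indicator (box a b) x * h x)) \<partial>lborel)"
      using zero[of a b] real_lebesgue_integral_def[OF i] by simp
    then have "(\<integral>\<^sup>+x. ennreal (indicator (box a b) x * h x) \<partial>lborel) = (\<integral>\<^sup>+x. ennreal (indicator (box a b) x * - h x) \<partial>lborel)"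
      using fin by (simp add: eq_diff_eq) (metis ennreal_enn2real)
    then show "(\<integral>\<^sup>+x. ennreal (h x) * indicator (box a b) x \<partial>lborel) = (\<integral>\<^sup>+x. ennreal (- h x) * indicator (box a b) x \<partial>lborel)"
      unfolding * .
    show "(\<integral>\<^sup>+x. ennreal (h x) * indicator (box a b) x \<partial>lborel) \<noteq> \<infinity>"
      using fin(1) unfolding * by simp
  qed
  have "density lborel (\<lambda>x. ennreal (h x)) = density lborel (\<lambda>x. ennreal (- h x))"
  proof (rule measure_eqI_generator_eq[where E="range (\<lambda>(a, b). box a b :: 'a set)" and \<Omega>=UNIV
        and A="\<lambda>n. box (- (real n *\<^sub>R One)) (real n *\<^sub>R One)"])
    show "Int_stable (range (\<lambda>(a, b). box a b :: 'a set))"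
      by (auto simp: Int_stable_def box_Int_box)
    show "sets (density lborel (\<lambda>x. ennreal (h x))) = sigma_sets UNIV (range (\<lambda>(a, b). box a b))"
      "sets (density lborel (\<lambda>x. ennreal (- h x))) = sigma_sets UNIV (range (\<lambda>(a, b). box a b))"
      by (simp_all add: borel_eq_box)
    show "(\<Union>n. box (- (real n *\<^sub>R One)) (real n *\<^sub>R One :: 'a)) = UNIV"
      by (rule UN_box_eq_UNIV)
  qed (use box_eq box_fin in \<open>auto simp: emeasure_density\<close>)
  then have "AE x in lborel. ennreal (h x) = ennreal (- h x)"
    by (intro sigma_finite_measure.density_unique[OF sigma_finite_lborel]) auto
  then show ?thesis
  proof eventually_elim
    case (elim x)
    then show ?case
      by (cases "0 \<le> h x") (auto simp: ennreal_neg ennreal_eq_0_iff)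
  qed
qed

lemma locally_integrable_measurable:
  fixes u :: "real^'n::finite \<Rightarrow> real"
  assumes "locally_integrable UNIV u" shows "u \<in> borel_measurable borel"
proof (rule borel_measurable_LIMSEQ_real)
  show "(\<lambda>x. indicator (cball 0 (real n)) x * u x) \<in> borel_measurable borel" for n
  proof -
    have "integrable lborel (\<lambda>x. indicator (cball 0 (real n)) x * u x)"
      using assms unfolding locally_integrable_def set_integrable_def real_scaleR_def by auto
    from borel_measurable_integrable[OF this] show ?thesis by simp
  qed
  fix x :: "real^'n"
  obtain N where N: "norm x \<le> real N" using real_arch_simple by blast
  show "(\<lambda>n. indicator (cball 0 (real n)) x * u x) \<longlonglongrightarrow> u x"
    by (rule tendsto_eventually, rule eventually_sequentiallyI[of N]) (use N in auto)
qed

text \<open>Box bumps are test functions that converge boundedly to indicators of boxes, so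
  orthogonality passes to boxes by dominated convergence.\<close>

lemma AE_zero_if_test_orthogonal:
  fixes h :: "real^'n::finite \<Rightarrow> real"
  assumes h: "locally_integrable UNIV h"
    and orth: "\<And>\<phi>. \<phi> \<in> test_functions UNIV \<Longrightarrow> (LINT x|lborel. h x * \<phi> x) = 0"
  shows "AE x in lborel. h x = 0"
proof (rule AE_zero_if_box_integrals_zero)
  show [measurable]: "h \<in> borel_measurable borel"
    using h by (rule locally_integrable_measurable)
  fix a b :: "real^'n"
  have i: "integrable lborel (\<lambda>x. indicator (cbox a b) x * h x)"
    using h unfolding locally_integrable_def set_integrable_def real_scaleR_def by auto
  show "integrable lborel (\<lambda>x. indicator (box a b) x * h x)"
    by (rule Bochner_Integration.integrable_bound[OF i])
       (auto split: split_indicator simp: box_subset_cbox[THEN subsetD])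
  have [measurable]: "box_bump (real n) a b \<in> borel_measurable borel" for n
    by (intro test_measurable box_bump_test) simp
  have "(\<lambda>n. LINT x|lborel. h x * box_bump (real n) a b x) \<longlonglongrightarrow> (LINT x|lborel. h x * indicator (box a b) x)"
  proof (rule integral_dominated_convergence[where w="\<lambda>x. \<bar>indicator (cbox a b) x * h x\<bar>"])
    show "AE x in lborel. (\<lambda>n. h x * box_bump (real n) a b x) \<longlonglongrightarrow> h x * indicator (box a b) x"
      by (intro AE_I2 tendsto_intros box_bump_tendsto)
    show "AE x in lborel. norm (h x * box_bump (real n) a b x) \<le> \<bar>indicator (cbox a b) x * h x\<bar>" for n
    proof (rule AE_I2)
      fix x
      show "norm (h x * box_bump (real n) a b x) \<le> \<bar>indicator (cbox a b) x * h x\<bar>"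
      proof (cases "x \<in> box a b")
        case True
        then show ?thesis
          using box_bump_nonneg[of n a b x] box_bump_le_1[of n a b x] box_subset_cbox[of a b]
          by (auto simp: abs_mult mult_left_le)
      qed (simp add: box_bump_eq_0)
    qed
  qed (use i in auto)
  moreover have "(LINT x|lborel. h x * box_bump (real n) a b x) = 0" for n
    by (intro orth box_bump_test) simp
  ultimately show "(LINT x|lborel. indicator (box a b) x * h x) = 0"
    by (simp add: LIMSEQ_const_iff mult.commute)
qed

lemma locally_integrable_diff:
  "locally_integrable U u \<Longrightarrow> locally_integrable U v \<Longrightarrow> locally_integrable U (\<lambda>x. u x - v x)"
  unfolding locally_integrable_def by (auto intro: set_integral_diff)

lemma weak_deriv_unique:
  assumes "has_weak_deriv UNIV i u g" "has_weak_deriv UNIV i u g'"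
  shows "AE x in lborel. g x = g' x"
proof -
  have "AE x in lborel. g x - g' x = 0"
  proof (rule AE_zero_if_test_orthogonal)
    show "locally_integrable UNIV (\<lambda>x. g x - g' x)"
      using assms by (auto simp: has_weak_deriv_def intro: locally_integrable_diff)
    fix \<phi> :: "real^'a \<Rightarrow> real" assume phi: "\<phi> \<in> test_functions UNIV"
    then have "(LINT x|lborel. g x * \<phi> x) = (LINT x|lborel. g' x * \<phi> x)"
      using assms by (force simp: has_weak_deriv_def set_lebesgue_integral_def)
    then show "(LINT x|lborel. (g x - g' x) * \<phi> x) = 0"
      using assms phi
      by (simp add: left_diff_distrib has_weak_deriv_def Bochner_Integration.integral_diff locally_integrable_mult_test)
  qed
  then show ?thesis by simp
qed

lemma weak_deriv_AE_eq:
  assumes "has_weak_deriv UNIV i u g" shows "AE x in lborel. weak_deriv UNIV i u x = g x"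
  unfolding weak_deriv_def by (rule weak_deriv_unique[OF someI[of "has_weak_deriv UNIV i u", OF assms] assms])

section \<open>Gradients and weak gradients as vector fields\<close>

lemma vec_nth_measurable [measurable (raw)]:
  fixes f :: "'a \<Rightarrow> 'b::euclidean_space ^ 'n::finite"
  shows "f \<in> borel_measurable M \<Longrightarrow> (\<lambda>x. f x $ i) \<in> borel_measurable M"
  by (rule borel_measurable_continuous_on[where f="\<lambda>v. v $ i"])
     (intro linear_continuous_on bounded_linear_vec_nth)

lemma vec_lambda_measurable:
  fixes f :: "'n::finite \<Rightarrow> 'a \<Rightarrow> real"
  assumes "\<And>i. f i \<in> borel_measurable M"
  shows "(\<lambda>x. \<chi> i. f i x) \<in> borel_measurable M"
proof (subst borel_measurable_euclidean_space, intro ballI)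
  fix b :: "real ^ 'n" assume "b \<in> Basis"
  then obtain i where "b = axis i 1" by (auto simp: Basis_vec_def)
  with assms show "(\<lambda>x. (\<chi> i. f i x) \<bullet> b) \<in> borel_measurable M"
    by (simp add: inner_axis)
qed

definition gradient :: "(real ^ 'n::finite \<Rightarrow> real) \<Rightarrow> real ^ 'n \<Rightarrow> real ^ 'n" where
  "gradient \<phi> x = (\<chi> i. partial_deriv i \<phi> x)"

definition weak_gradient :: "(real ^ 'n::finite \<Rightarrow> real) \<Rightarrow> real ^ 'n \<Rightarrow> real ^ 'n" where
  "weak_gradient u x = (\<chi> i. weak_deriv UNIV i u x)"

lemma gradient_measurable: "\<phi> \<in> test_functions UNIV \<Longrightarrow> gradient \<phi> \<in> borel_measurable borel"
  unfolding gradient_def[abs_def] by (intro vec_lambda_measurable test_measurable test_partial)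

lemma gradient_diff:
  assumes "\<phi> \<in> test_functions UNIV" "\<psi> \<in> test_functions UNIV"
  shows "gradient (\<lambda>x. \<phi> x - \<psi> x) x = gradient \<phi> x - gradient \<psi> x"
proof -
  have "((\<lambda>x. \<phi> x - \<psi> x) has_derivative (\<lambda>h. frechet_derivative \<phi> (at x) h - frechet_derivative \<psi> (at x) h)) (at x)"
    using assms by (intro has_derivative_diff) (auto simp: frechet_derivative_works[symmetric] test_differentiable)
  from partial_deriv_eqI[OF this] show ?thesis
    by (simp add: gradient_def vec_eq_iff partial_deriv_def)
qed

text \<open>The squared norm of the gradient is a sum of products of test functions, hence itself a
  test function, and \<open>test_bound\<close> applies to it.\<close>

lemma gradient_bound:
  assumes phi: "\<phi> \<in> test_functions UNIV"
  obtains C R where "0 < C" "0 < R" "\<And>x. (norm (gradient \<phi> x))\<^sup>2 \<le> C * indicator (cball 0 R) x"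
proof -
  let ?g = "\<lambda>x. \<Sum>i\<in>UNIV. partial_deriv i \<phi> x * partial_deriv i \<phi> x"
  have "?g \<in> test_functions UNIV"
  proof -
    have "(\<lambda>x. \<Sum>i\<in>I. partial_deriv i \<phi> x * partial_deriv i \<phi> x) \<in> test_functions UNIV" if "finite I" for I
      using that
    proof induction
      case empty
      show ?case by (rule test_intro[where R=0]) (auto simp: Ck_const)
    next
      case (insert i I)
      then show ?case by (simp add: test_add test_mult test_partial phi)
    qed
    then show ?thesis by simp
  qed
  then obtain C R where "0 < C" "0 < R" "\<And>x. \<bar>?g x\<bar> \<le> C * indicator (cball 0 R) x"
    by (rule test_bound) blast
  moreover have "(norm (gradient \<phi> x))\<^sup>2 = ?g x" for x
    by (simp add: gradient_def power2_norm_eq_inner inner_vec_def)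
  ultimately show ?thesis using that by (metis abs_le_D1)
qed

lemma dform_eq: "dform A UNIV u v = (LINT x|lborel. (A x *v weak_gradient v x) \<bullet> weak_gradient u x)"
proof -
  have "(\<Sum>i\<in>UNIV. \<Sum>j\<in>UNIV. A x $ i $ j * weak_deriv UNIV i u x * weak_deriv UNIV j v x) =
    (A x *v weak_gradient v x) \<bullet> weak_gradient u x" for x
    by (simp add: weak_gradient_def inner_vec_def matrix_vector_mult_def sum_distrib_right sum_distrib_left algebra_simps)
  then show ?thesis by (simp add: dform_def set_lebesgue_integral_def)
qed

definition has_weak_gradient :: "(real ^ 'n::finite \<Rightarrow> real) \<Rightarrow> (real ^ 'n \<Rightarrow> real ^ 'n) \<Rightarrow> bool" where
  "has_weak_gradient u G \<longleftrightarrow> (\<forall>i. has_weak_deriv UNIV i u (\<lambda>x. G x $ i))"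

lemma weak_gradient_AE_eq:
  assumes "has_weak_gradient u G" shows "AE x in lborel. weak_gradient u x = G x"
proof -
  have "AE x in lborel. \<forall>i\<in>UNIV. weak_deriv UNIV i u x = G x $ i"
    using assms by (subst AE_finite_all) (auto simp: has_weak_gradient_def intro: weak_deriv_AE_eq)
  then show ?thesis
    by eventually_elim (simp add: weak_gradient_def vec_eq_iff)
qed

lemma test_has_weak_gradient: "\<phi> \<in> test_functions UNIV \<Longrightarrow> has_weak_gradient \<phi> (gradient \<phi>)"
  by (simp add: has_weak_gradient_def gradient_def test_has_weak_deriv)

text \<open>Existence of some weak gradient makes the choice operator return genuine weak
  derivatives, and their local integrability contains measurability.\<close>

lemma weak_gradient_measurable:
  assumes "has_weak_gradient u G" shows "weak_gradient u \<in> borel_measurable borel"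
  unfolding weak_gradient_def[abs_def]
proof (intro vec_lambda_measurable)
  fix i
  have "has_weak_deriv UNIV i u (weak_deriv UNIV i u)"
    using assms someI[of "has_weak_deriv UNIV i u" "\<lambda>x. G x $ i"]
    by (simp add: has_weak_gradient_def weak_deriv_def)
  then show "weak_deriv UNIV i u \<in> borel_measurable borel"
    by (auto simp: has_weak_deriv_def intro: locally_integrable_measurable)
qed

text \<open>Young's inequality with a weight t stands in for Cauchy-Schwarz: t makes the
  contribution of the fixed factor g small, and then n makes that of \<open>f n\<close>
  small.\<close>

lemma integral_mult_tendsto_0:
  fixes f :: "nat \<Rightarrow> 'a \<Rightarrow> real"
  assumes f: "\<And>n. f n \<in> borel_measurable M" "\<And>n. integrable M (\<lambda>x. (f n x)\<^sup>2)"
    and g: "g \<in> borel_measurable M" "integrable M (\<lambda>x. (g x)\<^sup>2)"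
    and lim: "(\<lambda>n. LINT x|M. (f n x)\<^sup>2) \<longlonglongrightarrow> 0"
  shows "integrable M (\<lambda>x. f n x * g x)" "(\<lambda>n. LINT x|M. f n x * g x) \<longlonglongrightarrow> 0"
proof -
  have young: "\<bar>a * b\<bar> \<le> (a\<^sup>2 / t + t * b\<^sup>2) / 2" if "t > 0" for a b t :: real
  proof -
    have "0 \<le> (\<bar>a\<bar> / sqrt t - sqrt t * \<bar>b\<bar>)\<^sup>2" by simp
    also have "\<dots> = a\<^sup>2 / t + t * b\<^sup>2 - 2 * \<bar>a * b\<bar>"
      using that by (simp add: power2_diff power_divide power_mult_distrib abs_mult)
    finally show ?thesis by simp
  qed
  have int: "integrable M (\<lambda>x. f n x * g x)" for n
    by (rule Bochner_Integration.integrable_bound[where f="\<lambda>x. ((f n x)\<^sup>2 / 1 + 1 * (g x)\<^sup>2) / 2"])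
       (use f g young[of 1] in \<open>auto simp: AE_I2\<close>)
  show "integrable M (\<lambda>x. f n x * g x)" by (rule int)
  have bound: "\<bar>LINT x|M. f n x * g x\<bar> \<le> ((LINT x|M. (f n x)\<^sup>2) / t + t * (LINT x|M. (g x)\<^sup>2)) / 2" if "t > 0" for n t
  proof -
    have "\<bar>LINT x|M. f n x * g x\<bar> \<le> (LINT x|M. \<bar>f n x * g x\<bar>)"
      by (rule integral_abs_bound)
    also have "\<dots> \<le> (LINT x|M. ((f n x)\<^sup>2 / t + t * (g x)\<^sup>2) / 2)"
      by (intro integral_mono young that integrable_abs int) (use f g in auto)
    also have "\<dots> = ((LINT x|M. (f n x)\<^sup>2) / t + t * (LINT x|M. (g x)\<^sup>2)) / 2"
      using f g by simp
    finally show ?thesis .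
  qed
  show "(\<lambda>n. LINT x|M. f n x * g x) \<longlonglongrightarrow> 0"
  proof (rule LIMSEQ_I)
    fix e :: real assume "e > 0"
    define I where "I = (LINT x|M. (g x)\<^sup>2)"
    have "I \<ge> 0" unfolding I_def by simp
    \<comment> \<open>Chosen so that \<open>t * I\<close> is at most e; the added 1 keeps the
      quotient meaningful when g vanishes almost everywhere.\<close>
    define t where "t = e / (I + 1)"
    have "t > 0" using \<open>e > 0\<close> \<open>I \<ge> 0\<close> by (simp add: t_def)
    have "t * I \<le> e" using \<open>e > 0\<close> \<open>I \<ge> 0\<close> by (simp add: t_def field_simps)
    obtain N where N: "\<And>n. n \<ge> N \<Longrightarrow> norm ((LINT x|M. (f n x)\<^sup>2) - 0) < e * t"
      using LIMSEQ_D[OF lim, of "e * t"] \<open>e > 0\<close> \<open>t > 0\<close> by auto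
    have "norm ((LINT x|M. f n x * g x) - 0) < e" if "n \<ge> N" for n
    proof -
      have "(LINT x|M. (f n x)\<^sup>2) / t < e"
        using N[OF that] \<open>t > 0\<close> by (simp add: field_simps)
      with bound[OF \<open>t > 0\<close>, of n] \<open>t * I \<le> e\<close> show ?thesis unfolding I_def by simp
    qed
    then show "\<exists>N. \<forall>n\<ge>N. norm ((LINT x|M. f n x * g x) - 0) < e" by blast
  qed
qed

subsection \<open>Elliptic coefficient fields\<close>

text \<open>One frozen realisation of the environment: A, l, L stand for a, \<lambda>, \<Lambda>
  along the orbit of a single \<omega>. The deterministic analysis is done here, apart from the
  randomness.\<close>

locale elliptic_field =
  fixes A :: "real ^ 'n::finite \<Rightarrow> real ^ 'n ^ 'n" and l L :: "real ^ 'n \<Rightarrow> real"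
  assumes A_measurable: "A \<in> borel_measurable borel"
    and A_symmetric: "transpose (A x) = A x"
    and l_pos: "0 < l x" and L_pos: "0 < L x"
    and elliptic: "AE x in lborel. \<forall>\<xi>.
          l x * (norm \<xi>)\<^sup>2 \<le> (A x *v \<xi>) \<bullet> \<xi> \<and> (A x *v \<xi>) \<bullet> \<xi> \<le> L x * (norm \<xi>)\<^sup>2"
    and l_loc: "compact K \<Longrightarrow> \<exists>c. AE x in lborel. x \<in> K \<longrightarrow> 1 / l x \<le> c"
    and L_loc: "compact K \<Longrightarrow> \<exists>c. AE x in lborel. x \<in> K \<longrightarrow> L x \<le> c"
begin

definition bil :: "real ^ 'n \<Rightarrow> real ^ 'n \<Rightarrow> real ^ 'n \<Rightarrow> real" where
  "bil x \<xi> \<eta> = (A x *v \<eta>) \<bullet> \<xi>"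

lemma bil_sym: "bil x \<xi> \<eta> = bil x \<eta> \<xi>"
  unfolding bil_def by (metis A_symmetric dot_lmul_matrix inner_commute transpose_matrix_vector)

lemma bil_add: "bil x (\<xi> + \<xi>') \<eta> = bil x \<xi> \<eta> + bil x \<xi>' \<eta>"
  by (simp add: bil_def inner_add_right)

lemma bil_diff: "bil x (\<xi> - \<xi>') \<eta> = bil x \<xi> \<eta> - bil x \<xi>' \<eta>"
  by (simp add: bil_def inner_diff_right)

lemma bil_diff_diff: "bil x (\<xi> - \<eta>) (\<xi> - \<eta>) = bil x \<xi> \<xi> - 2 * bil x \<xi> \<eta> + bil x \<eta> \<eta>"
  using bil_sym[of x \<xi> \<eta>] by (simp add: bil_diff bil_sym[of x _ "\<xi> - \<eta>"])

lemma bil_add_add: "bil x (\<xi> + \<eta>) (\<xi> + \<eta>) = bil x \<xi> \<xi> + 2 * bil x \<xi> \<eta> + bil x \<eta> \<eta>"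
  using bil_sym[of x \<xi> \<eta>] by (simp add: bil_add bil_sym[of x _ "\<xi> + \<eta>"])

lemma bil_eq_sum: "bil x \<xi> \<eta> = (\<Sum>i\<in>UNIV. \<Sum>j\<in>UNIV. A x $ i $ j * \<eta> $ j * \<xi> $ i)"
  by (simp add: bil_def inner_vec_def matrix_vector_mult_def sum_distrib_right)

lemma bil_measurable [measurable (raw)]:
  assumes [measurable]: "G \<in> borel_measurable borel" "H \<in> borel_measurable borel"
  shows "(\<lambda>x. bil x (G x) (H x)) \<in> borel_measurable borel"
  using A_measurable unfolding bil_eq_sum by measurable

lemma continuous_bil: "continuous_on UNIV (\<lambda>\<xi>. bil x \<xi> \<xi>)"
  unfolding bil_eq_sum by (intro continuous_intros)

lemma AE_bil_lower: "AE x in lborel. \<forall>\<xi>. l x * (norm \<xi>)\<^sup>2 \<le> bil x \<xi> \<xi>"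
  using elliptic by eventually_elim (simp add: bil_def)

lemma AE_bil_upper: "AE x in lborel. \<forall>\<xi>. bil x \<xi> \<xi> \<le> L x * (norm \<xi>)\<^sup>2"
  using elliptic by eventually_elim (simp add: bil_def)

lemma AE_bil_nonneg: "AE x in lborel. \<forall>\<xi>. 0 \<le> bil x \<xi> \<xi>"
  using AE_bil_lower
proof eventually_elim
  case (elim x)
  then show ?case using l_pos[of x] by (meson less_imp_le mult_nonneg_nonneg order_trans zero_le_power2)
qed

text \<open>Defined on vector fields rather than on functions, so that limits of gradients can be
  handled before they are known to be the gradient of anything.\<close>

definition energy :: "(real ^ 'n \<Rightarrow> real ^ 'n) \<Rightarrow> real" where
  "energy G = (LINT x|lborel. bil x (G x) (G x))"

definition finite_energy :: "(real ^ 'n \<Rightarrow> real ^ 'n) \<Rightarrow> bool" where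
  "finite_energy G \<longleftrightarrow> G \<in> borel_measurable borel \<and> integrable lborel (\<lambda>x. bil x (G x) (G x))"

lemma finite_energyI_nn:
  assumes [measurable]: "G \<in> borel_measurable borel"
    and "(\<integral>\<^sup>+x. ennreal (bil x (G x) (G x)) \<partial>lborel) < \<infinity>"
  shows "finite_energy G"
  unfolding finite_energy_def using assms AE_bil_nonneg
  by (auto intro!: integrableI_nonneg)

lemma nn_energy:
  assumes "finite_energy G"
  shows "(\<integral>\<^sup>+x. ennreal (bil x (G x) (G x)) \<partial>lborel) = ennreal (energy G)"
  unfolding energy_def using assms AE_bil_nonneg
  by (intro nn_integral_eq_integral) (auto simp: finite_energy_def)

lemma energy_nonneg: "0 \<le> energy G"
  unfolding energy_def using AE_bil_nonneg by (intro integral_nonneg_AE) auto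

lemma finite_energy_diff:
  assumes "finite_energy G" "finite_energy H"
  shows "finite_energy (\<lambda>x. G x - H x)"
proof -
  have [measurable]: "G \<in> borel_measurable borel" "H \<in> borel_measurable borel"
    using assms by (auto simp: finite_energy_def)
  show ?thesis
    unfolding finite_energy_def
  proof (intro conjI, measurable)
    show "integrable lborel (\<lambda>x. bil x (G x - H x) (G x - H x))"
    proof (rule Bochner_Integration.integrable_bound)
      show "integrable lborel (\<lambda>x. 2 * bil x (G x) (G x) + 2 * bil x (H x) (H x))"
        using assms by (auto simp: finite_energy_def)
      show "AE x in lborel. norm (bil x (G x - H x) (G x - H x)) \<le> norm (2 * bil x (G x) (G x) + 2 * bil x (H x) (H x))"
        using AE_bil_nonneg
      proof eventually_elim
        case (elim x)
        \<comment> \<open>Parallelogram identity: dropping the nonnegative form of the sum bounds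
          the form of the difference.\<close>
        have "bil x (G x - H x) (G x - H x) \<ge> 0" "bil x (G x + H x) (G x + H x) \<ge> 0"
          using elim by auto
        then show ?case using bil_diff_diff[of x "G x" "H x"] bil_add_add[of x "G x" "H x"] by simp
      qed
    qed measurable
  qed
qed

lemma bil_integrable:
  assumes "finite_energy G" "finite_energy H"
  shows "integrable lborel (\<lambda>x. bil x (G x) (H x))"
proof -
  have "integrable lborel (\<lambda>x. (bil x (G x) (G x) + bil x (H x) (H x) - bil x (G x - H x) (G x - H x)) / 2)"
    using assms finite_energy_diff[OF assms] by (auto simp: finite_energy_def)
  then show ?thesis by (simp add: bil_diff_diff)
qed

lemma energy_diff:
  assumes "finite_energy G" "finite_energy H"
  shows "energy (\<lambda>x. G x - H x) = energy G - 2 * (LINT x|lborel. bil x (G x) (H x)) + energy H"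
  using assms bil_integrable[OF assms] unfolding energy_def bil_diff_diff
  by (simp add: finite_energy_def)

lemma finite_energy_gradient:
  assumes phi: "\<phi> \<in> test_functions UNIV" shows "finite_energy (gradient \<phi>)"
proof -
  obtain C R where C: "0 < C" "\<And>x. (norm (gradient \<phi> x))\<^sup>2 \<le> C * indicator (cball 0 R) x"
    using gradient_bound[OF phi] by metis
  obtain c where c: "AE x in lborel. x \<in> cball 0 R \<longrightarrow> L x \<le> c"
    using L_loc[of "cball 0 R"] by auto
  note [measurable] = gradient_measurable[OF phi]
  show ?thesis
    unfolding finite_energy_def
  proof (intro conjI, measurable)
    show "integrable lborel (\<lambda>x. bil x (gradient \<phi> x) (gradient \<phi> x))"
    proof (rule Bochner_Integration.integrable_bound[OF indicator_ball_integrable[of "c * C" R]])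
      show "AE x in lborel. norm (bil x (gradient \<phi> x) (gradient \<phi> x)) \<le> norm (c * C * indicator (cball 0 R) x)"
        using AE_bil_nonneg AE_bil_upper c
      proof eventually_elim
        case (elim x)
        have "bil x (gradient \<phi> x) (gradient \<phi> x) \<le> L x * (norm (gradient \<phi> x))\<^sup>2" using elim by simp
        also have "\<dots> \<le> L x * (C * indicator (cball 0 R) x)"
          using C(2)[of x] L_pos[of x] by (intro mult_left_mono) auto
        also have "\<dots> \<le> c * (C * indicator (cball 0 R) x)"
          using elim C by (auto split: split_indicator intro!: mult_right_mono)
        finally show ?case using elim by (simp add: mult.assoc)
      qed
    qed measurable
  qed
qed

text \<open>A Cauchy sequence in energy converges almost everywhere along a rapidly converging subsequence,
  because the lower ellipticity bound is positive at almost every point.\<close>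

lemma AE_convergent_Cauchy_energy:
  assumes H: "\<And>k::nat. finite_energy (H k)"
    and small: "\<And>k. energy (\<lambda>x. H (Suc k) x - H k x) \<le> (1 / 8) ^ k"
  shows "AE x in lborel. convergent (\<lambda>k. H k x)"
proof -
  define \<delta> where "\<delta> k x = bil x (H (Suc k) x - H k x) (H (Suc k) x - H k x)" for k x
  have fe: "finite_energy (\<lambda>x. H (Suc k) x - H k x)" for k by (intro finite_energy_diff H)
  have [measurable]: "H k \<in> borel_measurable borel" for k using H by (auto simp: finite_energy_def)
  have [measurable]: "\<delta> k \<in> borel_measurable borel" for k unfolding \<delta>_def by measurable
  \<comment> \<open>The weight \<open>4 ^ k\<close> splits the rate \<open>(1 / 8) ^ k\<close>: what
    is left, \<open>(1 / 2) ^ k\<close>, is summable, and the square root of the weight makes the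
    increments themselves of order \<open>(1 / 2) ^ k\<close>.\<close>
  have "(\<integral>\<^sup>+x. (\<Sum>k. ennreal (4 ^ k * \<delta> k x)) \<partial>lborel) = (\<Sum>k. \<integral>\<^sup>+x. ennreal (4 ^ k * \<delta> k x) \<partial>lborel)"
    by (rule nn_integral_suminf) measurable
  also have "\<dots> \<le> (\<Sum>k. ennreal ((1 / 2) ^ k))"
  proof (intro suminf_le allI)
    fix k
    have "(\<integral>\<^sup>+x. ennreal (4 ^ k * \<delta> k x) \<partial>lborel) = ennreal (4 ^ k) * (\<integral>\<^sup>+x. ennreal (\<delta> k x) \<partial>lborel)"
      by (subst nn_integral_cmult[symmetric]) (simp_all add: ennreal_mult')
    also have "\<dots> = ennreal (4 ^ k * energy (\<lambda>x. H (Suc k) x - H k x))"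
      unfolding \<delta>_def nn_energy[OF fe] by (simp add: ennreal_mult'' energy_nonneg)
    also have "\<dots> \<le> ennreal ((1 / 2) ^ k)"
    proof (intro ennreal_leI)
      have "4 ^ k * energy (\<lambda>x. H (Suc k) x - H k x) \<le> 4 ^ k * (1 / 8) ^ k"
        by (intro mult_left_mono small) simp
      also have "\<dots> = (1 / 2) ^ k" by (simp add: power_mult_distrib[symmetric])
      finally show "4 ^ k * energy (\<lambda>x. H (Suc k) x - H k x) \<le> (1 / 2) ^ k" .
    qed
    finally show "(\<integral>\<^sup>+x. ennreal (4 ^ k * \<delta> k x) \<partial>lborel) \<le> ennreal ((1 / 2) ^ k)" .
  qed auto
  also have "\<dots> = ennreal (\<Sum>k. (1 / 2) ^ k)"
    by (rule suminf_ennreal2) (auto intro: summable_geometric)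
  also have "\<dots> < \<infinity>" by simp
  finally have "AE x in lborel. (\<Sum>k. ennreal (4 ^ k * \<delta> k x)) \<noteq> \<infinity>"
    by (intro nn_integral_PInf_AE) auto
  then show ?thesis using AE_bil_lower
  proof eventually_elim
    case (elim x)
    obtain B where B: "(\<Sum>k. ennreal (4 ^ k * \<delta> k x)) = ennreal B" "B \<ge> 0"
      using elim(1) by (metis ennreal_cases infinity_ennreal_def)
    have "4 ^ k * \<delta> k x \<le> B" for k
    proof -
      have "ennreal (4 ^ k * \<delta> k x) \<le> (\<Sum>k. ennreal (4 ^ k * \<delta> k x))"
        using sum_le_suminf[of "\<lambda>k. ennreal (4 ^ k * \<delta> k x)" "{k}"] by auto
      then show ?thesis using B by simp
    qed
    have bd: "norm (H (Suc k) x - H k x) \<le> sqrt (B / l x) * (1 / 2) ^ k" for k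
    proof -
      have "4 ^ k * (l x * (norm (H (Suc k) x - H k x))\<^sup>2) \<le> 4 ^ k * \<delta> k x"
        using elim(2) unfolding \<delta>_def by (intro mult_left_mono) auto
      also have "\<dots> \<le> B" by fact
      finally have "(2 ^ k * norm (H (Suc k) x - H k x))\<^sup>2 \<le> B / l x"
        using l_pos[of x] power_mult_distrib[of "2::real" 2 k]
        by (simp add: field_simps power2_eq_square)
      then have "2 ^ k * norm (H (Suc k) x - H k x) \<le> sqrt (B / l x)"
        by (rule real_le_rsqrt)
      then show ?thesis by (simp add: field_simps power_divide)
    qed
    have "summable (\<lambda>k. H (Suc k) x - H k x)"
      by (rule summable_comparison_test[where g="\<lambda>k. sqrt (B / l x) * (1 / 2) ^ k"])
         (use bd in \<open>auto intro!: summable_mult summable_geometric\<close>)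
    then have "(\<lambda>n. \<Sum>k<n. H (Suc k) x - H k x) \<longlonglongrightarrow> (\<Sum>k. H (Suc k) x - H k x)"
      by (rule summable_LIMSEQ)
    then have "(\<lambda>n. H n x - H 0 x) \<longlonglongrightarrow> (\<Sum>k. H (Suc k) x - H k x)"
      by (simp add: sum_lessThan_telescope[of "\<lambda>k. H k x"])
    from tendsto_add[OF this tendsto_const[of "H 0 x"]] show ?case
      by (auto simp: convergent_def)
  qed
qed

text \<open>The Riesz-Fischer argument for the energy seminorm: a fast subsequence converges almost
  everywhere, and Fatou's lemma along it compares every \<open>H n\<close> with the limit.\<close>

lemma energy_complete:
  assumes H: "\<And>n::nat. finite_energy (H n)"
    and cauchy: "\<And>e. 0 < e \<Longrightarrow> \<exists>k. \<forall>m\<ge>k. \<forall>n\<ge>k. energy (\<lambda>x. H m x - H n x) < e"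
  obtains G where "finite_energy G" "(\<lambda>n. energy (\<lambda>x. H n x - G x)) \<longlonglongrightarrow> 0"
proof -
  have Hm [measurable]: "H k \<in> borel_measurable borel" for k using H by (auto simp: finite_energy_def)
  have "\<forall>j. \<exists>k. \<forall>m\<ge>k. \<forall>n\<ge>k. energy (\<lambda>x. H m x - H n x) < (1 / 8) ^ j"
    using cauchy by simp
  then obtain N where N: "\<And>j m n. m \<ge> N j \<Longrightarrow> n \<ge> N j \<Longrightarrow> energy (\<lambda>x. H m x - H n x) < (1 / 8) ^ j"
    by metis
  \<comment> \<open>Adding k and summing over all earlier thresholds makes \<open>s\<close>
    increasing, at least \<open>N k\<close> and at least k. The last property carries the tail of
    the subsequence past any given n in \<open>fatou\<close>.\<close>
  define s where "s k = k + (\<Sum>j\<le>k. N j)" for k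
  have sN: "N k \<le> s k" for k
    using member_le_sum[of k "{..k}" N] by (simp add: s_def)
  have s_Suc: "s k \<le> s (Suc k)" and s_id: "k \<le> s k" for k by (auto simp: s_def)
  \<comment> \<open>Where the subsequence diverges, \<open>lim\<close> has some unspecified value;
    this happens only on a null set.\<close>
  define G where "G x = lim (\<lambda>k. H (s k) x)" for x
  have [measurable]: "G \<in> borel_measurable borel"
    unfolding G_def[abs_def] by (rule borel_measurable_lim_metric) (rule Hm)
  have conv: "AE x in lborel. convergent (\<lambda>k. H (s k) x)"
  proof (rule AE_convergent_Cauchy_energy[of "\<lambda>k. H (s k)"])
    show "energy (\<lambda>x. H (s (Suc k)) x - H (s k) x) \<le> (1 / 8) ^ k" for k
      by (rule less_imp_le, rule N[OF le_trans[OF sN s_Suc] sN])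
  qed (rule H)
  have fatou: "(\<integral>\<^sup>+x. ennreal (bil x (H n x - G x) (H n x - G x)) \<partial>lborel) \<le> ennreal e"
    if e: "\<And>j. j \<ge> n \<Longrightarrow> energy (\<lambda>x. H n x - H j x) \<le> e" for n e
  proof -
    have "(\<integral>\<^sup>+x. ennreal (bil x (H n x - G x) (H n x - G x)) \<partial>lborel) =
      (\<integral>\<^sup>+x. liminf (\<lambda>k. ennreal (bil x (H n x - H (s k) x) (H n x - H (s k) x))) \<partial>lborel)"
    proof (rule nn_integral_cong_AE, use conv in eventually_elim)
      fix x assume "convergent (\<lambda>k. H (s k) x)"
      then have "(\<lambda>k. H (s k) x) \<longlonglongrightarrow> G x" by (simp add: G_def convergent_LIMSEQ_iff)
      then have "(\<lambda>k. H n x - H (s k) x) \<longlonglongrightarrow> H n x - G x" by (intro tendsto_intros)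
      then have "(\<lambda>k. bil x (H n x - H (s k) x) (H n x - H (s k) x)) \<longlonglongrightarrow> bil x (H n x - G x) (H n x - G x)"
        by (rule continuous_on_tendsto_compose[OF continuous_bil]) auto
      then have "(\<lambda>k. ennreal (bil x (H n x - H (s k) x) (H n x - H (s k) x))) \<longlonglongrightarrow> ennreal (bil x (H n x - G x) (H n x - G x))"
        by (rule tendsto_ennrealI)
      from lim_imp_Liminf[OF _ this]
      show "ennreal (bil x (H n x - G x) (H n x - G x)) = liminf (\<lambda>k. ennreal (bil x (H n x - H (s k) x) (H n x - H (s k) x)))"
        by simp
    qed
    also have "\<dots> \<le> liminf (\<lambda>k. \<integral>\<^sup>+x. ennreal (bil x (H n x - H (s k) x) (H n x - H (s k) x)) \<partial>lborel)"
      by (rule nn_integral_liminf) measurable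
    also have "\<dots> = liminf (\<lambda>k. ennreal (energy (\<lambda>x. H n x - H (s k) x)))"
      by (subst nn_energy[OF finite_energy_diff[OF H H]]) simp
    also have "\<dots> \<le> ennreal e"
    proof (rule Liminf_le)
      show "\<forall>\<^sub>F k in sequentially. ennreal (energy (\<lambda>x. H n x - H (s k) x)) \<le> ennreal e"
        by (rule eventually_sequentiallyI[of n]) (intro ennreal_leI e le_trans[OF _ s_id])
    qed simp
    finally show ?thesis .
  qed
  obtain n0 where n0: "\<And>j. j \<ge> n0 \<Longrightarrow> energy (\<lambda>x. H n0 x - H j x) \<le> 1"
    using cauchy[of 1] by (meson le_less_linear less_imp_le order_refl zero_less_one)
  have "finite_energy (\<lambda>x. H n0 x - G x)"
    by (rule finite_energyI_nn) (use fatou[OF n0] in \<open>auto intro: le_less_trans\<close>)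
  from finite_energy_diff[OF H[of n0] this] have G: "finite_energy G" by simp
  have "(\<lambda>n. energy (\<lambda>x. H n x - G x)) \<longlonglongrightarrow> 0"
  proof (rule LIMSEQ_I)
    fix e :: real assume "e > 0"
    then obtain k where k: "\<And>m n. m \<ge> k \<Longrightarrow> n \<ge> k \<Longrightarrow> energy (\<lambda>x. H m x - H n x) < e / 2"
      using cauchy[of "e / 2"] by auto
    have "norm (energy (\<lambda>x. H n x - G x) - 0) < e" if "n \<ge> k" for n
    proof -
      have "ennreal (energy (\<lambda>x. H n x - G x)) \<le> ennreal (e / 2)"
        unfolding nn_energy[OF finite_energy_diff[OF H G], symmetric]
        by (rule fatou) (use k that in \<open>auto intro!: less_imp_le\<close>)
      then show ?thesis using \<open>e > 0\<close> energy_nonneg[of "\<lambda>x. H n x - G x"] by (simp add: ennreal_le_iff)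
    qed
    then show "\<exists>k. \<forall>n\<ge>k. norm (energy (\<lambda>x. H n x - G x) - 0) < e" by blast
  qed
  with G show ?thesis by (rule that)
qed

end

section \<open>Square integrable functions and the form domain\<close>

lemma Lp_on_2_UNIV: "u \<in> Lp_on 2 UNIV \<longleftrightarrow> u \<in> borel_measurable borel \<and> integrable lborel (\<lambda>x. (u x)\<^sup>2)"
  by (simp add: Lp_on_def set_borel_measurable_def set_integrable_def powr_numeral)

lemma L2_mult_integrable:
  assumes "f \<in> Lp_on 2 UNIV" "g \<in> Lp_on 2 UNIV"
  shows "integrable lborel (\<lambda>x. f x * g x)"
proof (rule Bochner_Integration.integrable_bound)
  show "integrable lborel (\<lambda>x. (f x)\<^sup>2 + (g x)\<^sup>2)" using assms by (auto simp: Lp_on_2_UNIV)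
  show "(\<lambda>x. f x * g x) \<in> borel_measurable lborel" using assms by (auto simp: Lp_on_2_UNIV)
  have "\<bar>a * b\<bar> \<le> a\<^sup>2 + b\<^sup>2" for a b :: real
  proof -
    have "2 * \<bar>a * b\<bar> \<le> a\<^sup>2 + b\<^sup>2" "0 \<le> \<bar>a * b\<bar>"
      using sum_squares_bound[of "\<bar>a\<bar>" "\<bar>b\<bar>"] by (simp_all add: abs_mult mult.assoc)
    then show ?thesis by linarith
  qed
  then show "AE x in lborel. norm (f x * g x) \<le> norm ((f x)\<^sup>2 + (g x)\<^sup>2)" by (intro AE_I2) simp
qed

lemma L2_locally_integrable:
  assumes "u \<in> borel_measurable borel"
    and "\<And>K. compact K \<Longrightarrow> integrable lborel (\<lambda>x. indicator K x * (u x)\<^sup>2)"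
  shows "locally_integrable UNIV u"
  unfolding locally_integrable_def set_integrable_def real_scaleR_def
proof (intro allI impI)
  fix K :: "(real^'a) set" assume K: "compact K \<and> K \<subseteq> UNIV"
  note [measurable] = assms(1) borel_compact[OF conjunct1[OF K]]
  show "integrable lborel (\<lambda>x. indicator K x * u x)"
  proof (rule Bochner_Integration.integrable_bound)
    show "integrable lborel (\<lambda>x. indicator K x + indicator K x * (u x)\<^sup>2 :: real)"
      using K emeasure_compact_finite[of K]
      by (intro Bochner_Integration.integrable_add assms integrable_real_indicator) auto
    have "\<bar>a\<bar> \<le> 1 + a\<^sup>2" for a :: real
      using sum_squares_bound[of "\<bar>a\<bar>" 1] by (auto simp: abs_if split: if_splits)
    then show "AE x in lborel. norm (indicator K x * u x) \<le> norm (indicator K x + indicator K x * (u x)\<^sup>2 :: real)"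
      by (intro AE_I2) (auto split: split_indicator)
  qed measurable
qed

lemma test_L2:
  assumes "\<phi> \<in> test_functions UNIV" shows "\<phi> \<in> Lp_on 2 UNIV"
  using test_measurable[OF assms] test_integrable[OF test_mult[OF assms assms]]
  by (simp add: Lp_on_2_UNIV power2_eq_square)

lemma L2_diff:
  assumes "f \<in> Lp_on 2 UNIV" "g \<in> Lp_on 2 UNIV"
  shows "(\<lambda>x. f x - g x) \<in> Lp_on 2 UNIV"
  using assms L2_mult_integrable[OF assms] unfolding Lp_on_2_UNIV power2_diff
  by (auto simp: mult.assoc)

text \<open>The concave functional maximised by the resolvent of f at level 1. It uses classical
  gradients and mentions neither the form domain nor a choice of weak derivatives, so its dependence
  on the coefficients is explicit.\<close>

definition resolvent_functional ::
  "(real ^ 'n::finite \<Rightarrow> real ^ 'n ^ 'n) \<Rightarrow> (real ^ 'n \<Rightarrow> real) \<Rightarrow> (real ^ 'n \<Rightarrow> real) \<Rightarrow> real" where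
  "resolvent_functional A f v = 2 * (LINT x|lborel. f x * v x) -
     (LINT x|lborel. (A x *v gradient v x) \<bullet> gradient v x) - (LINT x|lborel. (v x)\<^sup>2)"

context elliptic_field
begin

lemma dform_bil:
  assumes "has_weak_gradient u G" "has_weak_gradient v H"
    and [measurable]: "G \<in> borel_measurable borel" "H \<in> borel_measurable borel"
  shows "dform A UNIV u v = (LINT x|lborel. bil x (G x) (H x))"
proof -
  note [measurable] = weak_gradient_measurable[OF assms(1)] weak_gradient_measurable[OF assms(2)]
  have "dform A UNIV u v = (LINT x|lborel. bil x (weak_gradient u x) (weak_gradient v x))"
    by (simp add: dform_eq bil_def)
  also have "\<dots> = (LINT x|lborel. bil x (G x) (H x))"
    using weak_gradient_AE_eq[OF assms(1)] weak_gradient_AE_eq[OF assms(2)]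
    by (intro integral_cong_AE) (measurable, auto)
  finally show ?thesis .
qed

lemma dform_sym: "dform A UNIV u v = dform A UNIV v u"
  unfolding dform_eq using bil_sym by (simp add: bil_def)

lemma dform_test_diff:
  assumes "\<phi> \<in> test_functions UNIV" "\<psi> \<in> test_functions UNIV"
  shows "dform A UNIV (\<lambda>x. \<phi> x - \<psi> x) (\<lambda>x. \<phi> x - \<psi> x) = energy (\<lambda>x. gradient \<phi> x - gradient \<psi> x)"
  using dform_bil[OF test_has_weak_gradient[OF test_diff[OF assms]] test_has_weak_gradient[OF test_diff[OF assms]]]
    gradient_measurable[OF test_diff[OF assms]]
  by (simp add: gradient_diff[OF assms] energy_def)

lemma test_form_domain:
  assumes "\<phi> \<in> test_functions UNIV" shows "\<phi> \<in> form_domain A UNIV"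
proof -
  have "dform A UNIV (\<lambda>x. \<phi> x - \<phi> x) (\<lambda>x. \<phi> x - \<phi> x) = 0"
    unfolding dform_test_diff[OF assms assms] by (simp add: energy_def bil_def)
  then show ?thesis
    using assms test_L2[OF assms] unfolding form_domain_def
    by (intro CollectI conjI exI[of _ "\<lambda>_. \<phi>"]) (auto simp: set_lebesgue_integral_def)
qed

text \<open>The Cauchy condition on the approximating sequence gives an energy limit G of its
  gradients. On the support of a fixed test function 1/l is bounded, so energy controls the L2 norm
  there, and the integration by parts formula passes to the limit. Thus G is the weak gradient of
  u.\<close>

lemma form_domain_gradient:
  assumes u: "u \<in> form_domain A UNIV"
  obtains \<phi> G where "\<And>n. \<phi> n \<in> test_functions UNIV"
    "(\<lambda>n. LINT x|lborel. (\<phi> n x - u x)\<^sup>2) \<longlonglongrightarrow> 0"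
    "finite_energy G" "has_weak_gradient u G"
    "(\<lambda>n. energy (\<lambda>x. gradient (\<phi> n) x - G x)) \<longlonglongrightarrow> 0"
proof -
  from u obtain \<phi> where phi': "\<forall>n. \<phi> n \<in> test_functions UNIV"
    and L2: "(\<lambda>n. LINT x|lborel. (\<phi> n x - u x)\<^sup>2) \<longlonglongrightarrow> 0"
    and cauchy': "\<forall>e>0. \<exists>k. \<forall>m\<ge>k. \<forall>n\<ge>k. dform A UNIV (\<lambda>x. \<phi> m x - \<phi> n x) (\<lambda>x. \<phi> m x - \<phi> n x) < e"
    unfolding form_domain_def set_lebesgue_integral_def by auto
  have phi: "\<phi> n \<in> test_functions UNIV" for n using phi' by blast
  have cauchy: "\<exists>k. \<forall>m\<ge>k. \<forall>n\<ge>k. energy (\<lambda>x. gradient (\<phi> m) x - gradient (\<phi> n) x) < e" if "e > 0" for e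
    using cauchy' that by (simp add: dform_test_diff[OF phi phi])
  from u have uL2: "u \<in> Lp_on 2 UNIV" by (simp add: form_domain_def)
  then have [measurable]: "u \<in> borel_measurable borel" and ui: "integrable lborel (\<lambda>x. (u x)\<^sup>2)"
    by (auto simp: Lp_on_2_UNIV)
  obtain G where G: "finite_energy G" and lim: "(\<lambda>n. energy (\<lambda>x. gradient (\<phi> n) x - G x)) \<longlonglongrightarrow> 0"
    using energy_complete[of "\<lambda>n. gradient (\<phi> n)", OF finite_energy_gradient[OF phi] cauchy] by blast
  have [measurable]: "G \<in> borel_measurable borel" using G by (simp add: finite_energy_def)
  note [measurable] = gradient_measurable[OF phi]
  have local_bound: "\<exists>c\<ge>0. AE x in lborel. \<forall>\<xi>::real^'n. x \<in> K \<longrightarrow> (norm \<xi>)\<^sup>2 \<le> c * bil x \<xi> \<xi>" if K: "compact K" for K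
  proof -
    obtain c where c: "AE x in lborel. x \<in> K \<longrightarrow> 1 / l x \<le> c" using l_loc[OF K] by blast
    have "AE x in lborel. \<forall>\<xi>::real^'n. x \<in> K \<longrightarrow> (norm \<xi>)\<^sup>2 \<le> \<bar>c\<bar> * bil x \<xi> \<xi>"
      using c AE_bil_lower
    proof (eventually_elim, intro allI impI)
      fix x \<xi> :: "real^'n" assume *: "x \<in> K \<longrightarrow> 1 / l x \<le> c" "\<forall>\<xi>. l x * (norm \<xi>)\<^sup>2 \<le> bil x \<xi> \<xi>" "x \<in> K"
      have "1 / l x \<le> \<bar>c\<bar>" using *(1,3) by simp
      then have "1 \<le> \<bar>c\<bar> * l x" using l_pos[of x] by (simp add: field_simps)
      then have "1 * (norm \<xi>)\<^sup>2 \<le> (\<bar>c\<bar> * l x) * (norm \<xi>)\<^sup>2" by (intro mult_right_mono) auto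
      also have "\<dots> = \<bar>c\<bar> * (l x * (norm \<xi>)\<^sup>2)" by simp
      also have "\<dots> \<le> \<bar>c\<bar> * bil x \<xi> \<xi>" using *(2) by (intro mult_left_mono) auto
      finally show "(norm \<xi>)\<^sup>2 \<le> \<bar>c\<bar> * bil x \<xi> \<xi>" by simp
    qed
    then show ?thesis by (intro exI[of _ "\<bar>c\<bar>"]) simp
  qed
  have component_L2: "integrable lborel (\<lambda>x. indicator K x * (H x $ i)\<^sup>2)"
      "(LINT x|lborel. indicator K x * (H x $ i)\<^sup>2) \<le> c * energy H"
    if K: "compact K" and H: "finite_energy H" and c: "AE x in lborel. \<forall>\<xi>::real^'n. x \<in> K \<longrightarrow> (norm \<xi>)\<^sup>2 \<le> c * bil x \<xi> \<xi>"
      and "c \<ge> 0" for K H i c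
  proof -
    have [measurable]: "K \<in> sets borel" "H \<in> borel_measurable borel"
      using K H by (auto simp: finite_energy_def borel_compact)
    have int: "integrable lborel (\<lambda>x. c * bil x (H x) (H x))" using H by (simp add: finite_energy_def)
    have le: "AE x in lborel. indicator K x * (H x $ i)\<^sup>2 \<le> c * bil x (H x) (H x)"
      using c AE_bil_nonneg
    proof eventually_elim
      case (elim x)
      have "(H x $ i)\<^sup>2 \<le> (norm (H x))\<^sup>2"
        using component_le_norm_cart[of "H x" i] by (intro abs_le_square_iff[THEN iffD1]) simp
      then show ?case using elim \<open>c \<ge> 0\<close> by (auto split: split_indicator intro: order_trans)
    qed
    show i: "integrable lborel (\<lambda>x. indicator K x * (H x $ i)\<^sup>2)"
      by (rule Bochner_Integration.integrable_bound[OF int])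
         (measurable, use le in \<open>eventually_elim; force split: split_indicator\<close>)
    show "(LINT x|lborel. indicator K x * (H x $ i)\<^sup>2) \<le> c * energy H"
      using integral_mono_AE[OF i int le] by (simp add: energy_def)
  qed
  have "has_weak_deriv UNIV i u (\<lambda>x. G x $ i)" for i
    unfolding has_weak_deriv_def
  proof (intro conjI ballI)
    show "locally_integrable UNIV u"
    proof (rule L2_locally_integrable)
      fix K :: "(real^'n) set" assume "compact K"
      then have [measurable]: "K \<in> sets borel" by (rule borel_compact)
      show "integrable lborel (\<lambda>x. indicator K x * (u x)\<^sup>2)"
        using integrable_real_mult_indicator[OF _ ui, of K] by (simp add: mult.commute)
    qed measurable
    show "locally_integrable UNIV (\<lambda>x. G x $ i)"
    proof (rule L2_locally_integrable)
      fix K :: "(real^'n) set" assume K: "compact K"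
      then show "integrable lborel (\<lambda>x. indicator K x * (G x $ i)\<^sup>2)"
        using local_bound[OF K] component_L2(1)[OF K G] by blast
    qed measurable
    fix \<psi> :: "real^'n \<Rightarrow> real" assume psi: "\<psi> \<in> test_functions UNIV"
    note [measurable] = test_measurable[OF psi] test_measurable[OF test_partial[OF psi]]
    obtain R where R: "\<And>x. R < norm x \<Longrightarrow> \<psi> x = 0" using test_supportE[OF psi] by blast
    define K where "K = cball (0::real^'n) R"
    have K: "compact K" by (simp add: K_def)
    have [measurable]: "K \<in> sets borel" by (simp add: K_def)
    obtain c where c: "c \<ge> 0" "AE x in lborel. \<forall>\<xi>::real^'n. x \<in> K \<longrightarrow> (norm \<xi>)\<^sup>2 \<le> c * bil x \<xi> \<xi>"
      using local_bound[OF K] by blast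
    have fe: "finite_energy (\<lambda>x. gradient (\<phi> n) x - G x)" for n
      by (intro finite_energy_diff finite_energy_gradient phi G)
    have psi2: "integrable lborel (\<lambda>x. (\<psi> x)\<^sup>2)" "integrable lborel (\<lambda>x. (partial_deriv i \<psi> x)\<^sup>2)"
      using test_L2[OF psi] test_L2[OF test_partial[OF psi]] by (auto simp: Lp_on_2_UNIV)
    have phi_u: "integrable lborel (\<lambda>x. (\<phi> n x - u x)\<^sup>2)" for n
      using L2_diff[OF test_L2[OF phi] uL2] by (simp add: Lp_on_2_UNIV)
    note [measurable] = test_measurable[OF phi]
    \<comment> \<open>Gradients converge in L2 only locally, so the error is cut off to a ball that
      contains the support of \<psi>.\<close>
    define d where "d n x = indicator K x * (gradient (\<phi> n) x - G x) $ i" for n x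
    have [measurable]: "d n \<in> borel_measurable borel" for n unfolding d_def by measurable
    have d2: "(d n x)\<^sup>2 = indicator K x * ((gradient (\<phi> n) x - G x) $ i)\<^sup>2" for n x
      by (auto simp: d_def split: split_indicator)
    have 1: "(\<lambda>n. LINT x|lborel. (\<phi> n x - u x) * partial_deriv i \<psi> x) \<longlonglongrightarrow> 0"
      by (rule integral_mult_tendsto_0) (use psi2 phi_u L2 in auto)
    have 2: "integrable lborel (\<lambda>x. d n x * \<psi> x)" "(\<lambda>n. LINT x|lborel. d n x * \<psi> x) \<longlonglongrightarrow> 0" for n
    proof (atomize(full), rule conjI)
      have i: "integrable lborel (\<lambda>x. (d n x)\<^sup>2)" for n
        unfolding d2 by (rule component_L2(1)[OF K fe c(2,1)])
      have "(\<lambda>n. LINT x|lborel. (d n x)\<^sup>2) \<longlonglongrightarrow> 0"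
      proof (rule tendsto_sandwich[where f="\<lambda>_. 0"])
        show "(\<lambda>n. c * energy (\<lambda>x. gradient (\<phi> n) x - G x)) \<longlonglongrightarrow> 0"
          using tendsto_mult_right_zero[OF lim] .
        show "\<forall>\<^sub>F n in sequentially. (LINT x|lborel. (d n x)\<^sup>2) \<le> c * energy (\<lambda>x. gradient (\<phi> n) x - G x)"
          unfolding d2 by (intro always_eventually allI component_L2(2)[OF K fe c(2,1)])
      qed auto
      then show "integrable lborel (\<lambda>x. d n x * \<psi> x)" "(\<lambda>n. LINT x|lborel. d n x * \<psi> x) \<longlonglongrightarrow> 0"
        using i psi2 by (auto intro!: integral_mult_tendsto_0)
    qed
    have loc_u: "integrable lborel (\<lambda>x. u x * partial_deriv i \<psi> x)"
      by (rule L2_mult_integrable[OF uL2 test_L2[OF test_partial[OF psi]]])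
    have loc_phi: "integrable lborel (\<lambda>x. \<phi> n x * partial_deriv i \<psi> x)" "integrable lborel (\<lambda>x. partial_deriv i (\<phi> n) x * \<psi> x)" for n
      by (intro test_integrable test_mult test_partial phi psi)+
    have dpsi: "d n x * \<psi> x = partial_deriv i (\<phi> n) x * \<psi> x - G x $ i * \<psi> x" for n x
      using R[of x] by (auto simp: d_def K_def gradient_def left_diff_distrib split: split_indicator)
    have loc_G: "integrable lborel (\<lambda>x. G x $ i * \<psi> x)"
    proof -
      have "integrable lborel (\<lambda>x. partial_deriv i (\<phi> 0) x * \<psi> x - d 0 x * \<psi> x)"
        by (intro Bochner_Integration.integrable_diff loc_phi 2)
      then show ?thesis by (simp add: dpsi)
    qed
    \<comment> \<open>The left side tends to 0 while the right side does not depend on n; so the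
      right side is 0, which is the weak derivative identity.\<close>
    have eq: "(LINT x|lborel. (\<phi> n x - u x) * partial_deriv i \<psi> x) + (LINT x|lborel. d n x * \<psi> x) =
      - (LINT x|lborel. u x * partial_deriv i \<psi> x) - (LINT x|lborel. G x $ i * \<psi> x)" for n
    proof -
      have "(LINT x|lborel. \<phi> n x * partial_deriv i \<psi> x) = - (LINT x|lborel. partial_deriv i (\<phi> n) x * \<psi> x)"
        using test_has_weak_deriv[OF phi] psi by (simp add: has_weak_deriv_def set_lebesgue_integral_def)
      then show ?thesis
        unfolding dpsi left_diff_distrib using loc_u loc_phi loc_G by simp
    qed
    have "(\<lambda>n. (LINT x|lborel. (\<phi> n x - u x) * partial_deriv i \<psi> x) + (LINT x|lborel. d n x * \<psi> x)) \<longlonglongrightarrow> 0 + 0"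
      by (intro tendsto_add 1 2)
    then show "(LINT x:UNIV|lborel. u x * partial_deriv i \<psi> x) = - (LINT x:UNIV|lborel. G x $ i * \<psi> x)"
      unfolding eq by (simp add: LIMSEQ_const_iff set_lebesgue_integral_def)
  qed
  then have "has_weak_gradient u G" by (simp add: has_weak_gradient_def)
  from that[OF phi L2 G this lim] show ?thesis .
qed

subsection \<open>The variational characterisation of the resolvent\<close>

abbreviation J :: "(real ^ 'n \<Rightarrow> real) \<Rightarrow> (real ^ 'n \<Rightarrow> real) \<Rightarrow> real" where
  "J \<equiv> resolvent_functional A"

lemma J_eq: "J f v = 2 * (LINT x|lborel. f x * v x) - energy (gradient v) - (LINT x|lborel. (v x)\<^sup>2)"
  by (simp add: resolvent_functional_def energy_def bil_def)

text \<open>Completing the square: the resolvent equation is tested with v, which gives the mixed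
  terms, and with g itself, which gives the value at the maximum.\<close>

lemma resolvent_identity:
  assumes f: "f \<in> Lp_on 2 UNIV" and g: "form_resolvent A UNIV 1 f g"
    and G: "finite_energy G" "has_weak_gradient g G" and v: "v \<in> test_functions UNIV"
  shows "J f v = (LINT x|lborel. f x * g x) - energy (\<lambda>x. gradient v x - G x) - (LINT x|lborel. (v x - g x)\<^sup>2)"
proof -
  have dom: "g \<in> form_domain A UNIV" and gL2: "g \<in> Lp_on 2 UNIV"
    using g by (auto simp: form_resolvent_def form_domain_def)
  have Gm: "G \<in> borel_measurable borel" using G by (simp add: finite_energy_def)
  have eq: "w \<in> form_domain A UNIV \<Longrightarrow> dform A UNIV g w + (LINT x|lborel. g x * w x) = (LINT x|lborel. f x * w x)" for w
    using g by (simp add: form_resolvent_def set_lebesgue_integral_def)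
  have "dform A UNIV g v = (LINT x|lborel. bil x (G x) (gradient v x))"
    by (intro dform_bil G test_has_weak_gradient v Gm gradient_measurable)
  with eq[OF test_form_domain[OF v]] have 1: "(LINT x|lborel. bil x (gradient v x) (G x)) + (LINT x|lborel. v x * g x) = (LINT x|lborel. f x * v x)"
    by (simp add: bil_sym[of _ "gradient v _"] mult.commute)
  have "dform A UNIV g g = energy G"
    unfolding energy_def by (intro dform_bil G Gm)
  with eq[OF dom] have 2: "energy G + (LINT x|lborel. (g x)\<^sup>2) = (LINT x|lborel. f x * g x)"
    by (simp add: power2_eq_square)
  have "(LINT x|lborel. (v x - g x)\<^sup>2) = (LINT x|lborel. (v x)\<^sup>2) + (LINT x|lborel. (g x)\<^sup>2) - 2 * (LINT x|lborel. v x * g x)"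
    using test_L2[OF v] gL2 L2_mult_integrable[OF test_L2[OF v] gL2]
    by (simp add: power2_diff Lp_on_2_UNIV mult.assoc)
  with 1 2 energy_diff[OF finite_energy_gradient[OF v] G(1)] show ?thesis
    by (simp add: J_eq)
qed

lemma resolvent_upper:
  assumes f: "f \<in> Lp_on 2 UNIV" and g: "form_resolvent A UNIV 1 f g" and v: "v \<in> test_functions UNIV"
  shows "J f v \<le> (LINT x|lborel. f x * g x)"
proof -
  have "g \<in> form_domain A UNIV" using g by (simp add: form_resolvent_def)
  then obtain G where "finite_energy G" "has_weak_gradient g G" by (rule form_domain_gradient) blast
  from resolvent_identity[OF f g this v] show ?thesis
    using energy_nonneg[of "\<lambda>x. gradient v x - G x"]
      Bochner_Integration.integral_nonneg[of lborel "\<lambda>x. (v x - g x)\<^sup>2", OF zero_le_power2] by linarith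
qed

text \<open>The test functions that put g into the form domain form a maximising sequence, since
  both deficits in \<open>resolvent_identity\<close> vanish along it.\<close>

lemma resolvent_approx:
  assumes f: "f \<in> Lp_on 2 UNIV" and g: "form_resolvent A UNIV 1 f g" and "e > 0"
  obtains v where "v \<in> test_functions UNIV" "(LINT x|lborel. f x * g x) - e < J f v"
proof -
  have "g \<in> form_domain A UNIV" using g by (simp add: form_resolvent_def)
  then obtain \<phi> G where phi: "\<And>n. \<phi> n \<in> test_functions UNIV"
    and 1: "(\<lambda>n. LINT x|lborel. (\<phi> n x - g x)\<^sup>2) \<longlonglongrightarrow> 0"
    and G: "finite_energy G" "has_weak_gradient g G"
    and 2: "(\<lambda>n. energy (\<lambda>x. gradient (\<phi> n) x - G x)) \<longlonglongrightarrow> 0"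
    by (rule form_domain_gradient) blast
  have "(\<lambda>n. J f (\<phi> n)) \<longlonglongrightarrow> (LINT x|lborel. f x * g x) - 0 - 0"
    unfolding resolvent_identity[OF f g G phi] by (intro tendsto_intros 1 2)
  then have "\<forall>\<^sub>F n in sequentially. (LINT x|lborel. f x * g x) - e < J f (\<phi> n)"
    using \<open>e > 0\<close> by (intro order_tendstoD) auto
  then obtain n where "(LINT x|lborel. f x * g x) - e < J f (\<phi> n)"
    by (auto simp: eventually_sequentially)
  with phi show ?thesis by (rule that)
qed

lemma resolvent_symmetric:
  assumes "form_resolvent A UNIV 1 f g" "form_resolvent A UNIV 1 f' g'"
  shows "(LINT x|lborel. f x * g' x) = (LINT x|lborel. f' x * g x)"
  using assms dform_sym[of g g']
  unfolding form_resolvent_def set_lebesgue_integral_def by (simp add: mult.commute[of "g _"]) metis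

end

subsection \<open>A countable family of test functions\<close>

lemma has_derivative_gradient:
  assumes "\<phi> differentiable (at x)"
  shows "(\<phi> has_derivative (\<lambda>h. gradient \<phi> x \<bullet> h)) (at x)"
proof -
  have d: "(\<phi> has_derivative frechet_derivative \<phi> (at x)) (at x)"
    using assms by (simp add: frechet_derivative_works)
  then have lin: "linear (frechet_derivative \<phi> (at x))"
    by (rule has_derivative_linear)
  have "frechet_derivative \<phi> (at x) h = gradient \<phi> x \<bullet> h" for h
  proof -
    have "frechet_derivative \<phi> (at x) h = frechet_derivative \<phi> (at x) (\<Sum>i\<in>UNIV. h $ i *\<^sub>R axis i 1)"
      using basis_expansion[of h] by (simp add: scalar_mult_eq_scaleR)
    also have "\<dots> = gradient \<phi> x \<bullet> h"
      using lin by (simp add: linear_sum linear_scale gradient_def inner_vec_def partial_deriv_def mult.commute)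
    finally show ?thesis .
  qed
  then have "frechet_derivative \<phi> (at x) = (\<lambda>h. gradient \<phi> x \<bullet> h)" by (rule ext)
  with d show ?thesis by simp
qed

lemma test_lipschitz:
  assumes phi: "\<phi> \<in> test_functions UNIV"
  obtains C where "0 < C" "\<And>x y. \<bar>\<phi> x - \<phi> y\<bar> \<le> C * norm (x - y)"
proof -
  obtain C R where C: "0 < C" "\<And>x. (norm (gradient \<phi> x))\<^sup>2 \<le> C * indicator (cball 0 R) x"
    using gradient_bound[OF phi] by metis
  have g: "norm (gradient \<phi> x) \<le> sqrt C" for x
  proof (rule real_le_rsqrt)
    have "C * indicator (cball 0 R) x \<le> C * 1" using C(1) by (intro mult_left_mono) (auto split: split_indicator)
    then show "(norm (gradient \<phi> x))\<^sup>2 \<le> C" using C(2)[of x] by simp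
  qed
  have "norm (\<phi> x - \<phi> y) \<le> sqrt C * norm (x - y)" for x y
  proof (rule differentiable_bound[where S=UNIV and f'="\<lambda>x h. gradient \<phi> x \<bullet> h"])
    show "onorm ((\<bullet>) (gradient \<phi> x)) \<le> sqrt C" for x
    proof (rule onorm_le)
      fix h
      have "norm (gradient \<phi> x \<bullet> h) \<le> norm (gradient \<phi> x) * norm h"
        using Cauchy_Schwarz_ineq2 by simp
      also have "\<dots> \<le> sqrt C * norm h" by (intro mult_right_mono g) simp
      finally show "norm (gradient \<phi> x \<bullet> h) \<le> sqrt C * norm h" .
    qed
  qed (auto intro: has_derivative_gradient test_differentiable[OF phi])
  with C(1) show ?thesis by (intro that[of "sqrt C"]) auto
qed

text \<open>The common bounds and the common support supply the dominating functions in
  \<open>J_tendsto\<close>. One natural number governs all the bounds, so countably many classes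
  exhaust the test functions.\<close>

definition bounded_tests :: "nat \<Rightarrow> (real ^ 'n::finite \<Rightarrow> real) set" where
  "bounded_tests m = {\<phi> \<in> test_functions UNIV.
     (\<forall>x. \<bar>\<phi> x\<bar> \<le> real m * indicator (cball 0 (real m)) x) \<and>
     (\<forall>x. norm (gradient \<phi> x) \<le> real m * indicator (cball 0 (real m)) x) \<and>
     (\<forall>x y. \<bar>\<phi> x - \<phi> y\<bar> \<le> real m * norm (x - y)) \<and>
     (\<forall>x y. norm (gradient \<phi> x - gradient \<phi> y) \<le> real m * norm (x - y))}"

lemma test_in_bounded_tests:
  assumes phi: "\<phi> \<in> test_functions UNIV"
  obtains m where "\<phi> \<in> bounded_tests m"
proof -
  obtain C1 R1 where 1: "0 < C1" "\<And>x. \<bar>\<phi> x\<bar> \<le> C1 * indicator (cball 0 R1) x"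
    using test_bound[OF phi] by metis
  obtain C2 R2 where 2: "0 < C2" "\<And>x. (norm (gradient \<phi> x))\<^sup>2 \<le> C2 * indicator (cball 0 R2) x"
    using gradient_bound[OF phi] by metis
  obtain C3 where 3: "0 < C3" "\<And>x y. \<bar>\<phi> x - \<phi> y\<bar> \<le> C3 * norm (x - y)"
    using test_lipschitz[OF phi] by metis
  have "\<exists>C>0. \<forall>x y. \<bar>partial_deriv i \<phi> x - partial_deriv i \<phi> y\<bar> \<le> C * norm (x - y)" for i
    using test_lipschitz[OF test_partial[OF phi]] by metis
  then obtain C4 where 4: "\<And>i. 0 < C4 i" "\<And>i x y. \<bar>partial_deriv i \<phi> x - partial_deriv i \<phi> y\<bar> \<le> C4 i * norm (x - y)"
    by metis
  \<comment> \<open>The radii come without a sign; the added absolute values let the sum dominate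
    each constant separately.\<close>
  obtain m where m: "C1 + R1 + sqrt C2 + R2 + C3 + (\<Sum>i\<in>UNIV. C4 i) + \<bar>R1\<bar> + \<bar>R2\<bar> + \<bar>R1\<bar> + \<bar>R2\<bar> \<le> real m"
    using real_arch_simple by blast
  have s: "0 \<le> (\<Sum>i\<in>UNIV. C4 i)" using 4(1) by (intro sum_nonneg) (auto intro: less_imp_le)
  have s2: "0 < sqrt C2" using 2 by simp
  have le: "C1 \<le> real m" "R1 \<le> real m" "sqrt C2 \<le> real m" "R2 \<le> real m" "C3 \<le> real m" "(\<Sum>i\<in>UNIV. C4 i) \<le> real m"
    using m 1(1) s2 3(1) s by linarith+
  have "\<phi> \<in> bounded_tests m"
    unfolding bounded_tests_def
  proof (intro CollectI conjI allI phi)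
    fix x y
    show "\<bar>\<phi> x\<bar> \<le> real m * indicator (cball 0 (real m)) x"
      using 1(2)[of x] le by (auto split: split_indicator split_indicator_asm)
    show "norm (gradient \<phi> x) \<le> real m * indicator (cball 0 (real m)) x"
    proof (cases "x \<in> cball 0 R2")
      case True
      then have "norm (gradient \<phi> x) \<le> sqrt C2" using 2(2)[of x] by (intro real_le_rsqrt) simp
      with True le show ?thesis by (auto split: split_indicator)
    next
      case False
      then have "gradient \<phi> x = 0" using 2(2)[of x] by simp
      then show ?thesis by (simp split: split_indicator)
    qed
    show "\<bar>\<phi> x - \<phi> y\<bar> \<le> real m * norm (x - y)"
      using 3(2)[of x y] le by (meson mult_right_mono norm_ge_zero order_trans)
    have "norm (gradient \<phi> x - gradient \<phi> y) \<le> (\<Sum>i\<in>UNIV. \<bar>(gradient \<phi> x - gradient \<phi> y) $ i\<bar>)"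
      by (rule norm_le_l1_cart)
    also have "\<dots> \<le> (\<Sum>i\<in>UNIV. C4 i * norm (x - y))"
      by (intro sum_mono) (use 4(2) in \<open>simp add: gradient_def\<close>)
    also have "\<dots> \<le> real m * norm (x - y)"
      unfolding sum_distrib_right[symmetric] using le by (intro mult_right_mono) auto
    finally show "norm (gradient \<phi> x - gradient \<phi> y) \<le> real m * norm (x - y)" .
  qed
  then show ?thesis by (rule that)
qed

lemma tendsto_equi_lipschitz:
  fixes f :: "nat \<Rightarrow> 'a::real_normed_vector \<Rightarrow> 'b::real_normed_vector"
  assumes lip: "\<And>k x y. norm (f k x - f k y) \<le> c * norm (x - y)" "\<And>x y. norm (g x - g y) \<le> c * norm (x - y)"
    and dense: "\<And>U. open U \<Longrightarrow> U \<noteq> {} \<Longrightarrow> \<exists>j::nat. q j \<in> U"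
    and conv: "\<And>j. (\<lambda>k. f k (q j)) \<longlonglongrightarrow> g (q j)"
  shows "(\<lambda>k. f k x) \<longlonglongrightarrow> g x"
proof (rule LIMSEQ_I)
  fix e :: real assume "e > 0"
  \<comment> \<open>An argument with three thirds of e. The sign of c is not known, and
    \<open>\<bar>c\<bar> + 1\<close> is positive in any case.\<close>
  define d where "d = e / (3 * (\<bar>c\<bar> + 1))"
  have "d > 0" using \<open>e > 0\<close> by (simp add: d_def)
  then obtain j where "q j \<in> ball x d" using dense[of "ball x d"] by auto
  then have n: "norm (x - q j) \<le> d" by (simp add: dist_norm)
  have "c * norm (x - q j) \<le> (\<bar>c\<bar> + 1) * d"
    using n by (intro mult_mono) auto
  also have "\<dots> = e / 3" by (simp add: d_def field_simps)
  finally have small: "c * norm (x - q j) \<le> e / 3" .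
  obtain N where N: "\<And>k. k \<ge> N \<Longrightarrow> norm (f k (q j) - g (q j)) < e / 3"
    using LIMSEQ_D[OF conv[of j], of "e / 3"] \<open>e > 0\<close> by auto
  have "norm (f k x - g x) < e" if "k \<ge> N" for k
  proof -
    have "f k x - g x = (f k x - f k (q j)) + (f k (q j) - g (q j)) - (g x - g (q j))" by simp
    then have "norm (f k x - g x) \<le> norm (f k x - f k (q j)) + norm (f k (q j) - g (q j)) + norm (g x - g (q j))"
      by (metis norm_triangle_le norm_triangle_ineq4 add_right_mono norm_triangle_ineq order_trans)
    then show ?thesis
      using lip(1)[of k x "q j"] lip(2)[of x "q j"] N[OF that] small by linarith
  qed
  then show "\<exists>N. \<forall>k\<ge>N. norm (f k x - g x) < e" by blast
qed

definition approximable :: "(real ^ 'n::finite \<Rightarrow> real) set \<Rightarrow> (real ^ 'n \<Rightarrow> real) \<Rightarrow> bool" where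
  "approximable T \<phi> \<longleftrightarrow> (\<exists>w. (\<forall>k::nat. w k \<in> T) \<and>
     (\<forall>x. (\<lambda>k. w k x) \<longlonglongrightarrow> \<phi> x) \<and> (\<forall>x. (\<lambda>k. gradient (w k) x) \<longlonglongrightarrow> gradient \<phi> x))"

text \<open>The functions in \<open>bounded_tests m\<close> are equi-Lipschitz together with their gradients, so pointwise
  convergence on a dense sequence suffices; the values there live in a countable product, which is
  separable.\<close>

lemma bounded_tests_separable:
  "\<exists>T\<subseteq>(bounded_tests m :: (real ^ 'n::finite \<Rightarrow> real) set). countable T \<and> (\<forall>\<phi>\<in>bounded_tests m. approximable T \<phi>)"
proof -
  obtain D :: "(real^'n) set" where D: "countable D" "\<And>U. open U \<Longrightarrow> U \<noteq> {} \<Longrightarrow> \<exists>d\<in>D. d \<in> U"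
    using countable_dense_exists by blast
  have "D \<noteq> {}" using D(2)[of UNIV] by auto
  define q where "q = from_nat_into D"
  have q: "\<exists>j. q j \<in> U" if "open U" "U \<noteq> {}" for U
    using D that from_nat_into_surj[OF D(1)] unfolding q_def by metis
  define h :: "(real^'n \<Rightarrow> real) \<Rightarrow> nat \<Rightarrow> real \<times> (real^'n)" where "h \<phi> j = (\<phi> (q j), gradient \<phi> (q j))" for \<phi> j
  obtain T' where T': "countable T'" "T' \<subseteq> h ` bounded_tests m" "h ` bounded_tests m \<subseteq> closure T'"
    by (rule separable)
  have "\<exists>T\<subseteq>bounded_tests m. countable T \<and> h ` T = T'"
    using T'(1,2) by (metis countable_subset_image subset_refl)
  then obtain T where T: "T \<subseteq> bounded_tests m" "countable T" "h ` T = T'" by blast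
  have "approximable T \<phi>" if phi: "\<phi> \<in> bounded_tests m" for \<phi>
  proof -
    have "h \<phi> \<in> closure T'" using T' phi by auto
    then obtain y where y: "\<And>k::nat. y k \<in> T'" "y \<longlonglongrightarrow> h \<phi>" by (auto simp: closure_sequential)
    then have "\<forall>k. \<exists>w\<in>T. h w = y k" using T(3) by (metis imageE)
    then obtain w where w: "\<And>k. w k \<in> T" "\<And>k. h (w k) = y k" by metis
    have wm: "w k \<in> bounded_tests m" for k using w(1) T(1) by blast
    have "(\<lambda>k. h (w k) j) \<longlonglongrightarrow> h \<phi> j" for j
    proof -
      have "continuous_on UNIV (\<lambda>f::nat \<Rightarrow> real \<times> (real^'n). f j)"
        by (rule continuous_on_product_then_coordinatewise[OF continuous_on_id])
      from continuous_on_tendsto_compose[OF this y(2)] show ?thesis by (simp add: w(2))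
    qed
    then have 1: "(\<lambda>k. w k (q j)) \<longlonglongrightarrow> \<phi> (q j)" and 2: "(\<lambda>k. gradient (w k) (q j)) \<longlonglongrightarrow> gradient \<phi> (q j)" for j
      using tendsto_fst tendsto_snd unfolding h_def by fastforce+
    have "(\<lambda>k. w k x) \<longlonglongrightarrow> \<phi> x" for x
      by (rule tendsto_equi_lipschitz[where f=w and g=\<phi> and q=q and c="real m", OF _ _ q 1])
         (use wm phi in \<open>auto simp: bounded_tests_def\<close>)
    moreover have "(\<lambda>k. gradient (w k) x) \<longlonglongrightarrow> gradient \<phi> x" for x
      by (rule tendsto_equi_lipschitz[where f="\<lambda>k. gradient (w k)" and g="gradient \<phi>" and q=q and c="real m", OF _ _ q 2])
         (use wm phi in \<open>auto simp: bounded_tests_def\<close>)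
    ultimately show ?thesis using w(1) unfolding approximable_def by (intro exI[of _ w] conjI allI)
  qed
  with T(1,2) show ?thesis by blast
qed

definition dense_tests :: "(real ^ 'n::finite \<Rightarrow> real) set" where
  "dense_tests = (\<Union>m. SOME T. T \<subseteq> bounded_tests m \<and> countable T \<and> (\<forall>\<phi>\<in>bounded_tests m. approximable T \<phi>))"

text \<open>The approximating sequence can be taken in the same class \<open>bounded_tests m\<close>
  as its limit. Density in a topology without such bounds would not give convergence of the
  energies.\<close>

lemma dense_tests:
  shows countable_dense_tests: "countable (dense_tests :: (real ^ 'n::finite \<Rightarrow> real) set)"
    and dense_tests_subset: "dense_tests \<subseteq> (test_functions UNIV :: (real ^ 'n \<Rightarrow> real) set)"
    and dense_tests_approx: "\<phi> \<in> bounded_tests m \<Longrightarrow> approximable (dense_tests \<inter> bounded_tests m) (\<phi> :: real ^ 'n \<Rightarrow> real)"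
proof -
  define T :: "nat \<Rightarrow> (real ^ 'n \<Rightarrow> real) set" where
    "T m = (SOME T. T \<subseteq> bounded_tests m \<and> countable T \<and> (\<forall>\<phi>\<in>bounded_tests m. approximable T \<phi>))" for m
  have T: "T m \<subseteq> bounded_tests m \<and> countable (T m) \<and> (\<forall>\<phi>\<in>bounded_tests m. approximable (T m) \<phi>)" for m
    unfolding T_def by (rule someI_ex) (rule bounded_tests_separable)
  have eq: "dense_tests = (\<Union>m. T m)" by (simp add: dense_tests_def T_def)
  show "countable (dense_tests :: (real ^ 'n::finite \<Rightarrow> real) set)"
    unfolding eq using T by (intro countable_UN) auto
  show "dense_tests \<subseteq> (test_functions UNIV :: (real ^ 'n \<Rightarrow> real) set)"
    unfolding eq using T by (fastforce simp: bounded_tests_def)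
  assume "\<phi> \<in> bounded_tests m"
  then have "approximable (T m) \<phi>" using T by blast
  moreover have "T m \<subseteq> dense_tests \<inter> bounded_tests m" unfolding eq using T[of m] by blast
  ultimately show "approximable (dense_tests \<inter> bounded_tests m) \<phi>"
    unfolding approximable_def by (meson subsetD)
qed

context elliptic_field
begin

lemma J_tendsto:
  assumes f: "f \<in> Lp_on 2 UNIV" and w: "\<And>k::nat. w k \<in> bounded_tests m" and v: "v \<in> bounded_tests m"
    and lim: "\<And>x. (\<lambda>k. w k x) \<longlonglongrightarrow> v x" "\<And>x. (\<lambda>k. gradient (w k) x) \<longlonglongrightarrow> gradient v x"
  shows "(\<lambda>k. J f (w k)) \<longlonglongrightarrow> J f v"
proof -
  have wt: "w k \<in> test_functions UNIV" and vt: "v \<in> test_functions UNIV" for k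
    using w v by (auto simp: bounded_tests_def)
  note [measurable] = test_measurable[OF wt] test_measurable[OF vt] gradient_measurable[OF wt] gradient_measurable[OF vt]
  have [measurable]: "f \<in> borel_measurable borel" using f by (simp add: Lp_on_2_UNIV)
  have b1: "\<bar>w k x\<bar> \<le> real m * indicator (cball 0 (real m)) x"
    and b2: "norm (gradient (w k) x) \<le> real m * indicator (cball 0 (real m)) x" for k x
    using w[of k] by (auto simp: bounded_tests_def)
  have ind2: "(real m * indicator (cball 0 (real m)) x)\<^sup>2 = real m ^ 2 * indicator (cball 0 (real m)) x" for x :: "real^'n"
    by (simp split: split_indicator)
  have indL2: "(\<lambda>x::real^'n. real m * indicator (cball 0 (real m)) x) \<in> Lp_on 2 UNIV"
    unfolding Lp_on_2_UNIV ind2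
    by (intro conjI indicator_ball_integrable borel_measurable_times borel_measurable_const borel_measurable_indicator) auto
  have 1: "(\<lambda>k. LINT x|lborel. f x * w k x) \<longlonglongrightarrow> (LINT x|lborel. f x * v x)"
  proof (rule integral_dominated_convergence[where w="\<lambda>x. \<bar>f x * (real m * indicator (cball 0 (real m)) x)\<bar>"])
    show "integrable lborel (\<lambda>x. \<bar>f x * (real m * indicator (cball 0 (real m)) x)\<bar>)"
      by (intro integrable_abs L2_mult_integrable f indL2)
    show "AE x in lborel. norm (f x * w k x) \<le> \<bar>f x * (real m * indicator (cball 0 (real m)) x)\<bar>" for k
      using b1 by (intro AE_I2) (simp add: abs_mult mult_left_mono)
  qed (auto intro!: AE_I2 tendsto_intros lim)
  have 2: "(\<lambda>k. LINT x|lborel. (w k x)\<^sup>2) \<longlonglongrightarrow> (LINT x|lborel. (v x)\<^sup>2)"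
  proof (rule integral_dominated_convergence[where w="\<lambda>x. (real m * indicator (cball 0 (real m)) x)\<^sup>2"])
    show "integrable lborel (\<lambda>x::real^'n. (real m * indicator (cball 0 (real m)) x)\<^sup>2)"
      using indL2 by (simp add: Lp_on_2_UNIV)
    show "AE x in lborel. norm ((w k x)\<^sup>2) \<le> (real m * indicator (cball 0 (real m)) x)\<^sup>2" for k
      using power_mono[OF b1 abs_ge_zero, of k _ 2] by (intro AE_I2) simp
  qed (auto intro!: AE_I2 tendsto_intros lim)
  obtain c where c: "AE x in lborel. x \<in> cball 0 (real m) \<longrightarrow> L x \<le> c" using L_loc[of "cball 0 (real m)"] by auto
  have 3: "(\<lambda>k. energy (gradient (w k))) \<longlonglongrightarrow> energy (gradient v)"
    unfolding energy_def
  proof (rule integral_dominated_convergence[where w="\<lambda>x. c * real m ^ 2 * indicator (cball 0 (real m)) x"])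
    show "integrable lborel (\<lambda>x::real^'n. c * real m ^ 2 * indicator (cball 0 (real m)) x)"
      by (rule indicator_ball_integrable)
    show "AE x in lborel. (\<lambda>k. bil x (gradient (w k) x) (gradient (w k) x)) \<longlonglongrightarrow> bil x (gradient v x) (gradient v x)"
      by (intro AE_I2 continuous_on_tendsto_compose[OF continuous_bil lim(2)]) auto
    show "AE x in lborel. norm (bil x (gradient (w k) x) (gradient (w k) x)) \<le> c * real m ^ 2 * indicator (cball 0 (real m)) x" for k
      using c AE_bil_upper AE_bil_nonneg
    proof eventually_elim
      case (elim x)
      have "bil x (gradient (w k) x) (gradient (w k) x) \<le> L x * (norm (gradient (w k) x))\<^sup>2" using elim by blast
      also have "\<dots> \<le> L x * (real m * indicator (cball 0 (real m)) x)\<^sup>2"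
        using L_pos[of x] by (intro mult_left_mono power_mono b2) auto
      also have "\<dots> \<le> c * (real m * indicator (cball 0 (real m)) x)\<^sup>2"
        using elim by (auto split: split_indicator intro!: mult_right_mono)
      finally show ?case using elim unfolding ind2 by (simp add: mult.assoc)
    qed
  qed measurable
  show ?thesis unfolding J_eq by (intro tendsto_intros 1 2 3)
qed

end

subsection \<open>Occupation measures\<close>

lemma AE_lborel_exists:
  fixes a b :: real
  assumes "AE t in lborel. Q t" "a < b"
  obtains t where "a < t" "t < b" "Q t"
proof (rule ccontr)
  assume "\<not> thesis"
  then have "AE t in lborel. t \<notin> {a<..<b}"
    using assms(1) that by (auto elim: eventually_mono)
  then have "{a<..<b} \<in> null_sets lborel"
    by (subst AE_iff_null_sets) auto
  then have "emeasure lborel {a<..<b} = 0" by (rule null_setsD1)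
  with \<open>a < b\<close> show False by simp
qed

lemma sets_cemetery_borel: "sets cemetery_borel = sigma_sets UNIV (insert {None} ((`) Some ` sets borel))"
  by (simp add: cemetery_borel_def)

lemma space_cemetery_borel [simp]: "space cemetery_borel = UNIV"
  by (simp add: cemetery_borel_def)

lemma None_cemetery [measurable]: "{None} \<in> sets cemetery_borel"
  unfolding sets_cemetery_borel by (intro sigma_sets.Basic) simp

lemma Some_cemetery: "B \<in> sets borel \<Longrightarrow> Some ` B \<in> sets cemetery_borel"
  unfolding sets_cemetery_borel by (intro sigma_sets.Basic) simp

text \<open>The value of \<open>the None\<close> is irrelevant but fixed.\<close>

lemma the_measurable: "the \<in> cemetery_borel \<rightarrow>\<^sub>M borel"
proof (rule measurableI)
  fix B :: "(real ^ 'n) set" assume B: "B \<in> sets borel"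
  have "the -` B = Some ` B \<union> (if the None \<in> B then {None} else {})"
    by (auto simp: image_iff) (metis option.exhaust_sel)+
  moreover have "Some ` B \<union> (if the None \<in> B then {None} else {}) \<in> sets cemetery_borel"
    by (rule sets.Un[OF Some_cemetery[OF B]]) (simp add: None_cemetery)
  ultimately show "the -` B \<inter> space cemetery_borel \<in> sets cemetery_borel"
    by (simp only: space_cemetery_borel Int_UNIV_right)
qed simp

context standard_diffusion
begin

lemma space_P: "space (P x) = space S"
  by (rule sets_eq_imp_space_eq[OF sets_P])

lemma prob_completion: "prob_space (completion (P x))"
  using prob_space.emeasure_space_1[OF prob_P] by (intro prob_spaceI) simp

lemma eq_None_iff: "w \<in> space S \<Longrightarrow> X t w = None \<longleftrightarrow> lifetime X w \<le> t"
  using absorbed by (auto simp: lifetime_def intro: Inf_lower)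

lemma measurable_the_X: "(\<lambda>w. the (X t w)) \<in> S \<rightarrow>\<^sub>M borel"
  using measurable_compose[OF measurable_X the_measurable] .

lemma dead_measurable: "{w \<in> space S. X t w = None} \<in> sets S"
  using measurable_sets[OF measurable_X None_cemetery, of t] by (simp add: vimage_def Int_def conj_commute)

lemma lifetime_measurable: "lifetime X \<in> borel_measurable S"
proof (rule borel_measurableI_le)
  fix t
  have "{w \<in> space S. lifetime X w \<le> t} = {w \<in> space S. X t w = None}"
    using eq_None_iff by auto
  then show "{w \<in> space S. lifetime X w \<le> t} \<in> sets S" by (simp add: dead_measurable)
qed

text \<open>Right continuity allows time to be replaced by grid points to its right, where the map
  is a countable gluing of measurable pieces. From the lifetime on, the value is constantly
  \<open>the None\<close>, so the limit holds there too.\<close>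

lemma jointly_measurable: "(\<lambda>(w, t). the (X (ennreal t) w)) \<in> S \<Otimes>\<^sub>M borel \<rightarrow>\<^sub>M borel"
proof -
  \<comment> \<open>The \<open>+ 1\<close> after the floor makes the grid point strictly larger than
    t, as a limit at the right requires. The maximum with 0 matches the truncation by
    \<open>ennreal\<close>.\<close>
  define T where "T n t = real_of_int (\<lfloor>real (Suc n) * max 0 t\<rfloor> + 1) / real (Suc n)" for n and t :: real
  have T_gt: "max 0 t < T n t" for n t
  proof -
    have "max 0 t * real (Suc n) < real_of_int (\<lfloor>real (Suc n) * max 0 t\<rfloor> + 1)" by (simp add: mult.commute)
    then show ?thesis
      by (simp only: T_def pos_less_divide_eq of_nat_0_less_iff zero_less_Suc)
  qed
  have T_le: "T n t \<le> max 0 t + 1 / real (Suc n)" for n t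
  proof -
    have "real_of_int (\<lfloor>real (Suc n) * max 0 t\<rfloor> + 1) \<le> real (Suc n) * max 0 t + 1" by linarith
    then have "T n t \<le> (real (Suc n) * max 0 t + 1) / real (Suc n)"
      unfolding T_def by (rule divide_right_mono) simp
    also have "\<dots> = max 0 t + 1 / real (Suc n)" by (simp add: field_simps)
    finally show ?thesis .
  qed
  have meas: "(\<lambda>(w, t). the (X (ennreal (T n t)) w)) \<in> S \<Otimes>\<^sub>M borel \<rightarrow>\<^sub>M borel" for n
  proof -
    have "(\<lambda>wt. (\<lambda>(i::int) wt. the (X (ennreal (real_of_int (i + 1) / real (Suc n))) (fst wt)))
        (\<lfloor>real (Suc n) * max 0 (snd wt)\<rfloor>) wt) \<in> S \<Otimes>\<^sub>M borel \<rightarrow>\<^sub>M borel"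
    proof (rule measurable_compose_countable[where g="\<lambda>wt. \<lfloor>real (Suc n) * max 0 (snd wt)\<rfloor>"
          and f="\<lambda>i wt. the (X (ennreal (real_of_int (i + 1) / real (Suc n))) (fst wt))"])
      show "(\<lambda>wt. the (X (ennreal (real_of_int (i + 1) / real (Suc n))) (fst wt))) \<in> S \<Otimes>\<^sub>M borel \<rightarrow>\<^sub>M borel" for i :: int
        by (rule measurable_compose[OF measurable_fst measurable_the_X])
    qed measurable
    then show ?thesis by (simp add: T_def case_prod_beta')
  qed
  have lim: "(\<lambda>n. case wt of (w, t) \<Rightarrow> the (X (ennreal (T n t)) w)) \<longlonglongrightarrow> (case wt of (w, t) \<Rightarrow> the (X (ennreal t) w))"
    if wt_space: "wt \<in> space (S \<Otimes>\<^sub>M (borel :: real measure))" for wt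
  proof -
    from wt_space obtain w t where wt: "wt = (w, t)" "w \<in> space S" by (auto simp: space_pair_measure)
    have T_lim: "(\<lambda>n. T n t) \<longlonglongrightarrow> max 0 t"
    proof (rule tendsto_sandwich[where f="\<lambda>_. max 0 t" and h="\<lambda>n. max 0 t + 1 / real (Suc n)"])
      show "(\<lambda>n. max 0 t + 1 / real (Suc n)) \<longlonglongrightarrow> max 0 t"
        using tendsto_add[OF tendsto_const[of "max 0 t"] LIMSEQ_Suc[OF lim_1_over_n]] by simp
      show "\<forall>\<^sub>F n in sequentially. max 0 t \<le> T n t" "\<forall>\<^sub>F n in sequentially. T n t \<le> max 0 t + 1 / real (Suc n)"
        by (intro always_eventually allI less_imp_le[OF T_gt] T_le)+
    qed simp
    have e: "ennreal t = ennreal (max 0 t)" by (simp add: max_def ennreal_neg)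
    have T_ge: "ennreal t \<le> ennreal (T n t)" for n
      unfolding e using T_gt[where n=n and t=t] by (intro ennreal_leI) simp
    have "(\<lambda>n. the (X (ennreal (T n t)) w)) \<longlonglongrightarrow> the (X (ennreal t) w)"
    proof (cases "ennreal t < lifetime X w")
      case False
      then have "X (ennreal t) w = None" using absorbed[OF wt(2)] by simp
      moreover have "X (ennreal (T n t)) w = None" for n
        using False T_ge[of n] by (intro absorbed[OF wt(2)]) simp
      ultimately show ?thesis by simp
    next
      case True
      have "filterlim (\<lambda>n. ennreal (T n t)) (at_right (ennreal t)) sequentially"
        unfolding filterlim_at
      proof (intro conjI always_eventually allI)
        show "(\<lambda>n. ennreal (T n t)) \<longlonglongrightarrow> ennreal t"
          unfolding e by (rule tendsto_ennrealI[OF T_lim])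
        show "ennreal (T n t) \<in> {ennreal t<..}" "ennreal (T n t) \<noteq> ennreal t" for n
          using T_gt[of t n] ennreal_lessI[of "T n t" t] by auto
      qed
      then show ?thesis by (rule filterlim_compose[OF right_continuous[OF wt(2) True]])
    qed
    then show ?thesis by (simp add: wt)
  qed
  show ?thesis
    by (rule borel_measurable_LIMSEQ_metric[where f="\<lambda>n (w, t). the (X (ennreal (T n t)) w)"])
       (use meas lim in auto)
qed

text \<open>Exit times from balls will be measurable only for the completion, so joint measurability
  is transferred there.\<close>

lemma jointly_measurable_completion:
  "(\<lambda>(w, t). the (X (ennreal t) w)) \<in> completion (P x) \<Otimes>\<^sub>M lborel \<rightarrow>\<^sub>M borel"
proof -
  have "(\<lambda>z. (fst z, snd z)) \<in> completion (P x) \<Otimes>\<^sub>M lborel \<rightarrow>\<^sub>M S \<Otimes>\<^sub>M borel"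
  proof (rule measurable_Pair)
    have "(\<lambda>w. w) \<in> completion (P x) \<rightarrow>\<^sub>M S"
      by (rule measurable_completion) (simp add: measurable_ident_sets[OF sets_P])
    then show "fst \<in> completion (P x) \<Otimes>\<^sub>M lborel \<rightarrow>\<^sub>M S"
      using measurable_compose[OF measurable_fst] by fastforce
    show "snd \<in> completion (P x) \<Otimes>\<^sub>M lborel \<rightarrow>\<^sub>M borel"
      using measurable_snd[of "completion (P x)" lborel] by simp
  qed
  from measurable_compose[OF this jointly_measurable] show ?thesis by simp
qed

definition alive :: "(real ^ 'n) set \<Rightarrow> 'p \<Rightarrow> real \<Rightarrow> bool" where
  "alive U w t \<longleftrightarrow> 0 < t \<and> ennreal t < exit_time X U w"

text \<open>The killed resolvent at level 1 as a kernel: the measure of B is the expected discounted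
  time spent in B before the exit from U, provided the exit time is measurable. As a measure it
  brings linearity, monotone limits and null sets.\<close>

definition occupation :: "(real ^ 'n) set \<Rightarrow> real ^ 'n \<Rightarrow> (real ^ 'n) measure" where
  "occupation U x = distr
     (density (completion (P x) \<Otimes>\<^sub>M lborel) (\<lambda>(w, t). ennreal (of_bool (alive U w t) * exp (- t))))
     borel (\<lambda>(w, t). the (X (ennreal t) w))"

lemma sets_occupation [simp, measurable_cong]: "sets (occupation U x) = sets borel"
  by (simp add: occupation_def)

lemma space_occupation [simp]: "space (occupation U x) = UNIV"
  by (simp add: occupation_def)

text \<open>The exit time looks at positive times only, the lifetime also at time 0. Absorption
  closes the gap, since every time beyond the lifetime is dead and positive.\<close>

lemma exit_time_UNIV: "w \<in> space S \<Longrightarrow> exit_time X UNIV w = lifetime X w"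
proof (rule antisym)
  assume w: "w \<in> space S"
  show "lifetime X w \<le> exit_time X UNIV w"
    unfolding lifetime_def exit_time_def by (rule Inf_superset_mono) (auto simp: notin_range_Some)
  show "exit_time X UNIV w \<le> lifetime X w"
  proof (rule dense_ge)
    fix t assume t: "lifetime X w < t"
    then have "X t w = None" using eq_None_iff[OF w] by simp
    moreover have "0 < t" using t by (meson le_less_trans zero_le)
    ultimately show "exit_time X UNIV w \<le> t"
      unfolding exit_time_def by (intro Inf_lower) auto
  qed
qed

lemma exit_time_UNIV_measurable: "exit_time X UNIV \<in> borel_measurable (completion (P x))"
proof (rule measurable_completion)
  have "lifetime X \<in> borel_measurable (P x)"
    using lifetime_measurable by (simp add: measurable_cong_sets[OF sets_P refl])
  then show "exit_time X UNIV \<in> borel_measurable (P x)"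
    by (rule measurable_cong[THEN iffD2, rotated]) (simp add: exit_time_UNIV space_P)
qed

lemma nn_integral_exp: "(\<integral>\<^sup>+t. ennreal (of_bool (0 < t) * exp (- t)) \<partial>lborel) = 1"
proof -
  have "AE t in lborel. ennreal (of_bool (0 < t) * exp (- t)) = ennreal (t ^ 0 * exp (- t)) * indicator {0..} (t::real)"
    using AE_lborel_singleton[of "0::real"] by eventually_elim (simp split: split_indicator)
  then have "(\<integral>\<^sup>+t. ennreal (of_bool (0 < t) * exp (- t)) \<partial>lborel) =
      (\<integral>\<^sup>+t. ennreal (t ^ 0 * exp (- t)) * indicator {0..} t \<partial>lborel)"
    by (rule nn_integral_cong_AE)
  also have "\<dots> = 1" by (simp only: nn_intergal_power_times_exp_Ici) simp
  finally show ?thesis .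
qed

context
  fixes U x
  assumes exit_measurable: "exit_time X U \<in> borel_measurable (completion (P x))"
begin

lemma alive_measurable: "(\<lambda>(w, t). of_bool (alive U w t) * exp (- t) :: real) \<in> borel_measurable (completion (P x) \<Otimes>\<^sub>M lborel)"
proof -
  note [measurable] = exit_measurable
  have "(\<lambda>z. of_bool (0 < snd z \<and> ennreal (snd z) < exit_time X U (fst z)) * exp (- snd z) :: real)
    \<in> borel_measurable (completion (P x) \<Otimes>\<^sub>M lborel)"
    by measurable
  then show ?thesis by (simp add: alive_def case_prod_beta')
qed

lemma nn_integral_occupation:
  assumes [measurable]: "f \<in> borel_measurable borel"
  shows "(\<integral>\<^sup>+y. f y \<partial>occupation U x) =
    (\<integral>\<^sup>+w. \<integral>\<^sup>+t. ennreal (of_bool (alive U w t) * exp (- t)) * f (the (X (ennreal t) w)) \<partial>lborel \<partial>completion (P x))"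
proof -
  note [measurable] = alive_measurable jointly_measurable_completion[of x]
  interpret C: prob_space "completion (P x)" by (rule prob_completion)
  have "(\<integral>\<^sup>+y. f y \<partial>occupation U x) = (\<integral>\<^sup>+(w, t). ennreal (of_bool (alive U w t) * exp (- t)) * f (the (X (ennreal t) w)) \<partial>(completion (P x) \<Otimes>\<^sub>M lborel))"
    unfolding occupation_def
    by (subst nn_integral_distr, measurable, subst nn_integral_density) (auto simp: case_prod_beta' intro!: nn_integral_cong)
  also have "\<dots> = (\<integral>\<^sup>+w. \<integral>\<^sup>+t. ennreal (of_bool (alive U w t) * exp (- t)) * f (the (X (ennreal t) w)) \<partial>lborel \<partial>completion (P x))"
    by (subst lborel.nn_integral_fst[symmetric]) auto
  finally show ?thesis .
qed

lemma occupation_le_1: "emeasure (occupation U x) UNIV \<le> 1"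
proof -
  interpret C: prob_space "completion (P x)" by (rule prob_completion)
  have "emeasure (occupation U x) UNIV =
      (\<integral>\<^sup>+w. \<integral>\<^sup>+t. ennreal (of_bool (alive U w t) * exp (- t)) \<partial>lborel \<partial>completion (P x))"
    using nn_integral_occupation[of "\<lambda>_. 1"] by simp
  also have "\<dots> \<le> (\<integral>\<^sup>+w. \<integral>\<^sup>+t. ennreal (of_bool (0 < t) * exp (- t)) \<partial>lborel \<partial>completion (P x))"
    by (intro nn_integral_mono) (simp add: alive_def)
  also have "\<dots> = 1" by (simp add: nn_integral_exp C.emeasure_space_1[simplified])
  finally show ?thesis .
qed

lemma finite_occupation: "finite_measure (occupation U x)"
proof (rule finite_measureI)
  have "emeasure (occupation U x) UNIV < \<infinity>"
    by (rule le_less_trans[OF occupation_le_1]) simp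
  then show "emeasure (occupation U x) (space (occupation U x)) \<noteq> \<infinity>" by simp
qed

lemma integrable_occupation:
  assumes "f \<in> borel_measurable borel" "\<And>y. \<bar>f y\<bar> \<le> C"
  shows "integrable (occupation U x) (f :: _ \<Rightarrow> real)"
  by (rule finite_measure.integrable_const_bound[OF finite_occupation, of _ C]) (use assms in auto)

lemma killed_resolvent_eq:
  assumes [measurable]: "f \<in> borel_measurable borel" and bound: "\<And>y. \<bar>f y\<bar> \<le> C"
  shows "killed_resolvent P X U 1 f x = (LINT y|occupation U x. f y)"
proof -
  note [measurable] = alive_measurable jointly_measurable_completion[of x]
  interpret C: prob_space "completion (P x)" by (rule prob_completion)
  interpret pair_sigma_finite "completion (P x)" "lborel :: real measure" ..
  define g :: "'p \<times> real \<Rightarrow> real" where "g = (\<lambda>(w, t). of_bool (alive U w t) * exp (- t))"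
  define Y where "Y = (\<lambda>(w, t). the (X (ennreal t) w))"
  have g: "g \<in> borel_measurable (completion (P x) \<Otimes>\<^sub>M lborel)" and g_nonneg: "0 \<le> g z" for z
    using alive_measurable by (auto simp: g_def split: prod.split)
  have Y: "Y \<in> completion (P x) \<Otimes>\<^sub>M lborel \<rightarrow>\<^sub>M borel"
    using jointly_measurable_completion by (simp add: Y_def)
  then have Y': "Y \<in> density (completion (P x) \<Otimes>\<^sub>M lborel) (\<lambda>z. ennreal (g z)) \<rightarrow>\<^sub>M borel"
    by simp
  have fY: "(\<lambda>z. f (Y z)) \<in> borel_measurable (completion (P x) \<Otimes>\<^sub>M lborel)"
    by (rule measurable_compose[OF Y assms(1)])
  have occ: "occupation U x = distr (density (completion (P x) \<Otimes>\<^sub>M lborel) (\<lambda>z. ennreal (g z))) borel Y"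
    by (simp add: occupation_def g_def Y_def case_prod_beta')
  have "integrable (occupation U x) f" by (rule integrable_occupation[OF assms])
  then have "integrable (density (completion (P x) \<Otimes>\<^sub>M lborel) (\<lambda>z. ennreal (g z))) (\<lambda>z. f (Y z))"
    unfolding occ by (rule integrable_distr[OF Y'])
  then have i: "integrable (completion (P x) \<Otimes>\<^sub>M lborel) (\<lambda>z. g z * f (Y z))"
    using g_nonneg by (simp add: integrable_density[OF fY g])
  have "(LINT y|occupation U x. f y) = (LINT z|(completion (P x) \<Otimes>\<^sub>M lborel). g z * f (Y z))"
    unfolding occ using g_nonneg by (simp add: integral_distr[OF Y' assms(1)] integral_density[OF fY g])
  also have "\<dots> = (LINT w|completion (P x). LINT t|lborel. g (w, t) * f (Y (w, t)))"
    by (rule integral_fst'[symmetric, OF i])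
  also have "\<dots> = killed_resolvent P X U 1 f x"
    unfolding killed_resolvent_def set_lebesgue_integral_def
    by (intro Bochner_Integration.integral_cong refl) (auto simp: alive_def g_def Y_def split: split_indicator)
  finally show ?thesis ..
qed

text \<open>Fubini is used to put time outside, so that a deterministic good time can be picked
  arbitrarily close to 0 for the Markov property.\<close>

lemma occupation_null:
  assumes [measurable]: "N \<in> sets borel" and null: "emeasure (occupation U x) N = 0"
  shows "AE t in lborel. AE w in completion (P x). \<not> (alive U w t \<and> the (X (ennreal t) w) \<in> N)"
proof -
  note [measurable] = alive_measurable jointly_measurable_completion[of x]
  interpret C: prob_space "completion (P x)" by (rule prob_completion)
  interpret pair_sigma_finite "completion (P x)" "lborel :: real measure" ..
  let ?h = "\<lambda>(w, t). ennreal (of_bool (alive U w t) * exp (- t)) * indicator N (the (X (ennreal t) w))"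
  have hm: "?h \<in> borel_measurable (completion (P x) \<Otimes>\<^sub>M lborel)" by measurable
  have "(\<integral>\<^sup>+w. \<integral>\<^sup>+t. ?h (w, t) \<partial>lborel \<partial>completion (P x)) = (\<integral>\<^sup>+y. indicator N y \<partial>occupation U x)"
    by (subst nn_integral_occupation) auto
  also have "\<dots> = 0" using null by simp
  finally have "(\<integral>\<^sup>+t. \<integral>\<^sup>+w. ?h (w, t) \<partial>completion (P x) \<partial>lborel) = 0"
    by (subst Fubini') (use hm in auto)
  then have "AE t in lborel. (\<integral>\<^sup>+w. ?h (w, t) \<partial>completion (P x)) = 0"
    by (subst (asm) nn_integral_0_iff_AE) (use hm in auto)
  then show ?thesis
  proof eventually_elim
    case (elim t)
    have "(\<lambda>w. ?h (w, t)) \<in> borel_measurable (completion (P x))" by (rule measurable_Pair1[OF hm]) simp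
    with elim have "AE w in completion (P x). ?h (w, t) = 0"
      by (subst (asm) nn_integral_0_iff_AE) auto
    then show ?case by eventually_elim (auto split: split_indicator_asm)
  qed
qed

end

text \<open>The discounted time has total mass 1 and splits into the part before and the part after
  the lifetime. When the first part already has expectation 1, the second vanishes almost
  surely.\<close>

lemma lifetime_infinite_if_full_occupation:
  assumes "emeasure (occupation UNIV x) UNIV = 1"
  shows "AE w in P x. lifetime X w = \<infinity>"
proof -
  interpret C: prob_space "completion (P x)" by (rule prob_completion)
  note em = exit_time_UNIV_measurable[of x]
  note [measurable] = em alive_measurable[OF em] jointly_measurable_completion[of x]
  let ?d = "\<lambda>w t. ennreal (of_bool (0 < t \<and> exit_time X UNIV w \<le> ennreal t) * exp (- t))"
  have dm: "(\<lambda>(w, t). ?d w t) \<in> borel_measurable (completion (P x) \<Otimes>\<^sub>M lborel)"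
    unfolding case_prod_beta' by measurable
  have am: "(\<lambda>(w, t). ennreal (of_bool (alive UNIV w t) * exp (- t))) \<in> borel_measurable (completion (P x) \<Otimes>\<^sub>M lborel)"
    by measurable
  have "1 + (\<integral>\<^sup>+w. \<integral>\<^sup>+t. ?d w t \<partial>lborel \<partial>completion (P x)) =
    (\<integral>\<^sup>+w. \<integral>\<^sup>+t. ennreal (of_bool (alive UNIV w t) * exp (- t)) \<partial>lborel \<partial>completion (P x)) + (\<integral>\<^sup>+w. \<integral>\<^sup>+t. ?d w t \<partial>lborel \<partial>completion (P x))"
    using assms nn_integral_occupation[OF em, of "\<lambda>_. 1"] by simp
  also have "\<dots> = (\<integral>\<^sup>+w. (\<integral>\<^sup>+t. ennreal (of_bool (alive UNIV w t) * exp (- t)) \<partial>lborel) + (\<integral>\<^sup>+t. ?d w t \<partial>lborel) \<partial>completion (P x))"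
    using lborel.borel_measurable_nn_integral_fst[OF dm] lborel.borel_measurable_nn_integral_fst[OF am]
    by (intro nn_integral_add[symmetric]) auto
  also have "\<dots> = (\<integral>\<^sup>+w. 1 \<partial>completion (P x))"
  proof (rule nn_integral_cong)
    fix w assume w: "w \<in> space (completion (P x))"
    have "(\<integral>\<^sup>+t. ennreal (of_bool (alive UNIV w t) * exp (- t)) \<partial>lborel) + (\<integral>\<^sup>+t. ?d w t \<partial>lborel) =
      (\<integral>\<^sup>+t. ennreal (of_bool (alive UNIV w t) * exp (- t)) + ?d w t \<partial>lborel)"
      using measurable_Pair2[OF am w] measurable_Pair2[OF dm w] by (intro nn_integral_add[symmetric]) auto
    also have "\<dots> = (\<integral>\<^sup>+t. ennreal (of_bool (0 < t) * exp (- t)) \<partial>lborel)"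
      by (intro nn_integral_cong) (auto simp: alive_def)
    finally show "(\<integral>\<^sup>+t. ennreal (of_bool (alive UNIV w t) * exp (- t)) \<partial>lborel) + (\<integral>\<^sup>+t. ?d w t \<partial>lborel) = 1"
      by (simp add: nn_integral_exp)
  qed
  also have "\<dots> = 1 + 0" by (simp add: C.emeasure_space_1[simplified])
  finally have "(\<integral>\<^sup>+w. \<integral>\<^sup>+t. ?d w t \<partial>lborel \<partial>completion (P x)) = 0"
    by (simp only: ennreal_add_left_cancel) simp
  then have "AE w in completion (P x). (\<integral>\<^sup>+t. ?d w t \<partial>lborel) = 0"
    using lborel.borel_measurable_nn_integral_fst[OF dm] by (subst (asm) nn_integral_0_iff_AE) auto
  then have "AE w in P x. (\<integral>\<^sup>+t. ?d w t \<partial>lborel) = 0"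
    by (simp add: AE_completion_iff)
  then show ?thesis using AE_space
  proof eventually_elim
    case (elim w)
    then have w: "w \<in> space S" "w \<in> space (completion (P x))" by (auto simp: space_P)
    have "AE t in lborel. ?d w t = 0"
      using elim(1) measurable_Pair2[OF dm w(2)] by (subst (asm) nn_integral_0_iff_AE) auto
    then have *: "AE t in lborel. 0 < t \<longrightarrow> ennreal t < lifetime X w"
      by eventually_elim (auto simp: exit_time_UNIV[OF w(1)] not_less split: if_splits)
    show "lifetime X w = \<infinity>"
    proof (rule ccontr)
      assume "lifetime X w \<noteq> \<infinity>"
      then obtain r where r: "lifetime X w = ennreal r" "0 \<le> r" by (cases "lifetime X w") auto
      obtain t where "r < t" "0 < t \<longrightarrow> ennreal t < lifetime X w"
        using AE_lborel_exists[OF *, of r "r + 1"] by auto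
      with r show False by (auto simp: ennreal_less_iff)
    qed
  qed
qed

end

subsection \<open>Exit times and conservativeness from every starting point\<close>

text \<open>Compactness gives a uniform distance from the sphere on each
  \<open>{1 / real (Suc k)..q}\<close>, and this reduces an uncountable condition to rational times.
  The index k is there because time 0 is excluded, so no margin holds uniformly on all of
  \<open>{0<..q}\<close>.\<close>

lemma ball_path_iff:
  fixes h :: "real \<Rightarrow> 'a::metric_space"
  assumes cont: "continuous_on {0..q} h" and "q \<in> \<rat>"
  shows "(\<forall>s\<in>{0<..q}. h s \<in> ball c \<rho>) \<longleftrightarrow>
    (\<forall>k. 1 / real (Suc k) \<le> q \<longrightarrow> (\<exists>m. \<forall>s\<in>\<rat> \<inter> {1 / real (Suc k)..q}. dist c (h s) \<le> \<rho> - 1 / real (Suc m)))"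
proof (intro iffI allI impI ballI)
  fix k assume in_ball: "\<forall>s\<in>{0<..q}. h s \<in> ball c \<rho>" and k: "1 / real (Suc k) \<le> q"
  have pos: "0 < 1 / real (Suc k)" by simp
  have "continuous_on {1 / real (Suc k)..q} (\<lambda>s. dist c (h s))"
    using pos by (intro continuous_intros continuous_on_subset[OF cont]) (auto intro: order_trans[of 0])
  then obtain s where s: "s \<in> {1 / real (Suc k)..q}" "\<forall>r\<in>{1 / real (Suc k)..q}. dist c (h r) \<le> dist c (h s)"
    using continuous_attains_sup[of "{1 / real (Suc k)..q}" "\<lambda>s. dist c (h s)"] k by auto
  have "0 < s" using pos s(1) by (meson atLeastAtMost_iff less_le_trans)
  then have "s \<in> {0<..q}" using s(1) by simp
  then have "0 < \<rho> - dist c (h s)" using in_ball by auto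
  then obtain m where "1 / real (Suc m) < \<rho> - dist c (h s)" by (rule nat_approx_posE)
  then have "\<forall>r\<in>\<rat> \<inter> {1 / real (Suc k)..q}. dist c (h r) \<le> \<rho> - 1 / real (Suc m)"
    using s(2) by fastforce
  then show "\<exists>m. \<forall>s\<in>\<rat> \<inter> {1 / real (Suc k)..q}. dist c (h s) \<le> \<rho> - 1 / real (Suc m)" ..
next
  fix s assume *: "\<forall>k. 1 / real (Suc k) \<le> q \<longrightarrow> (\<exists>m. \<forall>s\<in>\<rat> \<inter> {1 / real (Suc k)..q}. dist c (h s) \<le> \<rho> - 1 / real (Suc m))"
    and s: "s \<in> {0<..q}"
  then obtain k where k: "1 / real (Suc k) < s" using nat_approx_posE[of s] by auto
  with s have "1 / real (Suc k) \<le> q" by simp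
  with * obtain m where m: "\<And>r. r \<in> \<rat> \<Longrightarrow> 1 / real (Suc k) \<le> r \<Longrightarrow> r \<le> q \<Longrightarrow> dist c (h r) \<le> \<rho> - 1 / real (Suc m)"
    by (metis IntI atLeastAtMost_iff)
  have "dist c (h s) < \<rho>"
  \<comment> \<open>Other times are approximated by rationals from the right, which leaves the
    interval at its right end; there q is itself rational.\<close>
  proof (cases "s = q")
    case True
    have "dist c (h q) \<le> \<rho> - 1 / real (Suc m)"
      using m[OF \<open>q \<in> \<rat>\<close>] k True by simp
    also have "\<dots> < \<rho>" by simp
    finally show ?thesis using True by simp
  next
    case False
    have "s \<in> {0..q}" using s by simp
    then obtain d where d: "d > 0" "\<And>r. r \<in> {0..q} \<Longrightarrow> dist r s < d \<Longrightarrow> dist (h r) (h s) < 1 / real (Suc m)"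
      using cont unfolding continuous_on_iff by (metis zero_less_divide_1_iff of_nat_0_less_iff zero_less_Suc)
    have "s < min (s + d) q" using d(1) s False by auto
    then obtain r where r: "r \<in> \<rat>" "s < r" "r < min (s + d) q"
      using Rats_dense_in_real by blast
    have "dist (h r) (h s) < 1 / real (Suc m)"
      using r s by (intro d) (auto simp: dist_real_def)
    moreover have "dist c (h r) \<le> \<rho> - 1 / real (Suc m)"
      using m[OF r(1)] r k s by simp
    ultimately show ?thesis using dist_triangle[of c "h s" "h r"] by linarith
  qed
  then show "h s \<in> ball c \<rho>" by simp
qed

context standard_diffusion
begin

text \<open>The countable description of the event is valid only along continuous paths, that is
  almost surely. The event therefore differs from a measurable one by a null set, which the
  completion absorbs.\<close>

lemma stays_in_ball_measurable:
  assumes q: "q \<in> \<rat>" "0 < q"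
  shows "{w \<in> space S. \<forall>s\<in>{0<..q}. X (ennreal s) w \<in> Some ` ball c \<rho>} \<in> sets (completion (P x))"
proof -
  define E where "E = {w \<in> space S. \<forall>s\<in>{0<..q}. X (ennreal s) w \<in> Some ` ball c \<rho>}"
  \<comment> \<open>Being alive at q keeps the whole interval up to q below the lifetime, so that
    \<open>ball_path_iff\<close> applies.\<close>
  define E' where "E' = {w \<in> space S. X (ennreal q) w \<noteq> None \<and>
    (\<forall>k. 1 / real (Suc k) \<le> q \<longrightarrow> (\<exists>m. \<forall>s\<in>\<rat> \<inter> {1 / real (Suc k)..q}. dist c (the (X (ennreal s) w)) \<le> \<rho> - 1 / real (Suc m)))}"
  have "E' \<in> sets S"
  proof -
    note [measurable] = measurable_the_X dead_measurable[of "ennreal q"]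
    have c: "countable (\<rat> \<inter> {1 / real (Suc k)..q})" for k
      by (rule countable_Int1[OF countable_rat])
    have 0: "{w \<in> space S. \<forall>s\<in>\<rat> \<inter> {1 / real (Suc k)..q}. dist c (the (X (ennreal s) w)) \<le> \<rho> - 1 / real (Suc m)} \<in> sets S" for k m
      by (rule sets.sets_Collect_countable_All'[OF _ c]) measurable
    have 1: "{w \<in> space S. \<forall>k. 1 / real (Suc k) \<le> q \<longrightarrow> (\<exists>m. \<forall>s\<in>\<rat> \<inter> {1 / real (Suc k)..q}. dist c (the (X (ennreal s) w)) \<le> \<rho> - 1 / real (Suc m))} \<in> sets S"
      by (intro sets.sets_Collect_countable_All sets.sets_Collect_imp sets.sets_Collect_const sets.sets_Collect_countable_Ex 0)
    have "E' = {w \<in> space S. \<forall>k. 1 / real (Suc k) \<le> q \<longrightarrow> (\<exists>m. \<forall>s\<in>\<rat> \<inter> {1 / real (Suc k)..q}. dist c (the (X (ennreal s) w)) \<le> \<rho> - 1 / real (Suc m))}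
       - {w \<in> space S. X (ennreal q) w = None}"
      by (auto simp: E'_def)
    with sets.Diff[OF 1 dead_measurable] show ?thesis by (simp only:)
  qed
  then have E': "E' \<in> sets (completion (P x))" by (intro sets_completionI_sets) (simp add: sets_P)
  have ae: "AE w in completion (P x). w \<in> E' \<longleftrightarrow> w \<in> E"
    using AE_completion[OF continuous_paths[of x]] AE_space
  proof eventually_elim
    case (elim w)
    then have w: "w \<in> space S" by (simp add: space_P)
    show ?case
    proof (cases "X (ennreal q) w = None")
      case True
      then show ?thesis using q(2) by (auto simp: E_def E'_def intro!: bexI[of _ q])
    next
      case False
      then have life: "ennreal q < lifetime X w" using eq_None_iff[OF w] by auto
      then have not_None: "X (ennreal s) w \<noteq> None" if "s \<le> q" for s
        using that eq_None_iff[OF w, of "ennreal s"] ennreal_leI[of s q] by auto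
      have "continuous_on {0..q} (\<lambda>s. the (X (ennreal s) w))"
        by (rule continuous_on_compose2[OF elim(1)])
           (use life in \<open>auto intro!: continuous_on_ennreal continuous_on_id intro: le_less_trans[OF ennreal_leI]\<close>)
      from ball_path_iff[OF this q(1), of c \<rho>]
      have "w \<in> E' \<longleftrightarrow> (\<forall>s\<in>{0<..q}. the (X (ennreal s) w) \<in> ball c \<rho>)"
        using w False by (simp add: E'_def)
      also have "\<dots> \<longleftrightarrow> (\<forall>s\<in>{0<..q}. X (ennreal s) w \<in> Some ` ball c \<rho>)"
      proof (rule ball_cong[OF refl])
        fix s assume "s \<in> {0<..q}"
        then obtain y where "X (ennreal s) w = Some y" using not_None[of s] by auto
        then show "the (X (ennreal s) w) \<in> ball c \<rho> \<longleftrightarrow> X (ennreal s) w \<in> Some ` ball c \<rho>" by auto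
      qed
      also have "\<dots> \<longleftrightarrow> w \<in> E" using w by (simp add: E_def)
      finally show ?thesis .
    qed
  qed
  have "E \<subseteq> space (completion (P x))" by (auto simp: E_def space_P)
  from completion.in_sets_AE[OF ae E' this] show ?thesis
    by (simp add: E_def)
qed

text \<open>The exit happens after t exactly when the path stays in the ball up to some rational
  time beyond t.\<close>

lemma exit_time_ball_measurable: "exit_time X (ball c \<rho>) \<in> borel_measurable (completion (P x))"
proof (rule borel_measurableI_greater)
  fix t :: ennreal
  define Q where "Q = {q \<in> \<rat>. 0 < q \<and> t < ennreal q}"
  let ?E = "\<lambda>q. {w \<in> space S. \<forall>s\<in>{0<..q}. X (ennreal s) w \<in> Some ` ball c \<rho>}"
  have "{w \<in> space (completion (P x)). t < exit_time X (ball c \<rho>) w} = (\<Union>q\<in>Q. ?E q)"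
  proof (intro set_eqI iffI)
    fix w assume "w \<in> {w \<in> space (completion (P x)). t < exit_time X (ball c \<rho>) w}"
    then have w: "w \<in> space S" and t: "t < exit_time X (ball c \<rho>) w" by (auto simp: space_P)
    obtain u where u: "t < u" "u < exit_time X (ball c \<rho>) w" using dense[OF t] by blast
    obtain r r' where r: "t = ennreal r" "0 \<le> r" "u = ennreal r'" "0 \<le> r'"
      using u by (metis ennreal_cases less_top_ennreal top.not_eq_extremum order_less_trans not_less_iff_gr_or_eq)
    then have "r < r'" using u by (simp add: ennreal_less_iff)
    then obtain q where q: "q \<in> \<rat>" "r < q" "q < r'" using Rats_dense_in_real by blast
    have "q \<in> Q" using q r by (auto simp: Q_def ennreal_less_iff)
    moreover have "w \<in> ?E q"
    proof (intro CollectI conjI w ballI)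
      fix s assume s: "s \<in> {0<..q}"
      show "X (ennreal s) w \<in> Some ` ball c \<rho>"
      proof (rule ccontr)
        assume "X (ennreal s) w \<notin> Some ` ball c \<rho>"
        then have "exit_time X (ball c \<rho>) w \<le> ennreal s"
          unfolding exit_time_def using s by (intro Inf_lower) (auto simp: ennreal_less_zero_iff)
        also have "\<dots> \<le> u" using s q r by (simp add: ennreal_leI)
        finally show False using u by simp
      qed
    qed
    ultimately show "w \<in> (\<Union>q\<in>Q. ?E q)" by blast
  next
    fix w assume "w \<in> (\<Union>q\<in>Q. ?E q)"
    then obtain q where q: "q \<in> Q" and w: "w \<in> space S"
      and E: "\<And>s. 0 < s \<Longrightarrow> s \<le> q \<Longrightarrow> X (ennreal s) w \<in> Some ` ball c \<rho>" by auto
    have "ennreal q \<le> exit_time X (ball c \<rho>) w"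
      unfolding exit_time_def
    proof (rule Inf_greatest)
      fix s assume s: "s \<in> {t. 0 < t \<and> X t w \<notin> Some ` ball c \<rho>}"
      show "ennreal q \<le> s"
      proof (rule ccontr)
        assume "\<not> ennreal q \<le> s"
        then have sq: "s < ennreal q" by simp
        then obtain r where r: "s = ennreal r" "0 \<le> r" by (cases s) auto
        have "r \<le> q" using sq r by (simp add: ennreal_less_iff)
        moreover have "0 < r" using s r by simp
        ultimately show False using E[of r] s r by simp
      qed
    qed
    with q w show "w \<in> {w \<in> space (completion (P x)). t < exit_time X (ball c \<rho>) w}"
      by (auto simp: Q_def space_P)
  qed
  moreover have "countable Q" unfolding Q_def by (rule countable_subset[OF _ countable_rat]) auto
  ultimately show "{w \<in> space (completion (P x)). t < exit_time X (ball c \<rho>) w} \<in> sets (completion (P x))"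
    by (auto intro!: sets.countable_UN' stays_in_ball_measurable simp: Q_def)
qed

text \<open>The path starts at x almost surely and is right continuous at 0, so it remains in the
  ball for a short time.\<close>

lemma exit_time_ball_pos:
  assumes "0 < \<rho>" shows "AE w in P x. 0 < exit_time X (ball x \<rho>) w"
proof -
  interpret prob_space "P x" by (rule prob_P)
  have "AE w in P x. X 0 w = Some x"
  proof (rule AE_I_eq_1)
    have "{w \<in> space S. X 0 w = Some x} = X 0 -` (Some ` {x}) \<inter> space S" by auto
    also have "\<dots> \<in> sets S" by (intro measurable_sets[OF measurable_X] Some_cemetery) simp
    finally show "{w \<in> space (P x). X 0 w = Some x} \<in> sets (P x)" by (simp add: space_P sets_P)
    then show "emeasure (P x) {w \<in> space (P x). X 0 w = Some x} = 1"
      using normal[of x] by (simp add: emeasure_eq_measure space_P)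
  qed
  then show ?thesis using AE_space
  proof eventually_elim
    case (elim w)
    then have w: "w \<in> space S" and x: "X 0 w = Some x" by (auto simp: space_P)
    then have life: "0 < lifetime X w" using eq_None_iff[OF w, of 0] by (auto simp: zero_less_iff_neq_zero)
    have "\<forall>\<^sub>F s in at_right 0. the (X s w) \<in> ball x \<rho>"
      using right_continuous[OF w life] x assms
      by (intro topological_tendstoD) auto
    moreover have "\<forall>\<^sub>F s in at_right 0. s < lifetime X w"
      using life by (intro eventually_at_right_field[THEN iffD2] order_tendstoD[OF tendsto_ident_at]) auto
    ultimately have "\<forall>\<^sub>F s in at_right 0. X s w \<in> Some ` ball x \<rho>"
    proof eventually_elim
      case (elim s)
      then have "X s w \<noteq> None" using eq_None_iff[OF w, of s] by auto
      with elim show ?case by (metis image_eqI option.collapse)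
    qed
    then obtain b where b: "b > 0" "\<And>s. 0 < s \<Longrightarrow> s < b \<Longrightarrow> X s w \<in> Some ` ball x \<rho>"
      using eventually_at_right[of 0 "1::ennreal"] by auto
    have "b \<le> exit_time X (ball x \<rho>) w"
      unfolding exit_time_def using b(2) by (intro Inf_greatest) (auto simp: not_less[symmetric])
    with b(1) show ?case by simp
  qed
qed

text \<open>A constant time is a stopping time, and the sure event belongs to its stopped
  sigma-algebra once the right filtration is known to be increasing.\<close>

lemma Markov_at_time:
  assumes "A \<in> sets cemetery_borel"
  shows "measure (P x) {w \<in> space S. X (t + s) w \<in> A} = (LINT w:space S|P x. trans_prob P X s (X t w) A)"
proof (rule strong_Markov[where T="\<lambda>_. t" and \<Gamma>="space S"])
  show "space S \<in> sets (filtration.pre_sigma (space S) (right_filtration S X) (\<lambda>_. t))"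
  proof -
    have sp: "space (right_filtration S X u) = space S" for u
      by (auto simp: right_filtration_def natural_filtration_def space_measure_of_conv)
    have mono: "sets (right_filtration S X u) \<subseteq> sets (right_filtration S X v)" if "u \<le> v" for u v
    proof -
      have "(\<Inter>s\<in>insert \<infinity> {u<..}. sets (natural_filtration S X s)) \<subseteq> (\<Inter>s\<in>insert \<infinity> {v<..}. sets (natural_filtration S X s))"
        using that by (intro INF_superset_mono) auto
      moreover have "(\<Inter>s\<in>insert \<infinity> {u<..}. sets (natural_filtration S X s)) \<subseteq> Pow (space S)" for u
        using sets.sets_into_space[of _ "natural_filtration S X \<infinity>"]
        by (auto simp: natural_filtration_def space_measure_of_conv)
      ultimately show ?thesis
        unfolding right_filtration_def by (simp add: sigma_sets_mono')
    qed
    interpret F: filtration "space S" "right_filtration S X" by unfold_locales (auto simp: sp dest: mono[THEN subsetD])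
    show ?thesis using sets.top[of "F.pre_sigma (\<lambda>_. t)"] by (simp add: F.space_pre_sigma)
  qed
qed (use assms in \<open>auto intro: stopping_time_const\<close>)

end

text \<open>Testing the equation with g itself gives \<open>dform A U g g\<close> plus the integral
  of the square of g equal to 0. The form is nonnegative because its integrand is, pointwise,
  whatever functions \<open>weak_deriv U\<close> selects; so no theory of weak derivatives on U
  enters.\<close>

lemma (in elliptic_field) resolvent_of_null_function:
  assumes U: "U \<in> sets borel" and g: "form_resolvent A U 1 f g"
    and null: "AE x in lborel. x \<in> U \<longrightarrow> f x = 0"
  shows "AE x in lborel. x \<in> U \<longrightarrow> g x = 0"
proof -
  have dom: "g \<in> form_domain A U" using g by (simp add: form_resolvent_def)
  then have "integrable lborel (\<lambda>x. indicator U x * \<bar>g x\<bar> powr 2)"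
    by (simp add: form_domain_def Lp_on_def set_integrable_def)
  then have int: "integrable lborel (\<lambda>x. indicator U x * (g x)\<^sup>2)"
    by (simp add: powr_numeral)
  have "AE x in lborel. indicator U x * (\<Sum>i\<in>UNIV. \<Sum>j\<in>UNIV. A x $ i $ j * weak_deriv U i g x * weak_deriv U j g x) \<ge> 0"
    using AE_bil_nonneg
  proof eventually_elim
    case (elim x)
    let ?\<eta> = "\<chi> i. weak_deriv U i g x"
    have "(\<Sum>i\<in>UNIV. \<Sum>j\<in>UNIV. A x $ i $ j * weak_deriv U i g x * weak_deriv U j g x) = bil x ?\<eta> ?\<eta>"
      by (simp add: bil_eq_sum mult_ac)
    with elim show ?case by simp
  qed
  then have "0 \<le> dform A U g g"
    unfolding dform_def set_lebesgue_integral_def real_scaleR_def by (rule integral_nonneg_AE)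
  moreover have "dform A U g g + (LINT x:U|lborel. g x * g x) = (LINT x:U|lborel. f x * g x)"
    using g dom by (simp add: form_resolvent_def)
  moreover have "(LINT x:U|lborel. f x * g x) = 0"
    unfolding set_lebesgue_integral_def
    by (rule integral_eq_zero_AE) (use null in \<open>eventually_elim, simp split: split_indicator\<close>)
  ultimately have "(LINT x|lborel. indicator U x * (g x)\<^sup>2) \<le> 0"
    by (simp add: set_lebesgue_integral_def power2_eq_square)
  moreover have "0 \<le> (LINT x|lborel. indicator U x * (g x)\<^sup>2)"
    by (intro Bochner_Integration.integral_nonneg) simp
  ultimately have "(LINT x|lborel. indicator U x * (g x)\<^sup>2) = 0" by simp
  then have "AE x in lborel. indicator U x * (g x)\<^sup>2 = 0"
    by (subst (asm) integral_nonneg_eq_0_iff_AE[OF int]) simp_all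
  then show ?thesis by eventually_elim (simp split: split_indicator_asm)
qed

lemma continuous_AE_zero_imp_zero:
  fixes g :: "'a::euclidean_space \<Rightarrow> real"
  assumes U: "open U" and cont: "continuous_on U g" and ae: "AE x in lborel. x \<in> U \<longrightarrow> g x = 0" and x: "x \<in> U"
  shows "g x = 0"
proof (rule ccontr)
  assume "g x \<noteq> 0"
  define V where "V = U \<inter> g -` (- {0})"
  have "open V" unfolding V_def using cont U by (intro continuous_open_preimage) auto
  moreover have "x \<in> V" using x \<open>g x \<noteq> 0\<close> by (simp add: V_def)
  ultimately obtain r where r: "r > 0" "ball x r \<subseteq> V" using open_contains_ball by blast
  have "AE x in lborel. x \<notin> V" using ae by eventually_elim (auto simp: V_def)
  then have "V \<in> null_sets lborel" using \<open>open V\<close> by (subst AE_iff_null_sets) auto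
  then have "ball x r \<in> null_sets lborel" by (rule null_sets_subset) (use r in auto)
  then have "measure lborel (ball x r) = 0" by (simp add: measure_def null_setsD1)
  with content_ball_pos[OF r(1), of x] show False by simp
qed

context minimal_diffusion
begin

lemma occupation_ball_null:
  assumes ell: "elliptic_field a l L" and N: "N \<in> null_sets lborel" and "0 < \<rho>"
  shows "emeasure (occupation (ball x \<rho>) x) N = 0"
proof -
  have Nm: "N \<in> sets borel" using N by auto
  define U where "U = ball x \<rho>"
  \<comment> \<open>An exponent above the dimension, as the regularity of the killed resolvent
    requires.\<close>
  define r where "r = real CARD('n) + 1"
  define g where "g = killed_resolvent P X U 1 (indicator N)"
  have f: "indicator N \<in> Lp_on r U"
  proof -
    have "(\<lambda>y. indicator U y *\<^sub>R \<bar>indicator N y\<bar> powr r) = (indicator (U \<inter> N) :: _ \<Rightarrow> real)"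
      by (auto split: split_indicator simp: r_def)
    moreover have "integrable lborel (indicator (U \<inter> N) :: _ \<Rightarrow> real)"
      using Nm emeasure_mono[of "U \<inter> N" N lborel] null_setsD1[OF N]
      by (intro integrable_real_indicator) (auto simp: U_def)
    ultimately show ?thesis
      using Nm borel_measurable_times[OF borel_measurable_indicator borel_measurable_indicator, of U borel N]
      by (simp add: Lp_on_def set_integrable_def set_borel_measurable_def U_def)
  qed
  have "AE y in lborel. y \<in> U \<longrightarrow> g y = 0"
  proof (rule elliptic_field.resolvent_of_null_function[OF ell])
    show "form_resolvent a U 1 (indicator N) g"
      unfolding g_def U_def by (rule killed_form[where r=r]) (use f assms in \<open>auto simp: r_def U_def\<close>)
    show "AE y in lborel. y \<in> U \<longrightarrow> (indicator N y :: real) = 0"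
      using AE_not_in[OF N] by eventually_elim simp
  qed (simp add: U_def)
  moreover have "continuous_on U g"
  proof -
    have "g \<in> C_infty U"
      unfolding g_def U_def by (rule killed_C_infty[where r=r]) (use f assms in \<open>auto simp: r_def U_def\<close>)
    then show ?thesis by (simp add: C_infty_def)
  qed
  ultimately have "g x = 0"
    by (intro continuous_AE_zero_imp_zero[of U]) (use assms in \<open>auto simp: U_def\<close>)
  moreover have "g x = (LINT y|occupation U x. indicator N y)"
    unfolding g_def U_def
    by (rule killed_resolvent_eq[OF exit_time_ball_measurable, where C=1]) (use Nm in \<open>auto split: split_indicator\<close>)
  ultimately have "measure (occupation U x) N = 0" using Nm by simp
  then show ?thesis
    using finite_measure.emeasure_eq_measure[OF finite_occupation[OF exit_time_ball_measurable], of c \<rho> x N for c]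
    by (simp add: U_def)
qed

lemma conservative_everywhere:
  assumes ell: "elliptic_field a l L"
    and ae: "AE y in lborel. AE w in P y. lifetime X w = \<infinity>"
  shows "AE w in P x. lifetime X w = \<infinity>"
proof -
  interpret prob_space "P x" by (rule prob_P)
  interpret C: prob_space "completion (P x)" by (rule prob_completion)
  define D where "D s = {w \<in> space S. X s w = None}" for s
  have D: "D s \<in> sets S" for s unfolding D_def by (rule dead_measurable)
  \<comment> \<open>A finite lifetime means being dead at some integer time, so countably many times
    describe failure and N is measurable.\<close>
  define N where "N = {y. \<exists>n::nat. 0 < measure (P y) (D (of_nat n))}"
  have Nm: "N \<in> sets borel"
  proof -
    have [measurable]: "(\<lambda>y. measure (P y) (D s)) \<in> borel_measurable borel" for s
      using measurable_P[OF None_cemetery, of s] by (simp add: D_def)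
    have "{y \<in> space borel. \<exists>n::nat. 0 < measure (P y) (D (of_nat n))} \<in> sets borel" by measurable
    then show ?thesis by (simp add: N_def)
  qed
  have "AE y in lborel. y \<notin> N"
    using ae
  proof eventually_elim
    case (elim y)
    have "measure (P y) (D (of_nat n)) = 0" for n
    proof -
      have "AE w in P y. w \<notin> D (of_nat n)"
        using elim
      proof eventually_elim
        case (elim w)
        then show ?case using eq_None_iff[of w "of_nat n"] by (auto simp: D_def top_unique)
      qed
      then have "D (of_nat n) \<in> null_sets (P y)"
        using D by (subst AE_iff_null_sets) (auto simp: sets_P)
      then show ?thesis by (simp add: measure_def null_setsD1)
    qed
    then show ?case by (simp add: N_def)
  qed
  then have N: "N \<in> null_sets lborel" using Nm by (subst AE_iff_null_sets) auto
  define U where "U = ball x 1"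
  have em: "exit_time X U \<in> borel_measurable (completion (P x))"
    unfolding U_def by (rule exit_time_ball_measurable)
  have good: "AE t in lborel. AE w in completion (P x). \<not> (alive U w t \<and> the (X (ennreal t) w) \<in> N)"
    using occupation_null[OF em Nm] occupation_ball_null[OF ell N, of 1 x] by (simp add: U_def)
  define F where "F k = {w \<in> space (completion (P x)). exit_time X U w \<le> ennreal (1 / real (Suc k))}" for k
  have F: "F k \<in> sets (completion (P x))" for k
    using em unfolding F_def by measurable
  \<comment> \<open>Death by time n implies death by t + n. Conditioned at time t, this has
    probability 0 unless the path is then dead or in N, and up to a null event either case forces an
    exit from the unit ball by time t.\<close>
  have bound: "measure (P x) (D (of_nat n)) \<le> measure (completion (P x)) (F k)" for n k
  proof -
    obtain t where t: "0 < t" "t < 1 / real (Suc k)"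
      and good_t: "AE w in completion (P x). \<not> (alive U w t \<and> the (X (ennreal t) w) \<in> N)"
      using AE_lborel_exists[OF good, of 0 "1 / real (Suc k)"] by auto
    \<comment> \<open>The bad positions at time t. Outside B the process is at a point from which
      death by time n has probability 0; on B the transition probability is merely bounded by
      1.\<close>
    define B where "B = {w \<in> space S. X (ennreal t) w = None \<or> the (X (ennreal t) w) \<in> N}"
    have B: "B \<in> sets S"
    proof -
      have "B = D (ennreal t) \<union> ((\<lambda>w. the (X (ennreal t) w)) -` N \<inter> space S)"
        by (auto simp: B_def D_def)
      then show ?thesis using D measurable_sets[OF measurable_the_X Nm] by (simp add: sets.Un)
    qed
    have "measure (P x) (D (of_nat n)) \<le> measure (P x) (D (ennreal t + of_nat n))"
    proof (rule finite_measure_mono)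
      have le: "(of_nat n :: ennreal) \<le> ennreal t + of_nat n" by (intro add_increasing) auto
      show "D (of_nat n) \<subseteq> D (ennreal t + of_nat n)"
        by (auto simp: D_def eq_None_iff intro: order_trans[OF _ le])
    qed (use D in \<open>simp add: sets_P\<close>)
    also have "\<dots> = (LINT w:space S|P x. trans_prob P X (of_nat n) (X (ennreal t) w) {None})"
      using Markov_at_time[OF None_cemetery, of x "ennreal t" "of_nat n"] by (simp add: D_def)
    also have "\<dots> \<le> (LINT w|P x. indicator B w)"
      unfolding set_lebesgue_integral_def
    proof (rule integral_mono')
      show "integrable (P x) (indicator B :: _ \<Rightarrow> real)"
        using B by (intro integrable_real_indicator) (auto simp: sets_P emeasure_eq_measure)
      fix w assume "w \<in> space (P x)"
      then have w: "w \<in> space S" by (simp add: space_P)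
      show "indicator (space S) w *\<^sub>R trans_prob P X (of_nat n) (X (ennreal t) w) {None} \<le> indicator B w"
      proof (cases "X (ennreal t) w")
        case None
        then show ?thesis using w by (simp add: B_def trans_prob_def)
      next
        case (Some y)
        have le1: "measure (P y) {w \<in> space (P y). X (of_nat n) w = None} \<le> 1"
          by (rule prob_space.prob_le_1[OF prob_P])
        have "measure (P y) {w \<in> space (P y). X (of_nat n) w = None} = 0" if "y \<notin> N"
          using that measure_nonneg[of "P y" "D (of_nat n)"] by (auto simp: N_def D_def space_P not_less intro: antisym)
        with le1 Some w show ?thesis by (auto simp: B_def trans_prob_def split: split_indicator)
      qed
      show "0 \<le> (indicator B w :: real)" by simp
    qed
    also have "\<dots> = measure (P x) B" using B by (simp add: sets_P)
    also have "\<dots> = measure (completion (P x)) B" using B by (simp add: sets_P)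
    also have "\<dots> \<le> measure (completion (P x)) (F k)"
    proof (rule C.finite_measure_mono_AE[OF _ F])
      show "AE w in completion (P x). w \<in> B \<longrightarrow> w \<in> F k"
        using good_t
      proof (eventually_elim, intro impI)
        fix w assume good_w: "\<not> (alive U w t \<and> the (X (ennreal t) w) \<in> N)" and "w \<in> B"
        then have w: "w \<in> space S" "X (ennreal t) w = None \<or> the (X (ennreal t) w) \<in> N" by (auto simp: B_def)
        have "exit_time X U w \<le> ennreal t"
        proof (cases "X (ennreal t) w = None")
          case True
          then show ?thesis
            unfolding exit_time_def using t by (intro Inf_lower) (auto simp: ennreal_less_zero_iff)
        next
          case False
          then show ?thesis using good_w w t by (auto simp: alive_def not_less)
        qed
        also have "\<dots> \<le> ennreal (1 / real (Suc k))" using t by (intro ennreal_leI) simp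
        finally show "w \<in> F k" using w by (simp add: F_def space_P)
      qed
    qed
    finally show ?thesis .
  qed
  have "(\<lambda>k. measure (completion (P x)) (F k)) \<longlonglongrightarrow> measure (completion (P x)) (\<Inter>k. F k)"
  proof (rule C.finite_Lim_measure_decseq)
    show "range F \<subseteq> sets (completion (P x))" using F by auto
    show "decseq F"
    proof (rule decseq_SucI)
      fix k
      have "ennreal (1 / real (Suc (Suc k))) \<le> ennreal (1 / real (Suc k))"
        by (intro ennreal_leI) (simp add: frac_le)
      then show "F (Suc k) \<subseteq> F k" by (auto simp: F_def intro: order_trans)
    qed
  qed
  moreover have "measure (completion (P x)) (\<Inter>k. F k) = 0"
  proof -
    have "AE w in completion (P x). w \<notin> (\<Inter>k. F k)"
      using AE_completion[OF exit_time_ball_pos[of 1 x, OF zero_less_one]]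
    proof eventually_elim
      case (elim w)
      have "(\<lambda>k. ennreal (1 / real (Suc k))) \<longlonglongrightarrow> ennreal 0"
        by (intro tendsto_ennrealI LIMSEQ_Suc[OF lim_1_over_n])
      then have "\<forall>\<^sub>F k in sequentially. ennreal (1 / real (Suc k)) < exit_time X U w"
        using elim by (intro order_tendstoD) (auto simp: U_def)
      then show ?case by (auto simp: eventually_sequentially F_def not_le[symmetric])
    qed
    then have "(\<Inter>k. F k) \<in> null_sets (completion (P x))"
      using F by (subst AE_iff_null_sets) auto
    then show ?thesis by (simp add: measure_def null_setsD1)
  qed
  ultimately have lim: "(\<lambda>k. measure (completion (P x)) (F k)) \<longlonglongrightarrow> 0" by simp
  have "measure (P x) (D (of_nat n)) \<le> 0" for n
    by (rule LIMSEQ_le_const[OF lim]) (use bound in auto)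
  then have "measure (P x) (D (of_nat n)) = 0" for n
    using measure_nonneg[of "P x" "D (of_nat n)"] by (auto intro: antisym)
  then have "D (of_nat n) \<in> null_sets (P x)" for n :: nat
    using D by (auto simp: null_sets_def sets_P emeasure_eq_measure)
  then have "AE w in P x. \<forall>n::nat. w \<notin> D (of_nat n)"
    by (subst AE_all_countable) (auto intro: AE_not_in)
  then show ?thesis using AE_space
  proof eventually_elim
    case (elim w)
    then have w: "w \<in> space S" by (simp add: space_P)
    have big: "of_nat n < lifetime X w" for n :: nat
      using elim(1) eq_None_iff[OF w] w by (auto simp: D_def not_le)
    show ?case
    proof (rule ccontr)
      assume "lifetime X w \<noteq> \<infinity>"
      then obtain r where r: "lifetime X w = ennreal r" "0 \<le> r" by (cases "lifetime X w") auto
      obtain n where "r \<le> real n" using real_arch_simple by blast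
      then have "lifetime X w \<le> of_nat n" using r by (simp add: ennreal_of_nat_eq_real_of_nat ennreal_leI)
      with big[of n] show False by simp
    qed
  qed
qed

lemma prob_lifetime_infinite:
  assumes "AE w in P x. lifetime X w = \<infinity>"
  shows "measure (P x) {w \<in> space (P x). lifetime X w = \<infinity>} = 1"
proof -
  interpret prob_space "P x" by (rule prob_P)
  have "{w \<in> space (P x). lifetime X w = \<infinity>} = lifetime X -` {\<infinity>} \<inter> space S"
    by (auto simp: space_P)
  then have m: "{w \<in> space (P x). lifetime X w = \<infinity>} \<in> events"
    using measurable_sets[OF lifetime_measurable, of "{\<infinity>}"] by (simp add: sets_P)
  show ?thesis
    by (rule prob_eq_1[OF m, THEN iffD2]) (use assms AE_space in \<open>eventually_elim, simp\<close>)
qed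

end

subsection \<open>The mass of the resolvent\<close>

text \<open>The value \<integral> f G f expressed through the coefficients alone. The countable
  index set is what makes it measurable in the environment.\<close>

definition resolvent_sup ::
  "(real ^ 'n::finite \<Rightarrow> real ^ 'n ^ 'n) \<Rightarrow> (real ^ 'n \<Rightarrow> real) \<Rightarrow> ereal" where
  "resolvent_sup A f = (SUP v\<in>dense_tests. ereal (resolvent_functional A f v))"

lemma gradient_shift:
  assumes "v \<in> test_functions UNIV"
  shows "gradient (\<lambda>x. v (x + b)) x = gradient v (x + b)"
  using partial_deriv_affine[of v 1 x b] test_differentiable[OF assms] by (simp add: gradient_def vec_eq_iff)

lemma resolvent_functional_shift:
  assumes [measurable]: "A \<in> borel_measurable borel" "f \<in> borel_measurable borel"
    and v: "v \<in> test_functions UNIV"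
  shows "resolvent_functional (\<lambda>x. A (x + z)) f v = resolvent_functional A (\<lambda>x. f (x - z)) (\<lambda>x. v (x - z))"
proof -
  note [measurable] = test_measurable[OF v] gradient_measurable[OF v]
  have gm: "(\<lambda>x. gradient v (x - z)) \<in> borel_measurable borel"
    by (rule measurable_compose[OF _ gradient_measurable[OF v]]) simp
  have "(A x *v w) \<bullet> w = (\<Sum>i\<in>UNIV. \<Sum>j\<in>UNIV. A x $ i $ j * w $ j * w $ i)" for x w
    by (simp add: inner_vec_def matrix_vector_mult_def sum_distrib_right)
  then have "(\<lambda>x. (A x *v gradient v (x - z)) \<bullet> gradient v (x - z)) \<in> borel_measurable borel"
    by (simp only:) (intro borel_measurable_sum borel_measurable_times vec_nth_measurable gm assms)
  from lborel_integral_shift(1)[OF this, of z]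
  have 1: "(LINT x|lborel. (A (x + z) *v gradient v x) \<bullet> gradient v x) = (LINT x|lborel. (A x *v gradient v (x - z)) \<bullet> gradient v (x - z))"
    by simp
  have 2: "(LINT x|lborel. f x * v x) = (LINT x|lborel. f (x - z) * v (x - z))"
    using lborel_integral_shift(1)[of "\<lambda>x. f (x - z) * v (x - z)" z] by simp
  have 3: "(LINT x|lborel. (v x)\<^sup>2) = (LINT x|lborel. (v (x - z))\<^sup>2)"
    using lborel_integral_shift(1)[of "\<lambda>x. (v (x - z))\<^sup>2" z] by simp
  show ?thesis
    unfolding resolvent_functional_def 1 2 3 using gradient_shift[OF v, of "- z"] by simp
qed

context elliptic_field
begin

text \<open>Every test function is a limit of members of the countable family within one class
  \<open>bounded_tests m\<close>, where the functional is continuous by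
  \<open>J_tendsto\<close>.\<close>

lemma resolvent_sup_eq:
  assumes f: "f \<in> Lp_on 2 UNIV"
  shows "resolvent_sup A f = (SUP v\<in>test_functions UNIV. ereal (resolvent_functional A f v))"
  unfolding resolvent_sup_def
proof (rule antisym)
  show "(SUP v\<in>dense_tests. ereal (resolvent_functional A f v)) \<le> (SUP v\<in>test_functions UNIV. ereal (resolvent_functional A f v))"
    using dense_tests_subset by (rule SUP_subset_mono) simp
  show "(SUP v\<in>test_functions UNIV. ereal (resolvent_functional A f v)) \<le> (SUP v\<in>dense_tests. ereal (resolvent_functional A f v))"
  proof (rule SUP_least)
    fix v :: "real^'n \<Rightarrow> real" assume v: "v \<in> test_functions UNIV"
    obtain m where m: "v \<in> bounded_tests m" by (rule test_in_bounded_tests[OF v])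
    obtain w where w: "\<And>k::nat. w k \<in> dense_tests \<inter> bounded_tests m"
      "\<And>x. (\<lambda>k. w k x) \<longlonglongrightarrow> v x" "\<And>x. (\<lambda>k. gradient (w k) x) \<longlonglongrightarrow> gradient v x"
      using dense_tests_approx[OF m] unfolding approximable_def by blast
    have "(\<lambda>k. J f (w k)) \<longlonglongrightarrow> J f v"
      by (rule J_tendsto[OF f _ m w(2,3)]) (use w(1) in auto)
    then have "(\<lambda>k. ereal (resolvent_functional A f (w k))) \<longlonglongrightarrow> ereal (resolvent_functional A f v)"
      by simp
    then show "ereal (resolvent_functional A f v) \<le> (SUP v\<in>dense_tests. ereal (resolvent_functional A f v))"
      by (rule LIMSEQ_le_const2) (use w(1) in \<open>auto intro!: SUP_upper\<close>)
  qed
qed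

lemma resolvent_sup_eq_integral:
  assumes f: "f \<in> Lp_on 2 UNIV" and g: "form_resolvent A UNIV 1 f g"
  shows "resolvent_sup A f = ereal (LINT x|lborel. f x * g x)"
  unfolding resolvent_sup_eq[OF f]
proof (rule antisym)
  show "(SUP v\<in>test_functions UNIV. ereal (J f v)) \<le> ereal (LINT x|lborel. f x * g x)"
    using resolvent_upper[OF f g] by (intro SUP_least) simp
  show "ereal (LINT x|lborel. f x * g x) \<le> (SUP v\<in>test_functions UNIV. ereal (J f v))"
  proof (rule ereal_le_epsilon2)
    fix e :: real assume "e > 0"
    then obtain v where v: "v \<in> test_functions UNIV" "(LINT x|lborel. f x * g x) - e < J f v"
      by (rule resolvent_approx[OF f g])
    then have "ereal (LINT x|lborel. f x * g x) \<le> ereal (J f v) + ereal e" by simp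
    also have "\<dots> \<le> (SUP v\<in>test_functions UNIV. ereal (J f v)) + ereal e"
      using v(1) by (intro add_right_mono SUP_upper)
    finally show "ereal (LINT x|lborel. f x * g x) \<le> (SUP v\<in>test_functions UNIV. ereal (J f v)) + ereal e" .
  qed
qed

end

text \<open>Translations permute the class of all test functions, but not necessarily the countable
  family. The shift is therefore performed on the large class and the result transferred
  back.\<close>

lemma resolvent_sup_shift:
  assumes ell: "elliptic_field A l L" "elliptic_field (\<lambda>x. A (x + z)) l' L'"
    and f: "f \<in> Lp_on 2 UNIV"
  shows "resolvent_sup (\<lambda>x. A (x + z)) f = resolvent_sup A (\<lambda>x. f (x - z))"
proof -
  have A: "A \<in> borel_measurable borel" using ell(1) by (simp add: elliptic_field_def)
  have fm: "f \<in> borel_measurable borel" using f by (simp add: Lp_on_2_UNIV)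
  have shift: "(\<lambda>x. f (x - z)) \<in> Lp_on 2 UNIV"
    using f lborel_integral_shift(2)[of "\<lambda>x. (f x)\<^sup>2" "- z"] measurable_compose[OF _ fm, of "\<lambda>x. x - z" borel]
    by (simp add: Lp_on_2_UNIV)
  have img: "(\<lambda>v x. v (x - z)) ` test_functions UNIV = test_functions UNIV"
  proof (intro equalityI subsetI)
    fix v assume "v \<in> (\<lambda>v x. v (x - z)) ` test_functions UNIV"
    then show "v \<in> test_functions UNIV" using test_affine[of _ 1 "- z"] by auto
  next
    fix v :: "real ^ 'a \<Rightarrow> real" assume "v \<in> test_functions UNIV"
    then have "(\<lambda>x. v (x + z)) \<in> test_functions UNIV" using test_affine[of v 1 z] by simp
    then show "v \<in> (\<lambda>v x. v (x - z)) ` test_functions UNIV" by (rule rev_image_eqI) simp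
  qed
  have "resolvent_sup (\<lambda>x. A (x + z)) f = (SUP v\<in>test_functions UNIV. ereal (resolvent_functional (\<lambda>x. A (x + z)) f v))"
    by (rule elliptic_field.resolvent_sup_eq[OF ell(2) f])
  also have "\<dots> = (SUP v\<in>test_functions UNIV. ereal (resolvent_functional A (\<lambda>x. f (x - z)) (\<lambda>x. v (x - z))))"
    by (intro SUP_cong refl) (simp add: resolvent_functional_shift[OF A fm])
  also have "\<dots> = (SUP v\<in>(\<lambda>v x. v (x - z)) ` test_functions UNIV. ereal (resolvent_functional A (\<lambda>x. f (x - z)) v))"
    by (simp add: image_comp)
  also have "\<dots> = resolvent_sup A (\<lambda>x. f (x - z))"
    unfolding img by (rule elliptic_field.resolvent_sup_eq[OF ell(1) shift, symmetric])
  finally show ?thesis .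
qed

lemma indicator_L2:
  assumes "bounded K" "K \<in> sets borel" shows "(indicator K :: real^'n::finite \<Rightarrow> real) \<in> Lp_on 2 UNIV"
proof -
  have "(\<lambda>x. (indicator K x :: real)\<^sup>2) = indicator K" by (auto split: split_indicator)
  then show ?thesis
    using assms emeasure_bounded_finite[OF assms(1)] by (simp add: Lp_on_2_UNIV less_top[symmetric] integrable_indicator_iff)
qed

locale elliptic_diffusion = minimal_diffusion a S P X + elliptic_field a l L
  for a :: "real ^ 'n::finite \<Rightarrow> real ^ 'n ^ 'n" and S :: "'p measure"
    and P :: "real ^ 'n \<Rightarrow> 'p measure" and X :: "ennreal \<Rightarrow> 'p \<Rightarrow> (real ^ 'n) option"
    and l L :: "real ^ 'n \<Rightarrow> real"
begin

definition R :: "(real ^ 'n \<Rightarrow> real) \<Rightarrow> real ^ 'n \<Rightarrow> real" where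
  "R f y = (LINT u|occupation UNIV y. f u)"

text \<open>The function w of the overview: the resolvent at level 1 applied to the constant 1,
  which is not square integrable and thus outside the reach of the form.\<close>

definition mass :: "real ^ 'n \<Rightarrow> real" where
  "mass y = measure (occupation UNIV y) UNIV"

lemma finite_occ: "finite_measure (occupation UNIV y)"
  by (rule finite_occupation[OF exit_time_UNIV_measurable])

lemma mass_nonneg: "0 \<le> mass y" and mass_le_1: "mass y \<le> 1"
  using occupation_le_1[OF exit_time_UNIV_measurable, of y]
  by (simp_all add: mass_def measure_def enn2real_leI)

lemma form_resolvent_R:
  assumes "f \<in> borel_measurable borel" "\<And>y. \<bar>f y\<bar> \<le> C" "f \<in> Lp_on 2 UNIV"
  shows "form_resolvent a UNIV 1 f (R f)"
proof -
  have "R f = killed_resolvent P X UNIV 1 f"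
    using killed_resolvent_eq[OF exit_time_UNIV_measurable assms(1,2)] by (auto simp: R_def)
  then show ?thesis using associated assms(3) by (simp add: associated_def)
qed

lemma R_L2:
  assumes "f \<in> borel_measurable borel" "\<And>y. \<bar>f y\<bar> \<le> C" "f \<in> Lp_on 2 UNIV"
  shows "R f \<in> Lp_on 2 UNIV"
  using form_resolvent_R[OF assms] by (simp add: form_resolvent_def form_domain_def)

lemma R_indicator: "K \<in> sets borel \<Longrightarrow> R (indicator K) y = measure (occupation UNIV y) K"
  by (simp add: R_def)

lemma resolvent_sup_R:
  assumes "f \<in> borel_measurable borel" "\<And>y. \<bar>f y\<bar> \<le> C" "f \<in> Lp_on 2 UNIV"
  shows "real_of_ereal (resolvent_sup a f) = (LINT x|lborel. f x * R f x)"
  using resolvent_sup_eq_integral[OF assms(3) form_resolvent_R[OF assms]] by simp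

text \<open>Expanding the two quadratic expressions leaves each cross term twice, and the symmetry
  of the resolvent merges the two into one; hence the factor 4.\<close>

lemma polarisation:
  assumes f: "f \<in> borel_measurable borel" "\<And>y. \<bar>f y\<bar> \<le> C" "f \<in> Lp_on 2 UNIV"
    and g: "g \<in> borel_measurable borel" "\<And>y. \<bar>g y\<bar> \<le> C" "g \<in> Lp_on 2 UNIV"
  shows "real_of_ereal (resolvent_sup a (\<lambda>x. f x + g x)) - real_of_ereal (resolvent_sup a (\<lambda>x. f x - g x))
    = 4 * (LINT x|lborel. g x * R f x)"
proof -
  have occ_int: "integrable (occupation UNIV y) f" "integrable (occupation UNIV y) g" for y
    using integrable_occupation[OF exit_time_UNIV_measurable] f g by blast+
  have Rlin: "R (\<lambda>x. f x + g x) y = R f y + R g y" "R (\<lambda>x. f x - g x) y = R f y - R g y" for y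
    using occ_int by (simp_all add: R_def)
  have neg: "(\<lambda>x. - g x) \<in> Lp_on 2 UNIV" using g by (simp add: Lp_on_2_UNIV)
  have sum: "(\<lambda>x. f x + g x) \<in> Lp_on 2 UNIV" using L2_diff[OF f(3) neg] by simp
  have b: "\<bar>f y + g y\<bar> \<le> 2 * C" "\<bar>f y - g y\<bar> \<le> 2 * C" for y
    using f(2)[of y] g(2)[of y] by linarith+
  have 1: "real_of_ereal (resolvent_sup a (\<lambda>x. f x + g x)) = (LINT x|lborel. (f x + g x) * (R f x + R g x))"
    using resolvent_sup_R[of "\<lambda>x. f x + g x", OF _ b(1) sum] f g by (simp add: Rlin)
  have 2: "real_of_ereal (resolvent_sup a (\<lambda>x. f x - g x)) = (LINT x|lborel. (f x - g x) * (R f x - R g x))"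
    using resolvent_sup_R[of "\<lambda>x. f x - g x", OF _ b(2) L2_diff[OF f(3) g(3)]] f g by (simp add: Rlin)
  have i: "integrable lborel (\<lambda>x. f x * R f x)" "integrable lborel (\<lambda>x. f x * R g x)"
     "integrable lborel (\<lambda>x. g x * R f x)" "integrable lborel (\<lambda>x. g x * R g x)"
    using L2_mult_integrable f(3) g(3) R_L2[OF f] R_L2[OF g] by blast+
  have "(LINT x|lborel. f x * R g x) = (LINT x|lborel. g x * R f x)"
    by (rule resolvent_symmetric[OF form_resolvent_R[OF f] form_resolvent_R[OF g]])
  then show ?thesis
    unfolding 1 2 using i by (simp add: algebra_simps)
qed

lemma occupation_exhaust:
  assumes K: "\<And>n. K n \<in> sets borel" "incseq K" "(\<Union>n. K n) = UNIV"
  shows "(\<lambda>n. R (indicator (K n)) y) \<longlonglongrightarrow> mass y"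
  using finite_measure.finite_Lim_measure_incseq[OF finite_occ, of K y] K
  by (auto simp: R_indicator mass_def)

lemma R_indicator_bounds:
  assumes "K \<in> sets borel" shows "0 \<le> R (indicator K) y" "R (indicator K) y \<le> mass y"
  using assms finite_measure.finite_measure_mono[OF finite_occ, of K UNIV y] by (simp_all add: R_indicator mass_def)

text \<open>Measurability in the starting point is read off from the form: by association the
  function lies in the form domain, hence in L2.\<close>

lemma R_indicator_measurable:
  assumes "bounded K" "K \<in> sets borel" shows "R (indicator K) \<in> borel_measurable borel"
  using R_L2[of "indicator K" 1] indicator_L2[OF assms] assms(2) by (simp add: Lp_on_2_UNIV)

lemma mass_measurable: "mass \<in> borel_measurable borel"
proof (rule borel_measurable_LIMSEQ_real)
  show "R (indicator (cball 0 (real n))) \<in> borel_measurable borel" for n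
    by (rule R_indicator_measurable) auto
  show "(\<lambda>n. R (indicator (cball 0 (real n))) y) \<longlonglongrightarrow> mass y" for y
  proof (rule occupation_exhaust)
    have "\<exists>n. norm x \<le> real n" for x :: "real^'n" using real_arch_simple by blast
    then show "(\<Union>n. cball 0 (real n)) = (UNIV :: (real^'n) set)" by auto
  qed (auto simp: incseq_def)
qed

text \<open>Exhausting space by bounded sets makes the mass accessible to the variational formula.
  Any exhausting sequence will do, and the freedom to choose it is used when the environment is
  shifted.\<close>

lemma polarisation_limit:
  assumes K: "\<And>n. K n \<in> sets borel" "\<And>n. bounded (K n)" "incseq K" "(\<Union>n. K n) = UNIV"
    and Q: "Q \<in> sets borel" "bounded Q"
  shows "(\<lambda>n. (real_of_ereal (resolvent_sup a (\<lambda>x. indicator (K n) x + indicator Q x)) -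
      real_of_ereal (resolvent_sup a (\<lambda>x. indicator (K n) x - indicator Q x))) / 4)
    \<longlonglongrightarrow> (LINT x|lborel. indicator Q x * mass x)"
proof -
  have "(real_of_ereal (resolvent_sup a (\<lambda>x. indicator (K n) x + indicator Q x)) -
      real_of_ereal (resolvent_sup a (\<lambda>x. indicator (K n) x - indicator Q x))) / 4 = (LINT x|lborel. indicator Q x * R (indicator (K n)) x)" for n
    using polarisation[of "indicator (K n)" 1 "indicator Q"] indicator_L2 K Q by (simp add: indicator_L2)
  moreover have "(\<lambda>n. LINT x|lborel. indicator Q x * R (indicator (K n)) x) \<longlonglongrightarrow> (LINT x|lborel. indicator Q x * mass x)"
  proof (rule integral_dominated_convergence[where w="indicator Q"])
    show "integrable lborel (indicator Q :: _ \<Rightarrow> real)"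
      using Q emeasure_bounded_finite[OF Q(2)] by (intro integrable_real_indicator) auto
    show "(\<lambda>x. indicator Q x * mass x) \<in> borel_measurable lborel"
      "(\<lambda>x. indicator Q x * R (indicator (K n)) x) \<in> borel_measurable lborel" for n
      using mass_measurable R_indicator_measurable[OF K(2,1)] Q by auto
    show "AE x in lborel. (\<lambda>n. indicator Q x * R (indicator (K n)) x) \<longlonglongrightarrow> indicator Q x * mass x"
      by (intro AE_I2 tendsto_intros occupation_exhaust K)
    show "AE x in lborel. norm (indicator Q x * R (indicator (K n)) x) \<le> indicator Q x" for n
      using R_indicator_bounds[OF K(1)] order_trans[OF R_indicator_bounds(2)[OF K(1)] mass_le_1]
      by (intro AE_I2) (auto split: split_indicator)
  qed
  ultimately show ?thesis by simp
qed

lemma mass_defect_integrable: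
  assumes "B \<in> sets borel" "bounded B"
  shows "integrable lborel (\<lambda>x. indicator B x * (1 - mass x))"
proof (rule Bochner_Integration.integrable_bound)
  show "integrable lborel (indicator B :: _ \<Rightarrow> real)"
    using assms emeasure_bounded_finite[OF assms(2)] by (intro integrable_real_indicator) auto
qed (use assms mass_measurable mass_le_1 mass_nonneg in \<open>auto split: split_indicator\<close>)

text \<open>Since v vanishes off K, expanding \<open>(1 - v x)\<^sup>2\<close> on K shows that the
  right side is the volume of K minus the functional at v. By \<open>resolvent_upper\<close> the
  functional is at most the integral of \<open>R (indicator K)\<close> over K, and this resolvent is
  below \<open>mass\<close>.\<close>

lemma mass_defect_le:
  assumes K: "K \<in> sets borel" "bounded K" and v: "v \<in> test_functions UNIV" and supp: "\<And>x. x \<notin> K \<Longrightarrow> v x = 0"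
  shows "(LINT x|lborel. indicator K x * (1 - mass x)) \<le> (LINT x|lborel. indicator K x * (1 - v x)\<^sup>2) + energy (gradient v)"
proof -
  note KL2 = indicator_L2[OF K(2,1)]
  have iK: "integrable lborel (indicator K :: _ \<Rightarrow> real)"
    using K emeasure_bounded_finite[OF K(2)] by (intro integrable_real_indicator) auto
  have im: "integrable lborel (\<lambda>x. indicator K x * mass x)"
    by (rule Bochner_Integration.integrable_bound[OF iK])
       (use K mass_measurable mass_le_1 mass_nonneg in \<open>auto split: split_indicator\<close>)
  have iv: "integrable lborel (\<lambda>x. indicator K x * v x)"
    by (rule L2_mult_integrable[OF KL2 test_L2[OF v]])
  have iv2: "integrable lborel (\<lambda>x. (v x)\<^sup>2)" using test_L2[OF v] by (simp add: Lp_on_2_UNIV)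
  have b: "\<bar>indicator K y :: real\<bar> \<le> 1" for y by (simp split: split_indicator)
  have Km: "(indicator K :: _ \<Rightarrow> real) \<in> borel_measurable borel" using K by simp
  have "J (indicator K) v \<le> (LINT x|lborel. indicator K x * R (indicator K) x)"
    by (rule resolvent_upper[OF KL2 form_resolvent_R[OF Km b KL2] v])
  also have "\<dots> \<le> (LINT x|lborel. indicator K x * mass x)"
    using R_indicator_bounds[OF K(1)]
    by (intro integral_mono im L2_mult_integrable[OF KL2 R_L2[OF Km b KL2]]) (auto split: split_indicator)
  finally have "J (indicator K) v \<le> (LINT x|lborel. indicator K x * mass x)" .
  moreover have "(LINT x|lborel. indicator K x * (1 - mass x)) = (LINT x|lborel. indicator K x) - (LINT x|lborel. indicator K x * mass x)"
    using iK im by (simp add: right_diff_distrib)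
  moreover have "(LINT x|lborel. indicator K x * (1 - v x)\<^sup>2) = (LINT x|lborel. indicator K x) - 2 * (LINT x|lborel. indicator K x * v x) + (LINT x|lborel. (v x)\<^sup>2)"
  proof -
    have "indicator K x * (1 - v x)\<^sup>2 = indicator K x - 2 * (indicator K x * v x) + (v x)\<^sup>2" for x
      using supp[of x] by (auto simp: power2_diff split: split_indicator)
    then show ?thesis using iK iv iv2 by simp
  qed
  ultimately show ?thesis by (simp add: J_eq)
qed

end

subsection \<open>The environment\<close>

context stationary_ergodic_environment
begin

lemma measurable_shift: "\<tau> z \<in> M \<rightarrow>\<^sub>M M"
  using measurable_compose[OF measurable_Pair1' shift_measurable, of z] by simp

lemma shift_uminus: "\<omega> \<in> space M \<Longrightarrow> \<tau> (- z) (\<tau> z \<omega>) = \<omega>"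
  using shift_add[of \<omega> "- z" z] by (simp add: shift_zero)

text \<open>Stationarity is assumed for images of sets, while image measures involve preimages; the
  group property exchanges the two.\<close>

lemma vimage_shift: "A \<in> sets M \<Longrightarrow> \<tau> z -` A \<inter> space M = \<tau> (- z) ` A"
proof (intro equalityI subsetI)
  fix \<omega> assume "\<omega> \<in> \<tau> z -` A \<inter> space M"
  then show "\<omega> \<in> \<tau> (- z) ` A" using shift_uminus[of \<omega> z] by (auto intro: rev_image_eqI)
next
  fix \<omega> assume A: "A \<in> sets M" and "\<omega> \<in> \<tau> (- z) ` A"
  then obtain \<eta> where "\<eta> \<in> A" "\<omega> = \<tau> (- z) \<eta>" by auto
  moreover have "\<eta> \<in> space M" using \<open>\<eta> \<in> A\<close> A sets.sets_into_space by blast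
  ultimately show "\<omega> \<in> \<tau> z -` A \<inter> space M"
    using shift_uminus[of \<eta> "- z"] shift_space by simp
qed

lemma distr_shift: "distr M M (\<tau> z) = M"
  by (rule measure_eqI) (simp_all add: emeasure_distr measurable_shift vimage_shift stationary)

lemma AE_shift: "(AE \<omega> in M. Q \<omega>) \<Longrightarrow> AE \<omega> in M. Q (\<tau> z \<omega>)"
  using AE_distrD[OF measurable_shift[of z], of Q] unfolding distr_shift by blast

lemma nn_integral_shift:
  "f \<in> borel_measurable M \<Longrightarrow> (\<integral>\<^sup>+\<omega>. f (\<tau> z \<omega>) \<partial>M) = (\<integral>\<^sup>+\<omega>. f \<omega> \<partial>M)"
  using nn_integral_distr[OF measurable_shift[of z], of f] by (simp add: distr_shift)

lemma shift_jointly_measurable: "(\<lambda>(\<omega>, x). \<tau> x \<omega>) \<in> M \<Otimes>\<^sub>M lborel \<rightarrow>\<^sub>M M"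
proof -
  have "(\<lambda>z. (snd z, fst z)) \<in> M \<Otimes>\<^sub>M lborel \<rightarrow>\<^sub>M borel \<Otimes>\<^sub>M M"
    using measurable_snd[of M lborel] by (intro measurable_Pair) simp_all
  from measurable_compose[OF this shift_measurable] show ?thesis by (simp add: case_prod_beta')
qed

lemma measurable_along_orbit:
  "f \<in> M \<rightarrow>\<^sub>M N \<Longrightarrow> \<omega> \<in> space M \<Longrightarrow> (\<lambda>x. f (\<tau> x \<omega>)) \<in> borel \<rightarrow>\<^sub>M N"
  using measurable_compose[OF measurable_Pair2'[of \<omega> M borel] measurable_compose[OF shift_measurable]]
  by (metis (no_types, lifting) case_prod_conv measurable_cong)

text \<open>By stationarity each fixed shift preserves null sets, and Fubini turns this into almost
  every point of almost every orbit. It is applied to a measurable null set covering the failures,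
  as Q need not be measurable.\<close>

lemma AE_AE_shift:
  assumes "AE \<omega> in M. Q \<omega>"
  shows "AE \<omega> in M. AE x in lborel. Q (\<tau> x \<omega>)"
proof -
  interpret pair_sigma_finite M "lborel :: (real^'b) measure" ..
  obtain N where N: "N \<in> null_sets M" "{\<omega> \<in> space M. \<not> Q \<omega>} \<subseteq> N"
    using assms by (auto simp: eventually_ae_filter)
  have Nm: "N \<in> sets M" using N(1) by auto
  let ?h = "\<lambda>(\<omega>, x). indicator N (\<tau> x \<omega>) :: ennreal"
  have hm: "?h \<in> borel_measurable (M \<Otimes>\<^sub>M lborel)"
    using measurable_compose[OF shift_jointly_measurable borel_measurable_indicator[OF Nm]]
    by (simp add: case_prod_beta')
  have "(\<integral>\<^sup>+\<omega>. indicator N (\<tau> x \<omega>) \<partial>M) = (0 :: ennreal)" for x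
    using nn_integral_shift[of "indicator N" x] Nm N(1) by (simp add: null_setsD1)
  then have "(\<integral>\<^sup>+x. \<integral>\<^sup>+\<omega>. ?h (\<omega>, x) \<partial>M \<partial>lborel) = 0" by simp
  then have "(\<integral>\<^sup>+\<omega>. \<integral>\<^sup>+x. ?h (\<omega>, x) \<partial>lborel \<partial>M) = 0"
    using Fubini'[of "\<lambda>\<omega> x. indicator N (\<tau> x \<omega>)"] hm by simp
  then have "AE \<omega> in M. (\<integral>\<^sup>+x. ?h (\<omega>, x) \<partial>lborel) = 0"
    using lborel.borel_measurable_nn_integral_fst[OF hm] by (subst (asm) nn_integral_0_iff_AE) auto
  then show ?thesis using AE_space
  proof eventually_elim
    case (elim \<omega>)
    have "AE x in lborel. ?h (\<omega>, x) = 0"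
      using elim measurable_Pair2[OF hm, of \<omega>] by (subst (asm) nn_integral_0_iff_AE) auto
    then show ?case
    proof eventually_elim
      case (elim x)
      then have "\<tau> x \<omega> \<notin> N" by (simp split: split_indicator_asm)
      then show ?case using N(2) shift_space[OF \<open>\<omega> \<in> space M\<close>, of x] by auto
    qed
  qed
qed

end

section \<open>Local bounds and the first moment\<close>

lemma Linfty_loc_bound:
  assumes "Linfty_loc f" "compact K"
  shows "\<exists>c. AE x in lborel. x \<in> K \<longrightarrow> f x \<le> c"
proof -
  let ?e = "esssup (restrict_space lborel K) (\<lambda>x. ereal \<bar>f x\<bar>)"
  have "?e < \<infinity>" using assms by (simp add: Linfty_loc_def)
  then obtain c where c: "?e \<le> ereal c" by (cases ?e) auto
  have "AE x in restrict_space lborel K. ereal \<bar>f x\<bar> \<le> ?e" by (rule esssup_AE)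
  then have "AE x in lborel. x \<in> K \<longrightarrow> ereal \<bar>f x\<bar> \<le> ?e"
    using borel_compact[OF assms(2)] by (subst (asm) AE_restrict_space_iff) auto
  then have "AE x in lborel. x \<in> K \<longrightarrow> f x \<le> c"
  proof eventually_elim
    case (elim x)
    show ?case
    proof
      assume "x \<in> K"
      then have "ereal \<bar>f x\<bar> \<le> ereal c" using order_trans[OF _ c] elim by blast
      then show "f x \<le> c" by simp
    qed
  qed
  then show ?thesis ..
qed

text \<open>On a probability space the first moment is controlled through s \<le> 1 + s^r for s
  \<ge> 0 and r \<ge> 1; an infinite exponent is the case of an essential bound.\<close>

lemma finite_moment_imp_finite_mean:
  assumes M: "prob_space M" and f: "f \<in> borel_measurable M" and p: "1 \<le> p" and mom: "finite_moment M f p"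
  shows "(\<integral>\<^sup>+\<omega>. ennreal (f \<omega>) \<partial>M) < \<infinity>"
proof -
  interpret prob_space M by (rule M)
  show ?thesis
  proof (cases "p = \<infinity>")
    case True
    let ?e = "esssup M (\<lambda>\<omega>. ereal \<bar>f \<omega>\<bar>)"
    have "?e < \<infinity>" using mom True by (simp add: finite_moment_def)
    then obtain c where c: "?e \<le> ereal c" by (cases ?e) auto
    have "AE \<omega> in M. ereal \<bar>f \<omega>\<bar> \<le> ?e" by (rule esssup_AE)
    then have "AE \<omega> in M. ennreal (f \<omega>) \<le> ennreal c"
    proof eventually_elim
      case (elim \<omega>)
      then have "ereal \<bar>f \<omega>\<bar> \<le> ereal c" using c by (rule order_trans)
      then show ?case by (intro ennreal_leI) simp
    qed
    then have "(\<integral>\<^sup>+\<omega>. ennreal (f \<omega>) \<partial>M) \<le> (\<integral>\<^sup>+\<omega>. ennreal c \<partial>M)" by (rule nn_integral_mono_AE)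
    also have "\<dots> < \<infinity>" by (simp add: emeasure_space_1 ennreal_mult_less_top)
    finally show ?thesis .
  next
    case False
    define r where "r = enn2real p"
    have "1 \<le> r" using p False unfolding r_def
      by (metis enn2real_mono enn2real_1 infinity_ennreal_def less_top)
    have "ennreal (f \<omega>) \<le> 1 + ennreal (\<bar>f \<omega>\<bar> powr r)" for \<omega>
    proof (cases "\<bar>f \<omega>\<bar> \<le> 1")
      case True
      then have "ennreal (f \<omega>) \<le> ennreal 1" by (intro ennreal_leI) simp
      also have "\<dots> \<le> 1 + ennreal (\<bar>f \<omega>\<bar> powr r)" by simp
      finally show ?thesis .
    next
      case False
      then have "\<bar>f \<omega>\<bar> powr 1 \<le> \<bar>f \<omega>\<bar> powr r" using \<open>1 \<le> r\<close> by (intro powr_mono) auto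
      then have "ennreal (f \<omega>) \<le> ennreal (\<bar>f \<omega>\<bar> powr r)" using False by (intro ennreal_leI) simp
      also have "\<dots> \<le> 1 + ennreal (\<bar>f \<omega>\<bar> powr r)" by simp
      finally show ?thesis .
    qed
    then have "(\<integral>\<^sup>+\<omega>. ennreal (f \<omega>) \<partial>M) \<le> (\<integral>\<^sup>+\<omega>. 1 + ennreal (\<bar>f \<omega>\<bar> powr r) \<partial>M)" by (intro nn_integral_mono)
    also have "\<dots> = 1 + (\<integral>\<^sup>+\<omega>. ennreal (\<bar>f \<omega>\<bar> powr r) \<partial>M)"
      using f by (subst nn_integral_add) (auto simp: emeasure_space_1)
    also have "\<dots> < \<infinity>" using mom False by (simp add: finite_moment_def r_def)
    finally show ?thesis .
  qed
qed

subsection \<open>Lattice cubes and cut-off functions\<close>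

definition lattice_point :: "('n::finite \<Rightarrow> int) \<Rightarrow> real ^ 'n" where
  "lattice_point f = (\<chi> i. real_of_int (f i))"

text \<open>Half-open, so that the lattice translates partition the space and each point determines
  its cube by taking floors.\<close>

definition cube :: "real ^ 'n::finite \<Rightarrow> (real ^ 'n) set" where
  "cube z = {x. \<forall>i. z $ i \<le> x $ i \<and> x $ i < z $ i + 1}"

lemma cube_measurable [measurable]: "cube z \<in> sets borel"
proof -
  have "{x \<in> space borel. \<forall>i. z $ i \<le> x $ i \<and> x $ i < z $ i + 1} \<in> sets borel" by measurable
  then show ?thesis by (simp add: cube_def)
qed

lemma cube_bounded: "bounded (cube z)"
proof (rule bounded_subset[OF bounded_cbox])
  show "cube z \<subseteq> cbox z (z + 1)" by (auto simp: cube_def mem_box_cart less_imp_le)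
qed

lemma indicator_cube_shift: "indicator (cube 0) (x - z) = indicator (cube z) x"
proof -
  have "x - z \<in> cube 0 \<longleftrightarrow> x \<in> cube z"
    by (auto simp: cube_def diff_less_eq algebra_simps)
  then show ?thesis by (simp split: split_indicator)
qed

lemma in_cube_lattice_iff: "x \<in> cube (lattice_point f) \<longleftrightarrow> f = (\<lambda>i. \<lfloor>x $ i\<rfloor>)"
  by (auto simp: cube_def lattice_point_def fun_eq_iff floor_eq_iff) (metis floor_unique of_int_floor_le floor_correct)+

text \<open>Indexes the unit cubes that tile [0, N)^d, a part of the symmetric box used for the
  cut-off. Their number N^d is exactly the scaling factor of the volume terms.\<close>

definition lattice_box :: "nat \<Rightarrow> ('n::finite \<Rightarrow> int) set" where
  "lattice_box N = (UNIV \<rightarrow>\<^sub>E {0..<int N})"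

lemma finite_lattice_box: "finite (lattice_box N)"
  unfolding lattice_box_def by (intro finite_PiE) auto

lemma card_lattice_box: "card (lattice_box N :: ('n::finite \<Rightarrow> int) set) = N ^ CARD('n)"
  by (simp add: lattice_box_def card_PiE)

definition open_box :: "real \<Rightarrow> (real ^ 'n::finite) set" where
  "open_box r = box (\<chi> i. - r) (\<chi> i. r)"

lemma open_box_iff: "x \<in> open_box r \<longleftrightarrow> (\<forall>i. - r < x $ i \<and> x $ i < r)"
  by (auto simp: open_box_def mem_box_cart)

lemma open_box_measurable [measurable]: "open_box r \<in> sets borel"
  by (simp add: open_box_def)

lemma open_box_bounded: "bounded (open_box r)"
  by (simp add: open_box_def)

lemma sum_indicator_cubes:
  assumes "0 < N"
  shows "(\<Sum>f\<in>lattice_box N. indicator (cube (lattice_point f)) x) \<le> (indicator (open_box (real N)) x :: real)"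
proof -
  have "(\<Sum>f\<in>lattice_box N. indicator (cube (lattice_point f)) x) =
    (\<Sum>f\<in>lattice_box N. if f = (\<lambda>i. \<lfloor>x $ i\<rfloor>) then 1 else 0 :: real)"
    by (intro sum.cong refl) (simp add: indicator_def in_cube_lattice_iff)
  also have "\<dots> = (if (\<lambda>i. \<lfloor>x $ i\<rfloor>) \<in> lattice_box N then 1 else 0)"
    by (rule sum.delta[OF finite_lattice_box])
  also have "\<dots> \<le> indicator (open_box (real N)) x"
  proof (cases "(\<lambda>i. \<lfloor>x $ i\<rfloor>) \<in> lattice_box N")
    case True
    then have "0 \<le> \<lfloor>x $ i\<rfloor>" "\<lfloor>x $ i\<rfloor> < int N" for i by (auto simp: lattice_box_def PiE_iff)
    then have "- real N < x $ i \<and> x $ i < real N" for i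
      using assms by (smt (verit) floor_less_iff of_int_of_nat_eq of_nat_0_less_iff zero_le_floor)
    then show ?thesis by (simp add: open_box_iff True)
  qed simp
  finally show ?thesis .
qed

lemma lborel_integral_scale:
  fixes F :: "real ^ 'n::finite \<Rightarrow> real"
  assumes F: "F \<in> borel_measurable borel" and "0 < c"
  shows "(LINT x|lborel. F ((1 / c) *\<^sub>R x)) = c ^ CARD('n) * (LINT x|lborel. F x)"
proof -
  have "(LINT x|lborel. F ((1 / c) *\<^sub>R x)) =
    (LINT x|density (distr lborel borel (\<lambda>x. 0 + c *\<^sub>R x)) (\<lambda>_. ennreal (\<bar>c\<bar> ^ DIM(real ^ 'n))). F ((1 / c) *\<^sub>R x))"
    using lborel_affine[of c "0 :: real ^ 'n"] \<open>0 < c\<close> by simp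
  also have "\<dots> = (LINT x|distr lborel borel (\<lambda>x. 0 + c *\<^sub>R x). \<bar>c\<bar> ^ DIM(real ^ 'n) *\<^sub>R F ((1 / c) *\<^sub>R x))"
    using F by (intro integral_density) auto
  also have "\<dots> = (LINT x|lborel. \<bar>c\<bar> ^ DIM(real ^ 'n) *\<^sub>R F ((1 / c) *\<^sub>R (0 + c *\<^sub>R x)))"
    using F by (intro integral_distr) auto
  also have "\<dots> = c ^ CARD('n) * (LINT x|lborel. F x)"
    using \<open>0 < c\<close> by simp
  finally show ?thesis .
qed

definition bump :: "nat \<Rightarrow> real ^ 'n::finite \<Rightarrow> real" where
  "bump k = box_bump (real k) (\<chi> i. - 1) (\<chi> i. 1)"

text \<open>The type argument fixes the dimension, which a real value cannot show.\<close>

definition bump_defect :: "'n::finite itself \<Rightarrow> nat \<Rightarrow> real" where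
  "bump_defect _ k = (LINT x|lborel. indicator (open_box 1 :: (real ^ 'n) set) x * (1 - bump k x)\<^sup>2)"

lemma bump_test: "bump k \<in> test_functions UNIV"
  unfolding bump_def by (intro box_bump_test) simp

lemma bump_defect_nonneg: "0 \<le> bump_defect TYPE('n::finite) k"
  unfolding bump_defect_def by (intro Bochner_Integration.integral_nonneg) simp

lemma bump_defect_tendsto_0: "bump_defect TYPE('n::finite) \<longlonglongrightarrow> 0"
proof -
  note [measurable] = test_measurable[OF bump_test]
  have "(\<lambda>k. LINT x|lborel. indicator (open_box 1 :: (real ^ 'n) set) x * (1 - bump k x)\<^sup>2) \<longlonglongrightarrow> (LINT x|(lborel::(real^'n) measure). 0)"
  proof (rule integral_dominated_convergence[where w="indicator (open_box 1)"])
    show "integrable lborel (indicator (open_box 1 :: (real ^ 'n) set) :: _ \<Rightarrow> real)"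
      using emeasure_bounded_finite[OF open_box_bounded[of 1]] by (intro integrable_real_indicator) auto
    show "AE x in lborel. (\<lambda>k. indicator (open_box 1 :: (real ^ 'n) set) x * (1 - bump k x)\<^sup>2) \<longlonglongrightarrow> 0"
    proof (rule AE_I2)
      fix x :: "real ^ 'n"
      have "(\<lambda>k. indicator (open_box 1) x * (1 - bump k x)\<^sup>2) \<longlonglongrightarrow> indicator (open_box 1) x * (1 - indicator (open_box 1) x)\<^sup>2"
        unfolding bump_def open_box_def by (intro tendsto_intros box_bump_tendsto)
      then show "(\<lambda>k. indicator (open_box 1) x * (1 - bump k x)\<^sup>2) \<longlonglongrightarrow> 0"
        by (cases "x \<in> open_box 1") simp_all
    qed
    show "AE x in lborel. norm (indicator (open_box 1 :: (real ^ 'n) set) x * (1 - bump k x)\<^sup>2) \<le> indicator (open_box 1) x" for k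
    proof (rule AE_I2)
      fix x :: "real ^ 'n"
      have "(1 - bump k x)\<^sup>2 \<le> 1"
        unfolding bump_def using box_bump_nonneg box_bump_le_1 by (intro power_le_one) auto
      then show "norm (indicator (open_box 1) x * (1 - bump k x)\<^sup>2) \<le> indicator (open_box 1) x"
        by (simp split: split_indicator)
    qed
  qed measurable
  then show ?thesis by (simp add: bump_defect_def[abs_def])
qed

text \<open>\<open>mass_defect_le\<close> for the large box and the stretched bump. Stretching
  multiplies the first term by N^d, and it divides the squared gradient by N^2 while enlarging its
  support to radius \<open>r * real N\<close>. The bound is stated in \<open>ennreal\<close> so that
  it can be integrated over the environment as it stands.\<close>

lemma (in elliptic_diffusion) sum_mass_defect_le:
  assumes C: "\<And>x :: real ^ 'n. (norm (gradient (bump k) x))\<^sup>2 \<le> C * indicator (cball 0 r) x" "0 \<le> C"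
    and N: "0 < N" and L: "L \<in> borel_measurable borel"
  shows "ennreal (\<Sum>f\<in>lattice_box N. LINT x|lborel. indicator (cube (lattice_point f)) x * (1 - mass x)) \<le>
    ennreal (real N ^ CARD('n) * bump_defect TYPE('n) k) +
    ennreal (C / (real N)\<^sup>2) * (\<integral>\<^sup>+x. ennreal (L x) * indicator (cball 0 (r * real N)) x \<partial>lborel)"
proof -
  define K where "K = (open_box (real N) :: (real ^ 'n) set)"
  have K: "K \<in> sets borel" "bounded K" unfolding K_def by (simp_all add: open_box_measurable open_box_bounded)
  define v where "v x = bump k ((1 / real N) *\<^sub>R x)" for x :: "real ^ 'n"
  have v: "v \<in> test_functions UNIV"
    unfolding v_def[abs_def] using test_affine[OF bump_test, of "1 / real N" k 0] N by simp
  have scale_box: "(1 / real N) *\<^sub>R x \<in> open_box 1 \<longleftrightarrow> x \<in> K" for x :: "real ^ 'n"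
    using N by (simp add: K_def open_box_iff field_simps)
  have supp: "v x = 0" if "x \<notin> K" for x
    using that scale_box[of x] unfolding v_def bump_def open_box_def by (intro box_bump_eq_0) auto
  note int = mass_defect_integrable
  have "(\<Sum>f\<in>lattice_box N. LINT x|lborel. indicator (cube (lattice_point f)) x * (1 - mass x)) =
    (LINT x|lborel. (\<Sum>f\<in>lattice_box N. indicator (cube (lattice_point f)) x * (1 - mass x)))"
    by (intro Bochner_Integration.integral_sum[symmetric] int cube_measurable cube_bounded)
  also have "\<dots> \<le> (LINT x|lborel. indicator K x * (1 - mass x))"
  proof (rule integral_mono)
    show "integrable lborel (\<lambda>x. \<Sum>f\<in>lattice_box N. indicator (cube (lattice_point f)) x * (1 - mass x))"
      by (intro Bochner_Integration.integrable_sum int cube_measurable cube_bounded)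
    show "(\<Sum>f\<in>lattice_box N. indicator (cube (lattice_point f)) x * (1 - mass x)) \<le> indicator K x * (1 - mass x)" for x
      unfolding sum_distrib_right[symmetric] K_def
      using sum_indicator_cubes[OF N, of x] mass_le_1[of x] by (intro mult_right_mono) auto
  qed (rule int[OF K])
  also have "\<dots> \<le> (LINT x|lborel. indicator K x * (1 - v x)\<^sup>2) + energy (gradient v)"
    by (rule mass_defect_le[OF K v supp])
  also have "(LINT x|lborel. indicator K x * (1 - v x)\<^sup>2) = real N ^ CARD('n) * bump_defect TYPE('n) k"
  proof -
    have "indicator K x * (1 - v x)\<^sup>2 = indicator (open_box 1) ((1 / real N) *\<^sub>R x) * (1 - bump k ((1 / real N) *\<^sub>R x))\<^sup>2" for x
      using scale_box[of x] by (simp add: v_def indicator_def)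
    moreover note [measurable] = test_measurable[OF bump_test]
    have "(\<lambda>x. indicator (open_box 1 :: (real ^ 'n) set) x * (1 - bump k x)\<^sup>2) \<in> borel_measurable borel" by measurable
    ultimately show ?thesis
      using lborel_integral_scale[of "\<lambda>x. indicator (open_box 1 :: (real ^ 'n) set) x * (1 - bump k x)\<^sup>2" "real N"] N
      by (simp add: bump_defect_def)
  qed
  finally have "ennreal (\<Sum>f\<in>lattice_box N. LINT x|lborel. indicator (cube (lattice_point f)) x * (1 - mass x)) \<le>
      ennreal (real N ^ CARD('n) * bump_defect TYPE('n) k + energy (gradient v))"
    by (rule ennreal_leI)
  also have "\<dots> = ennreal (real N ^ CARD('n) * bump_defect TYPE('n) k) + ennreal (energy (gradient v))"
    by (intro ennreal_plus energy_nonneg mult_nonneg_nonneg bump_defect_nonneg) simp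
  also have "ennreal (energy (gradient v)) \<le> (\<integral>\<^sup>+x. ennreal (C / (real N)\<^sup>2) * (ennreal (L x) * indicator (cball 0 (r * real N)) x) \<partial>lborel)"
    unfolding nn_energy[OF finite_energy_gradient[OF v], symmetric]
  proof (rule nn_integral_mono_AE)
    show "AE x in lborel. ennreal (bil x (gradient v x) (gradient v x)) \<le> ennreal (C / (real N)\<^sup>2) * (ennreal (L x) * indicator (cball 0 (r * real N)) x)"
      using AE_bil_upper
    proof eventually_elim
      case (elim x)
      have grad: "gradient v x = (1 / real N) *\<^sub>R gradient (bump k) ((1 / real N) *\<^sub>R x)"
      proof -
        have "(bump k :: real ^ 'n \<Rightarrow> real) differentiable (at ((1 / real N) *\<^sub>R x + 0))"
          by (rule test_differentiable[OF bump_test])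
        from partial_deriv_affine[OF this] show ?thesis
          by (simp add: gradient_def vec_eq_iff v_def[abs_def])
      qed
      have ball: "(1 / real N) *\<^sub>R x \<in> cball 0 r \<longleftrightarrow> x \<in> cball 0 (r * real N)"
        using N by (simp add: field_simps)
      have "bil x (gradient v x) (gradient v x) \<le> L x * (norm (gradient v x))\<^sup>2" using elim by blast
      also have "(norm (gradient v x))\<^sup>2 = (1 / real N)\<^sup>2 * (norm (gradient (bump k) ((1 / real N) *\<^sub>R x)))\<^sup>2"
        by (simp add: grad power_mult_distrib power_divide)
      also have "\<dots> \<le> (1 / real N)\<^sup>2 * (C * indicator (cball 0 r) ((1 / real N) *\<^sub>R x))"
        by (intro mult_left_mono C) simp
      also have "\<dots> = C / (real N)\<^sup>2 * indicator (cball 0 (r * real N)) x"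
        using ball by (simp add: power_divide indicator_def)
      finally have "bil x (gradient v x) (gradient v x) \<le> C / (real N)\<^sup>2 * (L x * indicator (cball 0 (r * real N)) x)"
        using L_pos[of x] by (simp add: mult_ac)
      then have "ennreal (bil x (gradient v x) (gradient v x)) \<le> ennreal (C / (real N)\<^sup>2 * (L x * indicator (cball 0 (r * real N)) x))"
        by (rule ennreal_leI)
      also have "\<dots> = ennreal (C / (real N)\<^sup>2) * (ennreal (L x) * indicator (cball 0 (r * real N)) x)"
        using C(2) by (simp add: ennreal_mult[symmetric] less_imp_le[OF L_pos] split: split_indicator)
      finally show ?case .
    qed
  qed
  also have "\<dots> = ennreal (C / (real N)\<^sup>2) * (\<integral>\<^sup>+x. ennreal (L x) * indicator (cball 0 (r * real N)) x \<partial>lborel)"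
  proof (rule nn_integral_cmult)
    note [measurable] = L
    show "(\<lambda>x. ennreal (L x) * indicator (cball 0 (r * real N)) x) \<in> borel_measurable lborel"
      by (intro borel_measurable_times_ennreal borel_measurable_indicator measurable_compose[OF _ measurable_ennreal]) (auto simp: L)
  qed
  finally show ?thesis by (simp add: add_left_mono)
qed

subsection \<open>Conservativeness\<close>

text \<open>\<open>Lam_mean\<close> is the form in which the moment bound on \<open>Lam\<close> is
  used. The diffusions are given separately for each environment, and nothing links those of
  \<omega> and of a shift of \<omega>.\<close>

locale random_diffusion = stationary_ergodic_environment M \<tau>
  for M :: "'w measure" and \<tau> :: "real ^ 'n::finite \<Rightarrow> 'w \<Rightarrow> 'w" +
  fixes a :: "'w \<Rightarrow> real ^ 'n ^ 'n" and lam Lam :: "'w \<Rightarrow> real"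
    and S :: "'w \<Rightarrow> 'p measure" and P :: "'w \<Rightarrow> real ^ 'n \<Rightarrow> 'p measure"
    and X :: "'w \<Rightarrow> ennreal \<Rightarrow> 'p \<Rightarrow> (real ^ 'n) option"
  assumes a_measurable: "a \<in> borel_measurable M"
    and a_symmetric: "\<And>\<omega>. \<omega> \<in> space M \<Longrightarrow> transpose (a \<omega>) = a \<omega>"
    and Lam_measurable: "Lam \<in> borel_measurable M"
    and lam_pos: "\<And>\<omega>. \<omega> \<in> space M \<Longrightarrow> 0 < lam \<omega>"
    and Lam_pos: "\<And>\<omega>. \<omega> \<in> space M \<Longrightarrow> 0 < Lam \<omega>"
    and ellipticity: "AE \<omega> in M. \<forall>\<xi>.
          lam \<omega> * (norm \<xi>)\<^sup>2 \<le> (a \<omega> *v \<xi>) \<bullet> \<xi> \<and> (a \<omega> *v \<xi>) \<bullet> \<xi> \<le> Lam \<omega> * (norm \<xi>)\<^sup>2"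
    and Lam_mean: "(\<integral>\<^sup>+\<omega>. ennreal (Lam \<omega>) \<partial>M) < \<infinity>"
    and lam_loc: "AE \<omega> in M. Linfty_loc (\<lambda>x. 1 / lam (\<tau> x \<omega>))"
    and Lam_loc: "AE \<omega> in M. Linfty_loc (\<lambda>x. Lam (\<tau> x \<omega>))"
    and diffusion: "AE \<omega> in M. minimal_diffusion (\<lambda>x. a (\<tau> x \<omega>)) (S \<omega>) (P \<omega>) (X \<omega>)"
begin

definition A :: "'w \<Rightarrow> real ^ 'n \<Rightarrow> real ^ 'n ^ 'n" where
  "A \<omega> x = a (\<tau> x \<omega>)"

definition good :: "'w \<Rightarrow> bool" where
  "good \<omega> \<longleftrightarrow> \<omega> \<in> space M \<and>
     elliptic_diffusion (A \<omega>) (S \<omega>) (P \<omega>) (X \<omega>) (\<lambda>x. lam (\<tau> x \<omega>)) (\<lambda>x. Lam (\<tau> x \<omega>))"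

lemma A_shift: "\<omega> \<in> space M \<Longrightarrow> A (\<tau> z \<omega>) = (\<lambda>x. A \<omega> (x + z))"
  by (simp add: A_def shift_add fun_eq_iff)

text \<open>Ellipticity is given for almost every environment but is wanted at almost every point of
  one orbit, hence the use of \<open>AE_AE_shift\<close>.\<close>

lemma AE_good: "AE \<omega> in M. good \<omega>"
  using AE_AE_shift[OF ellipticity] lam_loc Lam_loc diffusion AE_space
proof eventually_elim
  case (elim \<omega>)
  have "elliptic_field (A \<omega>) (\<lambda>x. lam (\<tau> x \<omega>)) (\<lambda>x. Lam (\<tau> x \<omega>))"
  proof
    show "A \<omega> \<in> borel_measurable borel"
      using measurable_along_orbit[OF a_measurable \<open>\<omega> \<in> space M\<close>] by (simp add: A_def[abs_def])
    show "transpose (A \<omega> x) = A \<omega> x" "0 < lam (\<tau> x \<omega>)" "0 < Lam (\<tau> x \<omega>)" for x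
      using shift_space[OF \<open>\<omega> \<in> space M\<close>, of x] by (simp_all add: A_def a_symmetric lam_pos Lam_pos)
    show "\<exists>c. AE x in lborel. x \<in> K \<longrightarrow> 1 / lam (\<tau> x \<omega>) \<le> c" "\<exists>c. AE x in lborel. x \<in> K \<longrightarrow> Lam (\<tau> x \<omega>) \<le> c"
      if "compact K" for K :: "(real ^ 'n) set"
      using elim(2,3) that by (auto intro!: Linfty_loc_bound)
  qed (use elim(1) in \<open>simp add: A_def\<close>)
  with elim show ?case
    by (simp add: good_def elliptic_diffusion_def A_def[abs_def])
qed

lemma AE_good_lattice: "AE \<omega> in M. \<forall>f. good (\<tau> (lattice_point f) \<omega>)"
  by (subst AE_all_countable) (intro allI AE_shift AE_good)

lemma resolvent_functional_measurable:
  assumes v: "v \<in> test_functions UNIV"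
  shows "(\<lambda>\<omega>. resolvent_functional (A \<omega>) f v) \<in> borel_measurable M"
proof -
  have am: "(\<lambda>z. a (\<tau> (snd z) (fst z))) \<in> borel_measurable (M \<Otimes>\<^sub>M lborel)"
    using measurable_compose[OF shift_jointly_measurable a_measurable] by (simp add: case_prod_beta')
  have gm: "(\<lambda>z. gradient v (snd z)) \<in> borel_measurable (M \<Otimes>\<^sub>M lborel)"
    using measurable_compose[OF measurable_snd, of "gradient v" lborel borel M] gradient_measurable[OF v] by simp
  have eq: "(B *v w) \<bullet> w = (\<Sum>i\<in>UNIV. \<Sum>j\<in>UNIV. B $ i $ j * w $ j * w $ i)" for B :: "real ^ 'n ^ 'n" and w
    by (simp add: inner_vec_def matrix_vector_mult_def sum_distrib_right)
  have "(\<lambda>z. (a (\<tau> (snd z) (fst z)) *v gradient v (snd z)) \<bullet> gradient v (snd z)) \<in> borel_measurable (M \<Otimes>\<^sub>M lborel)"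
    unfolding eq by (intro borel_measurable_sum borel_measurable_times vec_nth_measurable gm am)
  then have "(\<lambda>\<omega>. LINT x|lborel. (A \<omega> x *v gradient v x) \<bullet> gradient v x) \<in> borel_measurable M"
    unfolding A_def by (intro lborel.borel_measurable_lebesgue_integral) (simp add: case_prod_beta')
  then show ?thesis unfolding resolvent_functional_def by measurable
qed

lemma resolvent_sup_measurable: "(\<lambda>\<omega>. resolvent_sup (A \<omega>) f) \<in> borel_measurable M"
  unfolding resolvent_sup_def using dense_tests_subset resolvent_functional_measurable
  by (intro borel_measurable_SUP countable_dense_tests borel_measurable_ereal) auto

text \<open>By polarisation the limit is the integral of the mass of the resolvent over the unit cube; in
  this form it is visibly measurable in the environment, although the processes are not assumed to
  depend measurably on it.\<close>

definition defect :: "'w \<Rightarrow> real" where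
  "defect \<omega> = measure lborel (cube 0 :: (real ^ 'n) set) - lim (\<lambda>n.
     (real_of_ereal (resolvent_sup (A \<omega>) (\<lambda>x. indicator (cball 0 (real n)) x + indicator (cube 0) x)) -
      real_of_ereal (resolvent_sup (A \<omega>) (\<lambda>x. indicator (cball 0 (real n)) x - indicator (cube 0) x))) / 4)"

lemma defect_measurable: "defect \<in> borel_measurable M"
proof -
  note [measurable] = resolvent_sup_measurable
  show ?thesis unfolding defect_def[abs_def]
    by (intro borel_measurable_diff borel_measurable_const borel_measurable_lim_metric) measurable
qed

text \<open>The processes at \<omega> and at its shift by z have no given relation; only the
  coefficients are translates of each other. Since \<open>defect\<close> sees the coefficients
  alone, its value at the shifted environment can be expressed through the process at \<omega>, on a
  translated cube.\<close>

lemma defect_shift: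
  assumes "good \<omega>" "good (\<tau> z \<omega>)"
  shows "defect (\<tau> z \<omega>) = (LINT x|lborel. indicator (cube z) x * (1 - elliptic_diffusion.mass (P \<omega>) (X \<omega>) x))"
proof -
  interpret E: elliptic_diffusion "A \<omega>" "S \<omega>" "P \<omega>" "X \<omega>" "\<lambda>x. lam (\<tau> x \<omega>)" "\<lambda>x. Lam (\<tau> x \<omega>)"
    using assms(1) by (simp add: good_def)
  have \<omega>: "\<omega> \<in> space M" using assms(1) by (simp add: good_def)
  have ell: "elliptic_field (A \<omega>) (\<lambda>x. lam (\<tau> x \<omega>)) (\<lambda>x. Lam (\<tau> x \<omega>))" by unfold_locales
  have ell': "elliptic_field (\<lambda>x. A \<omega> (x + z)) (\<lambda>x. lam (\<tau> x (\<tau> z \<omega>))) (\<lambda>x. Lam (\<tau> x (\<tau> z \<omega>)))"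
    using assms(2) by (simp add: good_def elliptic_diffusion_def A_shift[OF \<omega>])
  have ball: "indicator (cball 0 r) (x - z) = indicator (cball z r) x" for r x
    by (simp add: indicator_def dist_norm norm_minus_commute)
  have L2: "(\<lambda>x :: real ^ 'n. indicator (cball 0 (real n)) x + indicator (cube 0) x :: real) \<in> Lp_on 2 UNIV"
    "(\<lambda>x :: real ^ 'n. indicator (cball 0 (real n)) x - indicator (cube 0) x :: real) \<in> Lp_on 2 UNIV" for n
  proof -
    have b: "(indicator (cball 0 (real n)) :: real ^ 'n \<Rightarrow> real) \<in> Lp_on 2 UNIV" by (rule indicator_L2) auto
    have c: "(indicator (cube 0) :: real ^ 'n \<Rightarrow> real) \<in> Lp_on 2 UNIV" by (rule indicator_L2[OF cube_bounded cube_measurable])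
    then have "(\<lambda>x :: real ^ 'n. - indicator (cube 0) x :: real) \<in> Lp_on 2 UNIV" by (simp add: Lp_on_2_UNIV)
    from L2_diff[OF b this] L2_diff[OF b c]
    show "(\<lambda>x :: real ^ 'n. indicator (cball 0 (real n)) x + indicator (cube 0) x :: real) \<in> Lp_on 2 UNIV"
      "(\<lambda>x :: real ^ 'n. indicator (cball 0 (real n)) x - indicator (cube 0) x :: real) \<in> Lp_on 2 UNIV" by simp_all
  qed
  have sup: "resolvent_sup (A (\<tau> z \<omega>)) (\<lambda>x. indicator (cball 0 (real n)) x + indicator (cube 0) x) =
      resolvent_sup (A \<omega>) (\<lambda>x. indicator (cball z (real n)) x + indicator (cube z) x)"
    "resolvent_sup (A (\<tau> z \<omega>)) (\<lambda>x. indicator (cball 0 (real n)) x - indicator (cube 0) x) =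
      resolvent_sup (A \<omega>) (\<lambda>x. indicator (cball z (real n)) x - indicator (cube z) x)" for n
    unfolding A_shift[OF \<omega>] resolvent_sup_shift[OF ell ell' L2(1)] resolvent_sup_shift[OF ell ell' L2(2)]
    by (simp_all add: ball indicator_cube_shift)
  \<comment> \<open>Translation has moved the centre of the exhausting balls to z. They still
    exhaust the space, so the limit is an integral of the same mass.\<close>
  have "(\<lambda>n. (real_of_ereal (resolvent_sup (A \<omega>) (\<lambda>x. indicator (cball z (real n)) x + indicator (cube z) x)) -
      real_of_ereal (resolvent_sup (A \<omega>) (\<lambda>x. indicator (cball z (real n)) x - indicator (cube z) x))) / 4)
    \<longlonglongrightarrow> (LINT x|lborel. indicator (cube z) x * E.mass x)"
  proof (rule E.polarisation_limit)
    have "\<exists>n. dist z x \<le> real n" for x using real_arch_simple by blast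
    then show "(\<Union>n. cball z (real n)) = UNIV" by auto
  qed (auto simp: incseq_def cube_bounded)
  then have "defect (\<tau> z \<omega>) = measure lborel (cube 0 :: (real ^ 'n) set) - (LINT x|lborel. indicator (cube z) x * E.mass x)"
    unfolding defect_def sup by (simp add: limI)
  also have "measure lborel (cube 0 :: (real ^ 'n) set) = (LINT x|lborel. indicator (cube z) x)"
    using lborel_integral_shift(1)[of "indicator (cube 0) :: real ^ 'n \<Rightarrow> real" "- z"]
    by (simp add: indicator_cube_shift)
  also have "(LINT x|lborel. indicator (cube z) x) - (LINT x|lborel. indicator (cube z) x * E.mass x) =
    (LINT x|lborel. indicator (cube z) x * (1 - E.mass x))"
  proof -
    have i: "integrable lborel (indicator (cube z) :: _ \<Rightarrow> real)"
      using emeasure_bounded_finite[OF cube_bounded[of z]] by (intro integrable_real_indicator) auto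
    have "integrable lborel (\<lambda>x. indicator (cube z) x * E.mass x)"
      by (rule Bochner_Integration.integrable_bound[OF i])
         (use E.mass_measurable E.mass_le_1 E.mass_nonneg in \<open>auto split: split_indicator\<close>)
    with i show ?thesis by (simp add: right_diff_distrib)
  qed
  finally show ?thesis .
qed

text \<open>After exchanging the integrals, stationarity makes the inner expectation independent of
  the point x.\<close>

lemma mean_Lam_ball:
  "(\<integral>\<^sup>+\<omega>. \<integral>\<^sup>+x. ennreal (Lam (\<tau> x \<omega>)) * indicator B x \<partial>lborel \<partial>M) = (\<integral>\<^sup>+\<omega>. ennreal (Lam \<omega>) \<partial>M) * emeasure lborel B"
  "(\<lambda>\<omega>. \<integral>\<^sup>+x. ennreal (Lam (\<tau> x \<omega>)) * indicator B x \<partial>lborel) \<in> borel_measurable M"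
  if B: "B \<in> sets borel" for B :: "(real ^ 'n) set"
proof -
  interpret pair_sigma_finite M "lborel :: (real ^ 'n) measure" ..
  have m: "(\<lambda>(\<omega>, x). ennreal (Lam (\<tau> x \<omega>)) * indicator B x) \<in> borel_measurable (M \<Otimes>\<^sub>M lborel)"
  proof -
    have "(\<lambda>z. Lam (\<tau> (snd z) (fst z))) \<in> borel_measurable (M \<Otimes>\<^sub>M lborel)"
      using measurable_compose[OF shift_jointly_measurable Lam_measurable] by (simp add: case_prod_beta')
    moreover have "(\<lambda>z. indicator B (snd z) :: ennreal) \<in> borel_measurable (M \<Otimes>\<^sub>M lborel)"
      using measurable_compose[OF measurable_snd, of "indicator B :: _ \<Rightarrow> ennreal" lborel borel M] B by simp
    ultimately show ?thesis by (simp add: case_prod_beta')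
  qed
  show "(\<lambda>\<omega>. \<integral>\<^sup>+x. ennreal (Lam (\<tau> x \<omega>)) * indicator B x \<partial>lborel) \<in> borel_measurable M"
    using lborel.borel_measurable_nn_integral_fst[OF m] by simp
  have Lm: "(\<lambda>\<omega>. ennreal (Lam (\<tau> x \<omega>))) \<in> borel_measurable M" for x
    using measurable_compose[OF measurable_shift Lam_measurable] by simp
  have "(\<integral>\<^sup>+\<omega>. \<integral>\<^sup>+x. ennreal (Lam (\<tau> x \<omega>)) * indicator B x \<partial>lborel \<partial>M) =
    (\<integral>\<^sup>+x. \<integral>\<^sup>+\<omega>. ennreal (Lam (\<tau> x \<omega>)) * indicator B x \<partial>M \<partial>lborel)"
    using Fubini'[of "\<lambda>\<omega> x. ennreal (Lam (\<tau> x \<omega>)) * indicator B x"] m by simp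
  also have "\<dots> = (\<integral>\<^sup>+x. (\<integral>\<^sup>+\<omega>. ennreal (Lam \<omega>) \<partial>M) * indicator B x \<partial>lborel)"
    using nn_integral_shift[of "\<lambda>\<omega>. ennreal (Lam \<omega>)"] Lam_measurable
    by (intro nn_integral_cong) (simp add: nn_integral_multc[OF Lm])
  also have "\<dots> = (\<integral>\<^sup>+\<omega>. ennreal (Lam \<omega>) \<partial>M) * emeasure lborel B"
    using B by (intro nn_integral_cmult_indicator) simp
  finally show "(\<integral>\<^sup>+\<omega>. \<integral>\<^sup>+x. ennreal (Lam (\<tau> x \<omega>)) * indicator B x \<partial>lborel \<partial>M) = (\<integral>\<^sup>+\<omega>. ennreal (Lam \<omega>) \<partial>M) * emeasure lborel B" .
qed

text \<open>By stationarity all N^d cubes have the same expected defect, so N^d times this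
  expectation is bounded by the expectation of the estimate on the large box. Both terms there carry
  a factor N^d, the second one from the volume of the ball. Cancelling it leaves N^(-2) in front of
  the mean of \<open>Lam\<close>.\<close>

lemma mean_defect_le:
  assumes C: "\<And>x :: real ^ 'n. (norm (gradient (bump k) x))\<^sup>2 \<le> C * indicator (cball 0 r) x" "0 \<le> C" "0 \<le> r"
    and N: "0 < N"
  shows "(\<integral>\<^sup>+\<omega>. ennreal (defect \<omega>) \<partial>M) \<le> ennreal (bump_defect TYPE('n) k +
    C * enn2real (\<integral>\<^sup>+\<omega>. ennreal (Lam \<omega>) \<partial>M) * (unit_ball_vol (real CARD('n)) * r ^ CARD('n)) / (real N)\<^sup>2)"
proof -
  define c where "c = (\<integral>\<^sup>+\<omega>. ennreal (defect \<omega>) \<partial>M)"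
  define m where "m = enn2real (\<integral>\<^sup>+\<omega>. ennreal (Lam \<omega>) \<partial>M)"
  have m: "(\<integral>\<^sup>+\<omega>. ennreal (Lam \<omega>) \<partial>M) = ennreal m" "0 \<le> m"
    using Lam_mean by (simp_all add: m_def less_top)
  define V where "V = unit_ball_vol (real CARD('n)) * r ^ CARD('n)"
  have V: "0 \<le> V" using C(3) by (simp add: V_def)
  define h where "h \<omega> = (\<integral>\<^sup>+x. ennreal (Lam (\<tau> x \<omega>)) * indicator (cball 0 (r * real N)) (x :: real ^ 'n) \<partial>lborel)" for \<omega>
  have hm: "h \<in> borel_measurable M" unfolding h_def[abs_def] by (rule mean_Lam_ball(2)) simp
  have dm: "(\<lambda>\<omega>. ennreal (defect (\<tau> z \<omega>))) \<in> borel_measurable M" for z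
    using measurable_compose[OF measurable_shift defect_measurable] by simp
  have "of_nat (N ^ CARD('n)) * c = (\<Sum>f\<in>(lattice_box N :: ('n \<Rightarrow> int) set). c)"
    by (simp add: card_lattice_box)
  also have "\<dots> = (\<Sum>f\<in>(lattice_box N :: ('n \<Rightarrow> int) set). \<integral>\<^sup>+\<omega>. ennreal (defect (\<tau> (lattice_point f) \<omega>)) \<partial>M)"
    unfolding c_def using nn_integral_shift[of "\<lambda>\<omega>. ennreal (defect \<omega>)"] defect_measurable by simp
  also have "\<dots> = (\<integral>\<^sup>+\<omega>. (\<Sum>f\<in>lattice_box N. ennreal (defect (\<tau> (lattice_point f) \<omega>))) \<partial>M)"
    using dm by (intro nn_integral_sum[symmetric])
  also have "\<dots> \<le> (\<integral>\<^sup>+\<omega>. ennreal (real N ^ CARD('n) * bump_defect TYPE('n) k) + ennreal (C / (real N)\<^sup>2) * h \<omega> \<partial>M)"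
  proof (rule nn_integral_mono_AE)
    show "AE \<omega> in M. (\<Sum>f\<in>lattice_box N. ennreal (defect (\<tau> (lattice_point f) \<omega>))) \<le>
      ennreal (real N ^ CARD('n) * bump_defect TYPE('n) k) + ennreal (C / (real N)\<^sup>2) * h \<omega>"
      using AE_good AE_good_lattice
    proof eventually_elim
      case (elim \<omega>)
      interpret E: elliptic_diffusion "A \<omega>" "S \<omega>" "P \<omega>" "X \<omega>" "\<lambda>x. lam (\<tau> x \<omega>)" "\<lambda>x. Lam (\<tau> x \<omega>)"
        using elim(1) by (simp add: good_def)
      have \<omega>: "\<omega> \<in> space M" using elim(1) by (simp add: good_def)
      have d: "defect (\<tau> (lattice_point f) \<omega>) = (LINT x|lborel. indicator (cube (lattice_point f)) x * (1 - E.mass x))" for f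
        using elim by (intro defect_shift) auto
      have "0 \<le> defect (\<tau> (lattice_point f) \<omega>)" for f
        unfolding d using E.mass_le_1 by (intro Bochner_Integration.integral_nonneg) simp
      then have "(\<Sum>f\<in>lattice_box N. ennreal (defect (\<tau> (lattice_point f) \<omega>))) = ennreal (\<Sum>f\<in>lattice_box N. defect (\<tau> (lattice_point f) \<omega>))"
        by (intro sum_ennreal) auto
      also have "\<dots> \<le> ennreal (real N ^ CARD('n) * bump_defect TYPE('n) k) + ennreal (C / (real N)\<^sup>2) * h \<omega>"
        unfolding d h_def
        by (rule E.sum_mass_defect_le[OF C(1,2) N measurable_along_orbit[OF Lam_measurable \<omega>]])
      finally show ?case .
    qed
  qed
  also have "\<dots> = ennreal (real N ^ CARD('n) * bump_defect TYPE('n) k) + ennreal (C / (real N)\<^sup>2) * (\<integral>\<^sup>+\<omega>. h \<omega> \<partial>M)"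
    using hm by (subst nn_integral_add) (auto simp: nn_integral_cmult emeasure_space_1)
  also have "(\<integral>\<^sup>+\<omega>. h \<omega> \<partial>M) = ennreal m * emeasure lborel (cball 0 (r * real N) :: (real ^ 'n) set)"
    unfolding h_def m(1)[symmetric] by (rule mean_Lam_ball(1)) simp
  also have "emeasure lborel (cball 0 (r * real N) :: (real ^ 'n) set) = ennreal (V * real N ^ CARD('n))"
    using C(3) by (simp add: emeasure_cball V_def power_mult_distrib mult.assoc)
  also have "ennreal (real N ^ CARD('n) * bump_defect TYPE('n) k) + ennreal (C / (real N)\<^sup>2) * (ennreal m * ennreal (V * real N ^ CARD('n)))
    = ennreal (real N ^ CARD('n) * bump_defect TYPE('n) k + C / (real N)\<^sup>2 * (m * (V * real N ^ CARD('n))))"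
    using C m V bump_defect_nonneg[where 'n='n, of k]
    by (simp add: ennreal_mult''[symmetric] ennreal_plus[symmetric] del: ennreal_plus)
  also have "real N ^ CARD('n) * bump_defect TYPE('n) k + C / (real N)\<^sup>2 * (m * (V * real N ^ CARD('n))) =
    real N ^ CARD('n) * (bump_defect TYPE('n) k + C * m * V / (real N)\<^sup>2)"
    by (simp add: algebra_simps)
  finally have "of_nat (N ^ CARD('n)) * c \<le> ennreal (real N ^ CARD('n) * (bump_defect TYPE('n) k + C * m * V / (real N)\<^sup>2))" .
  also have "\<dots> = of_nat (N ^ CARD('n)) * ennreal (bump_defect TYPE('n) k + C * m * V / (real N)\<^sup>2)"
    using C m V bump_defect_nonneg[where 'n='n, of k]
    by (subst ennreal_mult) (auto simp: ennreal_of_nat_eq_real_of_nat)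
  finally have "c \<le> ennreal (bump_defect TYPE('n) k + C * m * V / (real N)\<^sup>2)"
    using N by (subst (asm) ennreal_mult_le_mult_iff) (auto simp: ennreal_of_nat_eq_real_of_nat)
  then show ?thesis by (simp add: c_def m_def V_def)
qed

text \<open>The limits are taken in order: C and r belong to a fixed bump, so N tends to infinity
  first and only then k.\<close>

lemma mean_defect_eq_0: "(\<integral>\<^sup>+\<omega>. ennreal (defect \<omega>) \<partial>M) = 0"
proof -
  have "(\<integral>\<^sup>+\<omega>. ennreal (defect \<omega>) \<partial>M) \<le> ennreal (bump_defect TYPE('n) k)" for k
  proof -
    obtain C r where C: "0 < C" "0 < r" "\<And>x :: real ^ 'n. (norm (gradient (bump k) x))\<^sup>2 \<le> C * indicator (cball 0 r) x"
      by (rule gradient_bound[OF bump_test]) blast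
    define D where "D = C * enn2real (\<integral>\<^sup>+\<omega>. ennreal (Lam \<omega>) \<partial>M) * (unit_ball_vol (real CARD('n)) * r ^ CARD('n))"
    have "(\<lambda>N. bump_defect TYPE('n) k + D * (1 / real (Suc N)) * (1 / real (Suc N))) \<longlonglongrightarrow> bump_defect TYPE('n) k + D * 0 * 0"
      by (intro tendsto_intros LIMSEQ_Suc[OF lim_1_over_n])
    then have "(\<lambda>N. ennreal (bump_defect TYPE('n) k + D / (real (Suc N))\<^sup>2)) \<longlonglongrightarrow> ennreal (bump_defect TYPE('n) k)"
      by (intro tendsto_ennrealI) (simp add: power2_eq_square)
    moreover have "(\<integral>\<^sup>+\<omega>. ennreal (defect \<omega>) \<partial>M) \<le> ennreal (bump_defect TYPE('n) k + D / (real (Suc N))\<^sup>2)" for N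
      unfolding D_def by (rule mean_defect_le[OF C(3)]) (use C in simp_all)
    ultimately show ?thesis by (intro LIMSEQ_le_const) blast+
  qed
  moreover have "(\<lambda>k. ennreal (bump_defect TYPE('n) k)) \<longlonglongrightarrow> ennreal 0"
    by (rule tendsto_ennrealI[OF bump_defect_tendsto_0])
  ultimately have "(\<integral>\<^sup>+\<omega>. ennreal (defect \<omega>) \<partial>M) \<le> ennreal 0"
    by (intro LIMSEQ_le_const) auto
  then show ?thesis by simp
qed

text \<open>Countably many lattice shifts keep the defect zero simultaneously, almost surely. On
  each cube a nonnegative function with zero integral vanishes almost everywhere, and the cubes
  cover the space.\<close>

lemma AE_mass_eq_1:
  "AE \<omega> in M. AE y in lborel. elliptic_diffusion.mass (P \<omega>) (X \<omega>) y = 1"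
proof -
  have "AE \<omega> in M. ennreal (defect \<omega>) = 0"
    using mean_defect_eq_0 defect_measurable by (subst (asm) nn_integral_0_iff_AE) auto
  then have "AE \<omega> in M. \<forall>f :: 'n \<Rightarrow> int. ennreal (defect (\<tau> (lattice_point f) \<omega>)) = 0"
    by (subst AE_all_countable) (intro allI AE_shift)
  then show ?thesis using AE_good AE_good_lattice
  proof eventually_elim
    case (elim \<omega>)
    interpret E: elliptic_diffusion "A \<omega>" "S \<omega>" "P \<omega>" "X \<omega>" "\<lambda>x. lam (\<tau> x \<omega>)" "\<lambda>x. Lam (\<tau> x \<omega>)"
      using elim(2) by (simp add: good_def)
    have "AE y in lborel. indicator (cube (lattice_point f)) y * (1 - E.mass y) = 0" for f
    proof -
      have "(LINT x|lborel. indicator (cube (lattice_point f)) x * (1 - E.mass x)) \<le> 0"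
      proof -
        \<comment> \<open>A vanishing \<open>ennreal\<close> value says only that the real number is
          not positive; the opposite inequality comes from \<open>E.mass_le_1\<close>.\<close>
        have "defect (\<tau> (lattice_point f) \<omega>) \<le> 0"
          using elim(1) by (simp add: ennreal_eq_0_iff)
        then show ?thesis using elim(2,3) by (simp add: defect_shift)
      qed
      moreover have "0 \<le> (LINT x|lborel. indicator (cube (lattice_point f)) x * (1 - E.mass x))"
        using E.mass_le_1 by (intro Bochner_Integration.integral_nonneg) simp
      moreover have "integrable lborel (\<lambda>x. indicator (cube (lattice_point f)) x * (1 - E.mass x))"
        by (rule E.mass_defect_integrable[OF cube_measurable cube_bounded])
      ultimately show ?thesis
        using E.mass_le_1 by (subst integral_nonneg_eq_0_iff_AE[symmetric]) auto
    qed
    then have "AE y in lborel. \<forall>f. indicator (cube (lattice_point f)) y * (1 - E.mass y) = 0"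
      by (subst AE_all_countable) auto
    then show ?case
    proof eventually_elim
      case (elim y)
      have "y \<in> cube (lattice_point (\<lambda>i. \<lfloor>y $ i\<rfloor>))" by (simp add: in_cube_lattice_iff)
      with elim[rule_format, of "\<lambda>i. \<lfloor>y $ i\<rfloor>"] show ?case by simp
    qed
  qed
qed

lemma AE_conservative: "AE \<omega> in M. \<forall>x. measure (P \<omega> x) {w \<in> space (P \<omega> x). lifetime (X \<omega>) w = \<infinity>} = 1"
  using AE_mass_eq_1 AE_good
proof eventually_elim
  case (elim \<omega>)
  interpret E: elliptic_diffusion "A \<omega>" "S \<omega>" "P \<omega>" "X \<omega>" "\<lambda>x. lam (\<tau> x \<omega>)" "\<lambda>x. Lam (\<tau> x \<omega>)"
    using elim(2) by (simp add: good_def)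
  have ell: "elliptic_field (A \<omega>) (\<lambda>x. lam (\<tau> x \<omega>)) (\<lambda>x. Lam (\<tau> x \<omega>))" by unfold_locales
  have "AE y in lborel. AE w in P \<omega> y. lifetime (X \<omega>) w = \<infinity>"
    using elim(1)
  proof eventually_elim
    case (elim y)
    then have "emeasure (E.occupation UNIV y) UNIV = 1"
      using finite_measure.emeasure_eq_measure[OF E.finite_occ, of y UNIV] by (simp add: E.mass_def)
    then show ?case by (rule E.lifetime_infinite_if_full_occupation)
  qed
  then show ?case
    by (intro allI E.prob_lifetime_infinite E.conservative_everywhere[OF ell])
qed

end

theorem theorem3p1:
  fixes M :: "'w measure" and \<tau> :: "real ^ 'n::finite \<Rightarrow> 'w \<Rightarrow> 'w"
    and a :: "'w \<Rightarrow> real ^ 'n ^ 'n" and lam Lam :: "'w \<Rightarrow> real" and p q :: ennreal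
    and S :: "'w \<Rightarrow> 'p measure" and P :: "'w \<Rightarrow> real ^ 'n \<Rightarrow> 'p measure"
    and X :: "'w \<Rightarrow> ennreal \<Rightarrow> 'p \<Rightarrow> (real ^ 'n) option"
  assumes environment: "stationary_ergodic_environment M \<tau>"
    and a_measurable: "a \<in> borel_measurable M"
    and a_symmetric: "\<And>\<omega>. \<omega> \<in> space M \<Longrightarrow> transpose (a \<omega>) = a \<omega>"
    and lam_measurable: "lam \<in> borel_measurable M"
    and Lam_measurable: "Lam \<in> borel_measurable M"
    and lam_pos: "\<And>\<omega>. \<omega> \<in> space M \<Longrightarrow> 0 < lam \<omega>"
    and Lam_pos: "\<And>\<omega>. \<omega> \<in> space M \<Longrightarrow> 0 < Lam \<omega>"
    and ellipticity: "AE \<omega> in M. \<forall>\<xi>.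
          lam \<omega> * (norm \<xi>)\<^sup>2 \<le> (a \<omega> *v \<xi>) \<bullet> \<xi> \<and> (a \<omega> *v \<xi>) \<bullet> \<xi> \<le> Lam \<omega> * (norm \<xi>)\<^sup>2"
    and exponents: "1 \<le> p" "1 \<le> q" "1 / p + 1 / q < 2 / of_nat CARD('n)"
    and lam_moment: "finite_moment M (\<lambda>\<omega>. 1 / lam \<omega>) q"
    and Lam_moment: "finite_moment M Lam p"
    and lam_loc: "AE \<omega> in M. Linfty_loc (\<lambda>x. 1 / lam (\<tau> x \<omega>))"
    and Lam_loc: "AE \<omega> in M. Linfty_loc (\<lambda>x. Lam (\<tau> x \<omega>))"
    and diffusion: "AE \<omega> in M. minimal_diffusion (\<lambda>x. a (\<tau> x \<omega>)) (S \<omega>) (P \<omega>) (X \<omega>)"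
  shows "AE \<omega> in M. \<forall>x. \<P>(w in P \<omega> x. lifetime (X \<omega>) w = \<infinity>) = 1"
proof -
  interpret E: stationary_ergodic_environment M \<tau> by (rule environment)
  have "random_diffusion M \<tau> a lam Lam S P X"
  proof (intro random_diffusion.intro random_diffusion_axioms.intro environment)
    show "(\<integral>\<^sup>+\<omega>. ennreal (Lam \<omega>) \<partial>M) < \<infinity>"
      by (rule finite_moment_imp_finite_mean[OF E.prob_space_axioms Lam_measurable exponents(1) Lam_moment])
  qed (fact a_measurable a_symmetric Lam_measurable lam_pos Lam_pos ellipticity lam_loc Lam_loc diffusion)+
  then show ?thesis by (rule random_diffusion.AE_conservative)
qed

end
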